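(* Let $\ell\ge 2$ be an integer and let $x>0$ be real. For each $n\ge 1$, let $\mathsf{K}_{\ell,n}$ be the number of joint orbits of a random commuting $\ell$-tuple of permutations of $[n]$ with distribution $\mathbb{P}_{\ell,n,x}$. Let $(a_n)$ be a sequence of real numbers and $(b_n)$ a sequence of positive real numbers such that, as $n\to\infty$, \[ a_n = x\, Z_{\ell-1}^{[\ell]}\left(\left(Z_{\ell}^{[\ell]}\right)^{-1}\left(\frac{n}{x}\right)\right)+o\left(n^{\frac{\ell-1}{2\ell}}\right), \qquad b_n = \frac{(x\mathcal{K}_{\ell})^{\frac{1}{2\ell}}}{\sqrt{\ell(\ell-1)}}\, n^{\frac{\ell-1}{2\ell}}\,(1+o(1)), \] where $\left(Z_{\ell}^{[\ell]}\right)^{-1}$ denotes the inverse function of the bijection $Z_{\ell}^{[\ell]}:(0,\infty)\to(0,\infty)$. Then, for all $s\in\mathbb{R}$, \[ \lim_{n\to\infty}\ln \mathbb{E}\left[\exp\left(s\left(\frac{\mathsf{K}_{\ell,n}-a_n}{b_n}\right)\right)\right]=\frac{s^2}{2}. \]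
   Context: Let $[n]=\{1,\dots,n\}$ and let $\mathfrak{S}_n$ be the symmetric group on $[n]$. Let \[ \mathcal{C}_{\ell,n}=\{(\sigma_1,\dots,\sigma_\ell)\in\mathfrak{S}_n^{\ell}\ :\ \sigma_i\sigma_j=\sigma_j\sigma_i \text{ for all } i,j\}. \] For $(\sigma_1,\dots,\sigma_\ell)\in\mathcal{C}_{\ell,n}$, let $\kappa_{\ell,n}(\sigma_1,\dots,\sigma_\ell)$ be the number of orbits of the subgroup $\langle\sigma_1,\dots,\sigma_\ell\rangle$ acting on $[n]$. For $x>0$, $\mathbb{P}_{\ell,n,x}$ is the probability measure on $\mathcal{C}_{\ell,n}$ giving each tuple probability proportional to $x^{\kappa_{\ell,n}(\sigma_1,\dots,\sigma_\ell)}$, and $\mathsf{K}_{\ell,n}=\kappa_{\ell,n}(\sigma_1,\dots,\sigma_\ell)$ for a tuple sampled from $\mathbb{P}_{\ell,n,x}$; $\mathbb{E}$ is the corresponding expectation. The constant is $\mathcal{K}_{\ell}=(\ell-1)!\,\zeta(2)\zeta(3)\cdots\zeta(\ell)$, with $\zeta$ the Riemann zeta function. For $\ell\ge1$, $m\in\mathbb{Z}$ and $t\in(0,\infty)$, \[ Z_{m}^{[\ell]}(t)=\sum_{\delta_1,\dots,\delta_\ell=1}^{\infty}\delta_1^{m-1}\delta_2^{m-2}\cdots\delta_\ell^{m-\ell}\,e^{-\delta_1\delta_2\cdots\delta_\ell t}, \] a convergent series. For $\ell\ge 2$, the functions $Z_{\ell-1}^{[\ell]}$ and $Z_{\ell}^{[\ell]}$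 are bijections from $(0,\infty)$ to $(0,\infty)$. *)

theory Defs
  imports
    "HOL-Probability.Probability"
    "HOL-Algebra.Sym_Groups"
    "HOL-Algebra.Group_Action"
    "HOL-Algebra.Elementary_Groups"
begin

definition commuting_tuples :: "nat \<Rightarrow> nat \<Rightarrow> (nat \<Rightarrow> nat) list set" where
  "commuting_tuples l n =
     {\<sigma>. length \<sigma> = l \<and> set \<sigma> \<subseteq> carrier (sym_group n) \<and>
         (\<forall>i<l. \<forall>j<l. \<sigma> ! i \<otimes>\<^bsub>sym_group n\<^esub> \<sigma> ! j = \<sigma> ! j \<otimes>\<^bsub>sym_group n\<^esub> \<sigma> ! i)}"

text \<open>Elements of \<^const>\<open>BijGroup\<close> are extensional functions, whereas elements of
  \<^const>\<open>sym_group\<close> are the identity outside \<open>{1..n}\<close>; restricting to \<open>{1..n}\<close> turns the latter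
  into a group action in the sense of \<^locale>\<open>group_action\<close>.\<close>

definition num_orbits :: "nat \<Rightarrow> (nat \<Rightarrow> nat) list \<Rightarrow> nat" where
  "num_orbits n \<sigma> =
     card (orbits (subgroup_generated (sym_group n) (set \<sigma>)) {1..n} (\<lambda>g. restrict g {1..n}))"

definition commuting_measure :: "nat \<Rightarrow> nat \<Rightarrow> real \<Rightarrow> (nat \<Rightarrow> nat) list measure" where
  "commuting_measure l n x =
     point_measure (commuting_tuples l n)
       (\<lambda>\<sigma>. ennreal (x ^ num_orbits n \<sigma> / (\<Sum>\<tau>\<in>commuting_tuples l n. x ^ num_orbits n \<tau>)))"

text \<open>The Dirichlet series, which represents the Riemann zeta function for real \<open>s > 1\<close>.\<close>

definition real_zeta :: "real \<Rightarrow> real" where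
  "real_zeta s = (\<Sum>k. 1 / real (Suc k) powr s)"

definition K_const :: "nat \<Rightarrow> real" where
  "K_const l = fact (l - 1) * (\<Prod>k=2..l. real_zeta (real k))"

text \<open>The multiple series is an unordered sum over the tuples
  \<open>(\<delta>\<^sub>1, \<dots>, \<delta>\<^sub>l)\<close> of positive integers; all its terms are positive.\<close>

definition Z_fun :: "nat \<Rightarrow> int \<Rightarrow> real \<Rightarrow> real" where
  "Z_fun l m t =
     (\<Sum>\<^sub>\<infinity>\<delta>\<in>{1..l} \<rightarrow>\<^sub>E {1::nat..}.
        (\<Prod>i=1..l. real (\<delta> i) powi (m - int i)) * exp (- (\<Prod>i=1..l. real (\<delta> i)) * t))"

lemma group_action_restrict:
  "group_action (subgroup_generated (sym_group n) S) {1..n} (\<lambda>g. restrict g {1..n})"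
proof -
  interpret S: group "sym_group n" by (rule sym_group_is_group)
  have bij: "restrict p {1..n} \<in> Bij {1..n}" if "p permutes {1..n}" for p
    using that by (auto simp: Bij_def dest: permutes_imp_bij)
  have "(\<lambda>g. restrict g {1..n}) \<in> hom (sym_group n) (BijGroup {1..n})"
  proof (rule homI)
    fix p assume "p \<in> carrier (sym_group n)"
    then show "restrict p {1..n} \<in> carrier (BijGroup {1..n})"
      using bij by (simp add: BijGroup_def sym_group_carrier)
  next
    fix p q assume "p \<in> carrier (sym_group n)" "q \<in> carrier (sym_group n)"
    then have p: "p permutes {1..n}" and q: "q permutes {1..n}"
      by (simp_all add: sym_group_carrier)
    then show "restrict (p \<otimes>\<^bsub>sym_group n\<^esub> q) {1..n} =
      restrict p {1..n} \<otimes>\<^bsub>BijGroup {1..n}\<^esub> restrict q {1..n}"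
      using permutes_in_image[OF q] bij[OF p] bij[OF q]
      by (auto simp: BijGroup_def sym_group_mult compose_def fun_eq_iff simp del: atLeastAtMost_iff)
  qed
  then have "(\<lambda>g. restrict g {1..n}) \<in> hom (subgroup_generated (sym_group n) S) (BijGroup {1..n})"
    using S.carrier_subgroup_generated_subset[of S] by (auto simp: hom_def)
  then show ?thesis
    by (simp add: group_action_def group_hom_def group_hom_axioms_def group_BijGroup)
qed

lemma finite_commuting_tuples: "finite (commuting_tuples l n)"
proof (rule finite_subset)
  show "commuting_tuples l n \<subseteq> {\<sigma>. set \<sigma> \<subseteq> {p. p permutes {1..n}} \<and> length \<sigma> = l}"
    by (auto simp: commuting_tuples_def sym_group_def)
  show "finite {\<sigma>. set \<sigma> \<subseteq> {p. p permutes {1..n}} \<and> length \<sigma> = l}"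
    by (intro finite_lists_length_eq finite_permutations) simp
qed

lemma commuting_tuples_nonempty: "commuting_tuples l n \<noteq> {}"
proof -
  have "replicate l id \<in> commuting_tuples l n"
    by (auto simp: commuting_tuples_def sym_group_def permutes_id)
  then show ?thesis by blast
qed

lemma prob_space_commuting_measure:
  assumes "x > 0"
  shows "prob_space (commuting_measure l n x)"
proof
  let ?C = "commuting_tuples l n"
  have pos: "(\<Sum>\<tau>\<in>?C. x ^ num_orbits n \<tau>) > 0"
    using assms by (intro sum_pos finite_commuting_tuples commuting_tuples_nonempty) auto
  have "emeasure (commuting_measure l n x) (space (commuting_measure l n x)) =
    (\<Sum>\<sigma>\<in>?C. ennreal (x ^ num_orbits n \<sigma> / (\<Sum>\<tau>\<in>?C. x ^ num_orbits n \<tau>)))"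
    unfolding commuting_measure_def
    by (simp add: space_point_measure emeasure_point_measure_finite finite_commuting_tuples)
  also have "\<dots> = ennreal (\<Sum>\<sigma>\<in>?C. x ^ num_orbits n \<sigma> / (\<Sum>\<tau>\<in>?C. x ^ num_orbits n \<tau>))"
    using assms pos by (intro sum_ennreal) auto
  also have "\<dots> = 1"
    using pos by (simp flip: sum_divide_distrib)
  finally show "emeasure (commuting_measure l n x) (space (commuting_measure l n x)) = 1" .
qed

end

theory Submission
  imports Defs "HOL-Complex_Analysis.Complex_Analysis" "HOL-Real_Asymp.Real_Asymp"
begin

text \<open>Write \<open>P n y\<close> for the sum of \<open>y^\<kappa>\<close> over \<open>C(l,n)\<close> divided by \<open>n!\<close>, so that the moment generating
  function in question is, up to an explicit factor, \<open>P n (x * exp (s / b)) / P n x\<close>. Splitting off the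
  orbit of a point shows that the generating function of \<open>P n y\<close> is \<open>exp (y * F z)\<close>, where \<open>k\<close> times
  the \<open>k\<close>-th coefficient of \<open>F\<close> counts pointed transitive tuples up to relabelling, and \<open>F (exp (- t))\<close>
  is the series \<open>Z\<close> of index \<open>l - 1\<close>. The coefficients are evaluated by Cauchy's formula on the
  circle of radius \<open>exp (- \<tau>)\<close> with \<open>x * Z \<tau> = n\<close> for the series \<open>Z\<close> of index \<open>l\<close>. The saddle point
  \<open>\<tau>\<close> of the weight \<open>x\<close> is used for \<open>x * exp (s / b)\<close> as well. The resulting mismatch tilts the
  Gaussian integral and contributes \<open>- (l - 1) * s^2 / 2\<close>; the second order term of
  \<open>x * (exp (s / b) - 1) * F (exp (- \<tau>))\<close> contributes \<open>l * s^2 / 2\<close>.\<close>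

section \<open>Commuting tuples on finite sets\<close>

text \<open>The variance is a Schur complement. Write \<open>mj\<close> for
  \<open>moment f j \<tau>\<close> and \<open>d = l - 1\<close>. In the tilted model at the saddle
  point, size and number of orbits have covariances \<open>x * m2\<close>, \<open>x * m1\<close>,
  \<open>x * m0\<close>; conditioning on the size leaves the variance
  \<open>x * (m0 - m1^2 / m2)\<close>. Since \<open>moment f j t\<close> behaves like
  \<open>C * fact (d + j - 1) / t ^ (d + j)\<close> near \<open>0\<close>, this is asymptotically
  \<open>x * m0 / l\<close>, which is the square of the prescribed \<open>b n\<close>. Hence the two
  contributions \<open>l\<close> and \<open>-(l - 1)\<close>, with difference \<open>1\<close>.
  Keeping the saddle point of \<open>x\<close> for both weights makes
  \<open>exp (n * \<tau>)\<close> cancel in the quotient and leaves \<open>(y - x) * F\<close>,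
  whose part linear in \<open>s\<close> is exactly the centering by \<open>a n\<close>. The inverse
  function of \<open>Z\<close> never has to be expanded. The obstacle is the arithmetic irregularity
  of the coefficients, which gives no direct access to \<open>F\<close> off the real axis. The
  argument relies on limits of moments, obtained from real series alone, and on the lower bound
  \<open>f k \<ge> 1\<close>, for which \<open>l \<ge> 2\<close> is essential.\<close>

definition perm_tuples :: "nat \<Rightarrow> 'a set \<Rightarrow> ('a \<Rightarrow> 'a) list set" where
  "perm_tuples l A = {ts. length ts = l \<and> (\<forall>t\<in>set ts. t permutes A) \<and>
     (\<forall>t\<in>set ts. \<forall>u\<in>set ts. t \<circ> u = u \<circ> t)}"

text \<open>The closure uses the entries but not their inverses, so it is the orbit of a monoid. On
  a finite set this is the orbit of the generated group; \<open>orb_sym\<close> supplies the missing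
  symmetry.\<close>

inductive_set orb :: "('a \<Rightarrow> 'a) list \<Rightarrow> 'a \<Rightarrow> 'a set" for ts p where
  orb_base: "p \<in> orb ts p"
| orb_step: "a \<in> orb ts p \<Longrightarrow> t \<in> set ts \<Longrightarrow> t a \<in> orb ts p"

text \<open>Unlike \<open>restrict\<close>, this is the identity outside \<open>S\<close>, as
  \<open>permutes\<close> requires.\<close>

definition restr :: "'a set \<Rightarrow> ('a \<Rightarrow> 'a) \<Rightarrow> 'a \<Rightarrow> 'a" where
  "restr S f a = (if a \<in> S then f a else a)"

definition trans_tuples :: "nat \<Rightarrow> 'a set \<Rightarrow> 'a \<Rightarrow> ('a \<Rightarrow> 'a) list set" where
  "trans_tuples l S p = {ts \<in> perm_tuples l S. orb ts p = S}"

lemma orb_least: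
  assumes "p \<in> S" "\<And>t a. t \<in> set ts \<Longrightarrow> a \<in> S \<Longrightarrow> t a \<in> S"
  shows "orb ts p \<subseteq> S"
proof
  fix a assume "a \<in> orb ts p"
  then show "a \<in> S" by induction (use assms in auto)
qed

lemma perm_tuples_closed: "ts \<in> perm_tuples l A \<Longrightarrow> t \<in> set ts \<Longrightarrow> a \<in> A \<Longrightarrow> t a \<in> A"
  by (auto simp: perm_tuples_def permutes_in_image)

lemma orb_subset: "ts \<in> perm_tuples l A \<Longrightarrow> p \<in> A \<Longrightarrow> orb ts p \<subseteq> A"
  by (rule orb_least) (auto dest: perm_tuples_closed)

lemma finite_perm_tuples [simp]: "finite A \<Longrightarrow> finite (perm_tuples l A)"
  by (rule finite_subset[OF _ finite_lists_length_eq[of "{p. p permutes A}" l]])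
     (auto simp: perm_tuples_def finite_permutations)

lemma finite_trans_tuples [simp]: "finite S \<Longrightarrow> finite (trans_tuples l S p)"
  by (simp add: trans_tuples_def)

text \<open>An entry \<open>t\<close> maps the orbit of \<open>t a\<close> injectively into itself,
  hence onto it by finiteness. So \<open>t a\<close> has a preimage inside that orbit, and this
  preimage is \<open>a\<close>: every single step can be undone.\<close>

lemma orb_sym:
  assumes "finite A" "ts \<in> perm_tuples l A" "p \<in> A" "q \<in> orb ts p"
  shows "p \<in> orb ts q"
  using assms(4)
proof induction
  case orb_base show ?case by (rule orb.orb_base)
next
  case (orb_step a t)
  let ?O = "orb ts (t a)"
  have a: "a \<in> A" using orb_step orb_subset[OF assms(2,3)] by auto
  have tA: "t permutes A" using orb_step assms(2) by (auto simp: perm_tuples_def)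
  have "t a \<in> A" using a tA by (simp add: permutes_in_image)
  then have "?O \<subseteq> A" by (rule orb_subset[OF assms(2)])
  then have fin: "finite ?O" using assms(1) finite_subset by auto
  have "t ` ?O \<subseteq> ?O" using orb_step by (auto intro: orb.orb_step)
  moreover have "inj_on t ?O" using permutes_inj[OF tA] by (simp add: inj_on_def)
  ultimately have "t ` ?O = ?O" using fin by (simp add: endo_inj_surj)
  then obtain b where "b \<in> ?O" "t b = t a" using orb.orb_base[of "t a" ts] by (metis imageE)
  then have "a \<in> ?O" using permutes_inj[OF tA] by (auto dest: injD)
  have "orb ts a \<subseteq> ?O" by (rule orb_least[OF \<open>a \<in> ?O\<close>]) (rule orb.orb_step)
  then show ?case using orb_step by auto
qed

lemma orb_eq:
  assumes "finite A" "ts \<in> perm_tuples l A" "p \<in> A" "q \<in> orb ts p"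
  shows "orb ts q = orb ts p"
proof
  show "orb ts q \<subseteq> orb ts p" by (rule orb_least[OF assms(4)]) (rule orb_step)
  show "orb ts p \<subseteq> orb ts q"
    by (rule orb_least[OF orb_sym[OF assms]]) (rule orb_step)
qed

lemma restr_permutes:
  assumes "finite S" "inj t" "\<And>a. a \<in> S \<Longrightarrow> t a \<in> S"
  shows "restr S t permutes S"
proof (rule bij_imp_permutes)
  have "inj_on t S" using assms(2) by (simp add: inj_on_def)
  moreover have "t ` S = S" using assms by (intro endo_inj_surj) (auto simp: inj_on_def)
  ultimately have "bij_betw t S S" by (simp add: bij_betw_def)
  then show "bij_betw (restr S t) S S" by (rule bij_betw_cong[THEN iffD1, rotated]) (simp add: restr_def)
qed (simp add: restr_def)

lemma restr_tuples:
  assumes "finite S" "ts \<in> perm_tuples l A" "\<And>t a. t \<in> set ts \<Longrightarrow> a \<in> S \<Longrightarrow> t a \<in> S"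
  shows "map (restr S) ts \<in> perm_tuples l S"
proof -
  have "restr S t permutes S" if "t \<in> set ts" for t
    using that assms by (intro restr_permutes) (auto simp: perm_tuples_def dest: permutes_inj)
  moreover have "restr S t \<circ> restr S u = restr S u \<circ> restr S t" if "t \<in> set ts" "u \<in> set ts" for t u
  proof
    fix a
    have "t (u a) = u (t a)" using that assms(2) unfolding perm_tuples_def by (metis (mono_tags, lifting) comp_apply mem_Collect_eq)
    then show "(restr S t \<circ> restr S u) a = (restr S u \<circ> restr S t) a"
      using assms(3) that by (auto simp: restr_def)
  qed
  ultimately show ?thesis using assms(2) by (auto simp: perm_tuples_def)
qed

lemma orb_restr:
  assumes "q \<in> S" "\<And>t a. t \<in> set ts \<Longrightarrow> a \<in> S \<Longrightarrow> t a \<in> S"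
  shows "orb (map (restr S) ts) q = orb ts q"
proof
  have sub: "orb (map (restr S) ts) q \<subseteq> S"
    by (rule orb_least[OF assms(1)]) (use assms(2) in \<open>auto simp: restr_def\<close>)
  show "orb (map (restr S) ts) q \<subseteq> orb ts q"
    by (rule orb_least[OF orb_base]) (auto simp: restr_def intro: orb_step)
  show "orb ts q \<subseteq> orb (map (restr S) ts) q"
  proof (rule orb_least[OF orb_base])
    fix t a assume t: "t \<in> set ts" and a: "a \<in> orb (map (restr S) ts) q"
    have "restr S t a \<in> orb (map (restr S) ts) q" using t by (intro orb_step[OF a]) auto
    then show "t a \<in> orb (map (restr S) ts) q" using a sub by (auto simp: restr_def)
  qed
qed

text \<open>For tuples with disjoint supports, composition is their common extension; the two
  restrictions undo it.\<close>

definition merge :: "('a \<Rightarrow> 'a) list \<Rightarrow> ('a \<Rightarrow> 'a) list \<Rightarrow> ('a \<Rightarrow> 'a) list" where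
  "merge us vs = map2 (\<circ>) us vs"

lemma merge_tuples:
  assumes "us \<in> perm_tuples l S" "vs \<in> perm_tuples l T" "S \<inter> T = {}"
  shows "merge us vs \<in> perm_tuples l (S \<union> T)" (is ?P)
    and "map (restr S) (merge us vs) = us" (is ?Q)
    and "map (restr T) (merge us vs) = vs" (is ?R)
    and "\<And>t a. t \<in> set (merge us vs) \<Longrightarrow> a \<in> S \<Longrightarrow> t a \<in> S"
    and "\<And>t a. t \<in> set (merge us vs) \<Longrightarrow> a \<in> T \<Longrightarrow> t a \<in> T"
proof -
  have len: "length us = l" "length vs = l" using assms by (auto simp: perm_tuples_def)
  have U: "us ! i permutes S" and V: "vs ! i permutes T" if "i < l" for i
    using assms that len by (auto simp: perm_tuples_def)
  have nth: "merge us vs ! i = us ! i \<circ> vs ! i" if "i < l" for i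
    using that len by (simp add: merge_def)
  have lm: "length (merge us vs) = l" using len by (simp add: merge_def)
  have onS: "(merge us vs ! i) a = (us ! i) a" "(us ! i) a \<in> S" if "i < l" "a \<in> S" for i a
  proof -
    have "a \<notin> T" using that assms(3) by auto
    then show "(merge us vs ! i) a = (us ! i) a" "(us ! i) a \<in> S"
      using that nth permutes_not_in[OF V[OF that(1)], of a] permutes_in_image[OF U[OF that(1)], of a] by auto
  qed
  have onT: "(merge us vs ! i) a = (vs ! i) a" "(vs ! i) a \<in> T" if "i < l" "a \<in> T" for i a
  proof -
    show "(vs ! i) a \<in> T" using that by (simp add: permutes_in_image[OF V])
    then have "(vs ! i) a \<notin> S" using assms(3) by auto
    then show "(merge us vs ! i) a = (vs ! i) a"
      using that nth permutes_not_in[OF U[OF that(1)], of "(vs ! i) a"] by auto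
  qed
  have out: "(merge us vs ! i) a = a" if "i < l" "a \<notin> S \<union> T" for i a
    using that nth permutes_not_in[OF U[OF that(1)]] permutes_not_in[OF V[OF that(1)]] by auto
  have cU: "(us ! i) ((us ! j) a) = (us ! j) ((us ! i) a)" if "i < l" "j < l" for i j a
    using assms(1) that len unfolding perm_tuples_def by (auto simp: fun_eq_iff)
  have cV: "(vs ! i) ((vs ! j) a) = (vs ! j) ((vs ! i) a)" if "i < l" "j < l" for i j a
    using assms(2) that len unfolding perm_tuples_def by (auto simp: fun_eq_iff)
  show "t a \<in> S" if "t \<in> set (merge us vs)" "a \<in> S" for t a
    using that onS lm by (auto simp: in_set_conv_nth)
  show "t a \<in> T" if "t \<in> set (merge us vs)" "a \<in> T" for t a
    using that onT lm by (auto simp: in_set_conv_nth)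
  have perm: "merge us vs ! i permutes (S \<union> T)" if "i < l" for i
    unfolding nth[OF that] using U[OF that] V[OF that]
    by (intro permutes_compose) (auto intro: permutes_subset)
  have comm: "merge us vs ! i \<circ> merge us vs ! j = merge us vs ! j \<circ> merge us vs ! i"
    if "i < l" "j < l" for i j
  proof
    fix a
    consider "a \<in> S" | "a \<in> T" | "a \<notin> S \<union> T" by blast
    then show "(merge us vs ! i \<circ> merge us vs ! j) a = (merge us vs ! j \<circ> merge us vs ! i) a"
      by cases (use that onS onT out cU cV in auto)
  qed
  show ?P using perm comm lm by (auto simp: perm_tuples_def in_set_conv_nth)
  show ?Q
    by (rule nth_equalityI)
       (use len lm onS permutes_not_in[OF U] in \<open>auto simp: restr_def fun_eq_iff\<close>)
  show ?R
    by (rule nth_equalityI)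
       (use len lm onT permutes_not_in[OF V] in \<open>auto simp: restr_def fun_eq_iff\<close>)
qed

lemma merge_restr:
  assumes "ts \<in> perm_tuples l A" "S \<subseteq> A"
    "\<And>t a. t \<in> set ts \<Longrightarrow> a \<in> A - S \<Longrightarrow> t a \<in> A - S"
  shows "merge (map (restr S) ts) (map (restr (A - S)) ts) = ts"
proof (rule nth_equalityI)
  fix i assume "i < length (merge (map (restr S) ts) (map (restr (A - S)) ts))"
  then have i: "i < length ts" by (simp add: merge_def)
  then have p: "ts ! i permutes A" using assms(1) by (auto simp: perm_tuples_def)
  have "restr S (ts ! i) (restr (A - S) (ts ! i) a) = (ts ! i) a" for a
    using assms(2) assms(3)[OF nth_mem[OF i], of a] permutes_not_in[OF p, of a]
    by (auto simp: restr_def)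
  then show "merge (map (restr S) ts) (map (restr (A - S)) ts) ! i = ts ! i"
    using i by (auto simp: merge_def)
qed (simp add: merge_def)

text \<open>Arbitrary finite sets replace \<open>{1..n}\<close> because the recursion passes to the
  complement of an orbit.\<close>

definition orbit_poly :: "nat \<Rightarrow> real \<Rightarrow> 'a set \<Rightarrow> real" where
  "orbit_poly l x A = (\<Sum>ts\<in>perm_tuples l A. x ^ card (orb ts ` A))"

lemma card_orbits_merge:
  assumes "finite A" "S \<subseteq> A" "p \<in> S" "us \<in> trans_tuples l S p" "vs \<in> perm_tuples l (A - S)"
  shows "card (orb (merge us vs) ` A) = Suc (card (orb vs ` (A - S)))"
proof -
  let ?ts = "merge us vs"
  have us: "us \<in> perm_tuples l S" "orb us p = S" using assms(4) by (auto simp: trans_tuples_def)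
  have fS: "finite S" using assms finite_subset by auto
  note m = merge_tuples[OF us(1) assms(5)]
  have 1: "orb ?ts q = S" if "q \<in> S" for q
    using orb_restr[OF that, of ?ts] m that orb_eq[OF fS us(1) assms(3), of q] us(2) by auto
  have 2: "orb ?ts q = orb vs q" if "q \<in> A - S" for q
    using orb_restr[OF that, of ?ts] m that by auto
  have "orb ?ts ` A = orb ?ts ` S \<union> orb ?ts ` (A - S)" using assms(2) by auto
  also have "orb ?ts ` S = {S}" using 1 assms(3) by auto
  also have "orb ?ts ` (A - S) = orb vs ` (A - S)" using 2 by auto
  finally have eq: "orb ?ts ` A = insert S (orb vs ` (A - S))" by auto
  have "S \<notin> orb vs ` (A - S)"
  proof
    assume "S \<in> orb vs ` (A - S)"
    then obtain q where "q \<in> A - S" "S = orb vs q" by auto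
    then have "q \<in> S" using orb_base by metis
    then show False using \<open>q \<in> A - S\<close> by auto
  qed
  then show ?thesis unfolding eq using assms(1) by simp
qed

text \<open>Cutting a tuple along the orbit \<open>S\<close> of \<open>p\<close> gives a transitive
  tuple on \<open>S\<close> and an arbitrary one on \<open>A - S\<close>, chosen independently. The
  factor \<open>x\<close> records the orbit \<open>S\<close> itself.\<close>

lemma orbit_poly_decomp:
  assumes "finite A" "p \<in> A"
  shows "orbit_poly l x A =
    (\<Sum>S | p \<in> S \<and> S \<subseteq> A. x * real (card (trans_tuples l S p)) * orbit_poly l x (A - S))"
proof -
  let ?I = "{S. p \<in> S \<and> S \<subseteq> A}"
  have finI: "finite ?I" using assms by simp
  have fS: "finite S" if "S \<in> ?I" for S using that assms finite_subset by auto
  have "orbit_poly l x A =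
    (\<Sum>(S, us, vs)\<in>Sigma ?I (\<lambda>S. trans_tuples l S p \<times> perm_tuples l (A - S)).
       x * x ^ card (orb vs ` (A - S)))"
    unfolding orbit_poly_def
  proof (rule sum.reindex_bij_witness[where
      i = "\<lambda>(S, us, vs). merge us vs" and
      j = "\<lambda>ts. (orb ts p, map (restr (orb ts p)) ts, map (restr (A - orb ts p)) ts)"])
    fix ts assume ts: "ts \<in> perm_tuples l A"
    let ?S = "orb ts p"
    have sub: "?S \<subseteq> A" using orb_subset[OF ts assms(2)] .
    have cl1: "t a \<in> ?S" if "t \<in> set ts" "a \<in> ?S" for t a using that by (rule orb_step[rotated])
    \<comment> \<open>If \<open>t a\<close> were in the orbit of \<open>p\<close>, then so would be
      \<open>a\<close>, which lies in the orbit of \<open>t a\<close> by symmetry.\<close>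
    have cl2: "t a \<in> A - ?S" if "t \<in> set ts" "a \<in> A - ?S" for t a
    proof -
      have "t a \<in> A" using perm_tuples_closed[OF ts] that by auto
      moreover have "a \<in> orb ts (t a)"
        using that orb_sym[OF assms(1) ts _ orb_step[OF orb_base]] by auto
      ultimately show ?thesis
        using orb_eq[OF assms(1) ts assms(2), of "t a"] that by blast
    qed
    show *: "(\<lambda>(S, us, vs). merge us vs)
           (?S, map (restr ?S) ts, map (restr (A - ?S)) ts) = ts"
      unfolding prod.case by (rule merge_restr[OF ts sub]) (rule cl2)
    have fin: "finite ?S" "finite (A - ?S)" using sub assms finite_subset by auto
    have us: "map (restr ?S) ts \<in> trans_tuples l ?S p"
      using restr_tuples[OF fin(1) ts] orb_restr[of p ?S ts] cl1 orb_base[of p ts]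
      by (auto simp: trans_tuples_def)
    have vs: "map (restr (A - ?S)) ts \<in> perm_tuples l (A - ?S)"
      by (rule restr_tuples[OF fin(2) ts]) (rule cl2)
    show "(?S, map (restr ?S) ts, map (restr (A - ?S)) ts)
      \<in> Sigma ?I (\<lambda>S. trans_tuples l S p \<times> perm_tuples l (A - S))"
      using us vs sub orb_base[of p ts] by auto
    show "(case (?S, map (restr ?S) ts, map (restr (A - ?S)) ts) of
          (S, us, vs) \<Rightarrow> x * x ^ card (orb vs ` (A - S))) = x ^ card (orb ts ` A)"
      using card_orbits_merge[OF assms(1) sub orb_base us vs] * by simp
  next
    fix b assume b: "b \<in> Sigma ?I (\<lambda>S. trans_tuples l S p \<times> perm_tuples l (A - S))"
    obtain S us vs where [simp]: "b = (S, us, vs)" by (cases b) auto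
    have S: "p \<in> S" "S \<subseteq> A" and us: "us \<in> perm_tuples l S" "orb us p = S"
      and vs: "vs \<in> perm_tuples l (A - S)" using b by (auto simp: trans_tuples_def)
    have AS: "S \<union> (A - S) = A" using S by auto
    note m = merge_tuples[OF us(1) vs, unfolded AS]
    show "(case b of (S, us, vs) \<Rightarrow> merge us vs) \<in> perm_tuples l A" using m by auto
    have "orb (merge us vs) p = S"
      using orb_restr[OF S(1), of "merge us vs"] m us by auto
    then show "(orb (case b of (S, us, vs) \<Rightarrow> merge us vs) p,
          map (restr (orb (case b of (S, us, vs) \<Rightarrow> merge us vs) p)) (case b of (S, us, vs) \<Rightarrow> merge us vs),
          map (restr (A - orb (case b of (S, us, vs) \<Rightarrow> merge us vs) p)) (case b of (S, us, vs) \<Rightarrow> merge us vs)) = b"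
      using m by auto
  qed
  also have "\<dots> = (\<Sum>S\<in>?I. \<Sum>(us, vs)\<in>trans_tuples l S p \<times> perm_tuples l (A - S). x * x ^ card (orb vs ` (A - S)))"
    by (subst sum.Sigma) (use finI fS assms in \<open>auto simp: split_def\<close>)
  also have "\<dots> = (\<Sum>S\<in>?I. x * real (card (trans_tuples l S p)) * orbit_poly l x (A - S))"
    by (rule sum.cong) (simp_all add: sum.cartesian_product[symmetric] orbit_poly_def sum_distrib_left mult_ac)
  finally show ?thesis .
qed

section \<open>Centralizers of transitive commuting tuples\<close>

definition centralizer :: "'a set \<Rightarrow> ('a \<Rightarrow> 'a) list \<Rightarrow> ('a \<Rightarrow> 'a) set" where
  "centralizer S us = {\<alpha>. \<alpha> permutes S \<and> (\<forall>u\<in>set us. \<alpha> \<circ> u = u \<circ> \<alpha>)}"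

lemma commute_eq_on_orb:
  assumes "f p = g p" "\<And>u a. u \<in> set us \<Longrightarrow> a \<in> orb us p \<Longrightarrow> f (u a) = u (f a)"
    "\<And>u a. u \<in> set us \<Longrightarrow> a \<in> orb us p \<Longrightarrow> g (u a) = u (g a)" "a \<in> orb us p"
  shows "f a = g a"
  using assms(4) by induction (use assms(1-3) in auto)

text \<open>As the entries commute with each other, they lie in the centralizer themselves;
  composing them along a path from \<open>p\<close> reaches every point of the orbit.\<close>

lemma orb_element_in_centralizer:
  assumes "us \<in> perm_tuples l S" "p \<in> S" "q \<in> orb us p"
  shows "\<exists>g\<in>centralizer S us. g p = q"
  using assms(3)
proof induction
  case orb_base
  have "id \<in> centralizer S us" by (auto simp: centralizer_def permutes_id)
  then show ?case by (intro bexI[of _ id]) auto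
next
  case (orb_step a t)
  then obtain g where g: "g \<in> centralizer S us" "g p = a" by auto
  have "t permutes S" using orb_step assms(1) by (auto simp: perm_tuples_def)
  moreover have "(t \<circ> g) \<circ> u = u \<circ> (t \<circ> g)" if "u \<in> set us" for u
  proof -
    have "t \<circ> u = u \<circ> t" using that orb_step assms(1) by (auto simp: perm_tuples_def)
    moreover have "g \<circ> u = u \<circ> g" using that g by (auto simp: centralizer_def)
    ultimately show ?thesis by (metis comp_assoc)
  qed
  ultimately have "t \<circ> g \<in> centralizer S us"
    using g by (auto simp: centralizer_def intro: permutes_compose)
  then show ?case using g by (intro bexI[of _ "t \<circ> g"]) auto
qed

text \<open>The centralizer acts regularly: evaluation at \<open>p\<close> is onto \<open>S\<close>
  because the tuple is commutative and transitive, and injective because the image of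
  \<open>p\<close> determines the images along the whole orbit.\<close>

lemma card_centralizer:
  assumes "finite S" "us \<in> trans_tuples l S p" "p \<in> S"
  shows "card (centralizer S us) = card S"
proof -
  have us: "us \<in> perm_tuples l S" "orb us p = S" using assms by (auto simp: trans_tuples_def)
  have "inj_on (\<lambda>g. g p) (centralizer S us)"
  proof (rule inj_onI)
    fix g h assume g: "g \<in> centralizer S us" and h: "h \<in> centralizer S us" and eq: "g p = h p"
    show "g = h"
    proof
      fix a show "g a = h a"
      proof (cases "a \<in> S")
        case True
        show ?thesis
          by (rule commute_eq_on_orb[where us = us and p = p])
             (use g h eq us True in \<open>auto simp: centralizer_def fun_eq_iff\<close>)
      next
        case False
        then show ?thesis using g h by (auto simp: centralizer_def permutes_not_in)
      qed
    qed
  qed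
  moreover have "(\<lambda>g. g p) ` centralizer S us = S"
  proof
    show "(\<lambda>g. g p) ` centralizer S us \<subseteq> S"
      using assms(3) by (auto simp: centralizer_def permutes_in_image)
    show "S \<subseteq> (\<lambda>g. g p) ` centralizer S us"
      using orb_element_in_centralizer[OF us(1) assms(3)] us(2) by force
  qed
  ultimately show ?thesis by (metis card_image)
qed

section \<open>Transitive tuples built from blocks\<close>

definition transport :: "'b set \<Rightarrow> ('b \<Rightarrow> 'a) \<Rightarrow> ('b \<Rightarrow> 'b) \<Rightarrow> 'a \<Rightarrow> 'a" where
  "transport M e g a = (if a \<in> e ` M then e (g (inv_into M e a)) else a)"

lemma transport_apply: "inj_on e M \<Longrightarrow> z \<in> M \<Longrightarrow> transport M e g (e z) = e (g z)"
  by (simp add: transport_def)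

lemma transport_not_in: "a \<notin> e ` M \<Longrightarrow> transport M e g a = a"
  by (simp add: transport_def)

lemma transport_permutes:
  assumes "bij_betw e M S" "bij_betw g M M"
  shows "transport M e g permutes S"
proof (rule bij_imp_permutes)
  have "bij_betw (e \<circ> (g \<circ> inv_into M e)) S S"
    using assms by (intro bij_betw_trans[OF bij_betw_trans[OF bij_betw_inv_into]])
  then show "bij_betw (transport M e g) S S"
    by (rule bij_betw_cong[THEN iffD1, rotated])
       (use assms(1) in \<open>auto simp: transport_def bij_betw_def\<close>)
  show "transport M e g a = a" if "a \<notin> S" for a
    using that assms(1) by (simp add: transport_not_in bij_betw_def)
qed

lemma transport_commute:
  assumes "inj_on e M" "\<And>z. z \<in> M \<Longrightarrow> g z \<in> M" "\<And>z. z \<in> M \<Longrightarrow> h z \<in> M"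
    "\<And>z. z \<in> M \<Longrightarrow> g (h z) = h (g z)"
  shows "transport M e g \<circ> transport M e h = transport M e h \<circ> transport M e g"
proof
  fix a
  show "(transport M e g \<circ> transport M e h) a = (transport M e h \<circ> transport M e g) a"
  proof (cases "a \<in> e ` M")
    case True
    then obtain z where "z \<in> M" "a = e z" by auto
    then show ?thesis using assms by (simp add: transport_apply)
  qed (simp add: transport_not_in)
qed

text \<open>The model of the first entry: it moves each of \<open>d\<close> copies of
  \<open>T\<close> to the next one, and \<open>\<alpha>\<close> is the monodromy picked up on
  returning to copy \<open>0\<close>.\<close>

definition block_shift :: "nat \<Rightarrow> ('a \<Rightarrow> 'a) \<Rightarrow> nat \<times> 'a \<Rightarrow> nat \<times> 'a" where
  "block_shift d \<alpha> = (\<lambda>(m, y). if Suc m < d then (Suc m, y) else (0, \<alpha> y))"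

text \<open>Copy \<open>0\<close> must be \<open>T\<close> itself because \<open>e (0, y)\<close>
  stands for the zeroth power of the first entry at \<open>y\<close>. Extensionality fixes
  \<open>e\<close> off its domain, so that such maps can be counted.\<close>

definition bijections_ext :: "nat \<Rightarrow> 'a set \<Rightarrow> 'a set \<Rightarrow> (nat \<times> 'a \<Rightarrow> 'a) set" where
  "bijections_ext d T S =
     {e \<in> extensional ({..<d} \<times> T). bij_betw e ({..<d} \<times> T) S \<and> (\<forall>y\<in>T. e (0, y) = y)}"

text \<open>A transitive tuple \<open>\<tau> # us\<close> on \<open>S\<close> is determined by the orbit \<open>T\<close> of \<open>p\<close> under \<open>us\<close>, the action
  of \<open>us\<close> on \<open>T\<close>, the bijection \<open>e (m, y) = (\<tau> ^^ m) y\<close> from \<open>{..<d} \<times> T\<close> onto \<open>S\<close>, and the action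
  \<open>\<alpha>\<close> of \<open>\<tau> ^^ d\<close> on \<open>T\<close>, an arbitrary element of the centralizer.\<close>

definition assemble :: "nat \<Rightarrow> 'a set \<Rightarrow> ('a \<Rightarrow> 'a) list \<Rightarrow> (nat \<times> 'a \<Rightarrow> 'a) \<Rightarrow> ('a \<Rightarrow> 'a) \<Rightarrow> ('a \<Rightarrow> 'a) list" where
  "assemble d T us e \<alpha> = transport ({..<d} \<times> T) e (block_shift d \<alpha>) #
     map (\<lambda>u. transport ({..<d} \<times> T) e (\<lambda>(m, y). (m, u y))) us"

definition fibre :: "nat \<Rightarrow> 'a set \<Rightarrow> 'a \<Rightarrow> 'a set \<Rightarrow> ('a \<Rightarrow> 'a) list \<Rightarrow> ('a \<Rightarrow> 'a) list set" where
  "fibre l S p T us = {ts \<in> trans_tuples (Suc l) S p. orb (tl ts) p = T \<and> map (restr T) (tl ts) = us}"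

text \<open>With one such bijection \<open>e0\<close> chosen, every other one is its composition
  with a unique permutation of \<open>S - T\<close>.\<close>

lemma card_bijections_ext:
  assumes "finite S" "T \<subseteq> S" "card S = d * card T" "d > 0"
  shows "card (bijections_ext d T S) = fact (card S - card T)"
proof -
  let ?M = "{..<d} \<times> T"
  have fT: "finite T" using assms finite_subset by auto
  have "card (?M - {0} \<times> T) = card (S - T)"
    using assms fT by (subst card_Diff_subset) (auto simp: card_Diff_subset)
  then obtain f where f: "bij_betw f (?M - {0} \<times> T) (S - T)"
    using assms fT by (meson finite_Diff finite_SigmaI finite_lessThan finite_same_card_bij)
  define e0 where "e0 = (\<lambda>(m, y). if m = 0 then y else f (m, y))"
  have "bij_betw e0 ({0} \<times> T) T" by (auto simp: bij_betw_def e0_def inj_on_def image_iff)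
  moreover have "bij_betw e0 (?M - {0} \<times> T) (S - T)"
    using f by (rule bij_betw_cong[THEN iffD1, rotated]) (auto simp: e0_def split: if_splits)
  ultimately have "bij_betw e0 ({0} \<times> T \<union> (?M - {0} \<times> T)) (T \<union> (S - T))"
    by (rule bij_betw_combine) auto
  moreover have "{0} \<times> T \<union> (?M - {0} \<times> T) = ?M" "T \<union> (S - T) = S" using assms by auto
  ultimately have e0: "bij_betw e0 ?M S" by simp
  have "bij_betw (\<lambda>\<pi>. restrict (\<pi> \<circ> e0) ?M) {\<pi>. \<pi> permutes (S - T)} (bijections_ext d T S)"
  proof (rule bij_betwI')
    fix \<pi> \<rho> assume "\<pi> \<in> {\<pi>. \<pi> permutes (S - T)}" "\<rho> \<in> {\<pi>. \<pi> permutes (S - T)}"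
    then have p: "\<pi> permutes (S - T)" "\<rho> permutes (S - T)" by auto
    show "(restrict (\<pi> \<circ> e0) ?M = restrict (\<rho> \<circ> e0) ?M) = (\<pi> = \<rho>)"
    proof
      assume eq: "restrict (\<pi> \<circ> e0) ?M = restrict (\<rho> \<circ> e0) ?M"
      show "\<pi> = \<rho>"
      proof
        fix a show "\<pi> a = \<rho> a"
        proof (cases "a \<in> S - T")
          case True
          then obtain z where "z \<in> ?M" "a = e0 z" using e0 by (auto simp: bij_betw_def)
          then show ?thesis using fun_cong[OF eq, of z] by simp
        qed (use p in \<open>auto simp: permutes_not_in\<close>)
      qed
    qed simp
  next
    fix \<pi> assume "\<pi> \<in> {\<pi>. \<pi> permutes (S - T)}"
    then have p: "\<pi> permutes (S - T)" by auto
    then have "bij_betw \<pi> S S" by (intro permutes_imp_bij) (auto intro: permutes_subset)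
    then have "bij_betw (\<pi> \<circ> e0) ?M S" using e0 by (rule bij_betw_trans[rotated])
    then have "bij_betw (restrict (\<pi> \<circ> e0) ?M) ?M S" by simp
    moreover have "\<pi> (e0 (0, y)) = y" if "y \<in> T" for y
      using that permutes_not_in[OF p, of y] by (simp add: e0_def)
    ultimately show "restrict (\<pi> \<circ> e0) ?M \<in> bijections_ext d T S"
      using assms by (auto simp: bijections_ext_def)
  next
    fix e assume e: "e \<in> bijections_ext d T S"
    then have eb: "bij_betw e ?M S" and e_ext: "e \<in> extensional ?M" and ey: "\<And>y. y \<in> T \<Longrightarrow> e (0, y) = y"
      by (auto simp: bijections_ext_def)
    define \<pi> where "\<pi> = restr S (e \<circ> inv_into ?M e0)"
    have "bij_betw (e \<circ> inv_into ?M e0) S S"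
      by (rule bij_betw_trans[OF bij_betw_inv_into[OF e0] eb])
    then have "bij_betw \<pi> S S" by (rule bij_betw_cong[THEN iffD1, rotated]) (simp add: \<pi>_def restr_def)
    then have pS: "\<pi> permutes S" by (rule bij_imp_permutes) (simp add: \<pi>_def restr_def)
    have pe: "\<pi> (e0 z) = e z" if "z \<in> ?M" for z
      using that e0 by (auto simp: \<pi>_def restr_def bij_betw_def)
    have "\<pi> y = y" if "y \<in> T" for y
      using pe[of "(0, y)"] that ey assms(4) by (simp add: e0_def)
    then have "\<pi> permutes (S - T)" by (intro permutes_superset[OF pS]) auto
    moreover have "e = restrict (\<pi> \<circ> e0) ?M"
      by (rule extensionalityI[OF e_ext]) (auto simp: pe)
    ultimately show "\<exists>\<pi>\<in>{\<pi>. \<pi> permutes (S - T)}. e = restrict (\<pi> \<circ> e0) ?M" by auto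
  qed
  then have "card (bijections_ext d T S) = card {\<pi>. \<pi> permutes (S - T)}"
    by (simp add: bij_betw_same_card)
  also have "\<dots> = fact (card (S - T))" using assms by (intro card_permutations) auto
  also have "card (S - T) = card S - card T" using assms fT by (simp add: card_Diff_subset)
  finally show ?thesis .
qed

lemma fibre_trans:
  assumes "ts \<in> fibre l S p T us"
  shows "ts = hd ts # tl ts" "tl ts \<in> perm_tuples l S" "orb (tl ts) p = T"
    "map (restr T) (tl ts) = us" "hd ts permutes S" "orb ts p = S" "ts \<in> perm_tuples (Suc l) S"
    "\<And>v. v \<in> set (tl ts) \<Longrightarrow> hd ts \<circ> v = v \<circ> hd ts"
proof -
  have ts: "ts \<in> perm_tuples (Suc l) S" "orb ts p = S" "orb (tl ts) p = T" "map (restr T) (tl ts) = us"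
    using assms unfolding fibre_def trans_tuples_def by blast+
  have len: "length ts = Suc l" and perm: "\<forall>t\<in>set ts. t permutes S"
    and comm: "\<forall>t\<in>set ts. \<forall>u\<in>set ts. t \<circ> u = u \<circ> t"
    using ts(1) unfolding perm_tuples_def by blast+
  have ne: "ts \<noteq> []" using len by auto
  show "ts = hd ts # tl ts" using ne by simp
  have sub: "set (tl ts) \<subseteq> set ts" "hd ts \<in> set ts" using ne by (auto dest: list.set_sel)
  have "length (tl ts) = l" using len by simp
  then show "tl ts \<in> perm_tuples l S" unfolding perm_tuples_def using perm comm sub(1) by blast
  show "hd ts permutes S" using perm sub(2) by blast
  show "hd ts \<circ> v = v \<circ> hd ts" if "v \<in> set (tl ts)" for v using comm sub that by blast
  show "orb (tl ts) p = T" "map (restr T) (tl ts) = us" "orb ts p = S" "ts \<in> perm_tuples (Suc l) S"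
    by (fact ts)+
qed

lemma bij_betw_block_shift:
  assumes "finite T" "\<alpha> permutes T"
  shows "bij_betw (block_shift d \<alpha>) ({..<d} \<times> T) ({..<d} \<times> T)"
proof -
  have "inj_on (block_shift d \<alpha>) ({..<d} \<times> T)"
    using permutes_inj[OF assms(2)]
    by (auto simp: inj_on_def block_shift_def split: if_splits dest: injD)
  moreover have "block_shift d \<alpha> ` ({..<d} \<times> T) \<subseteq> {..<d} \<times> T"
    using assms(2) by (auto simp: block_shift_def permutes_in_image split: if_splits)
  ultimately show ?thesis using assms(1) endo_inj_surj[of "{..<d} \<times> T"] by (simp add: bij_betw_def)
qed

lemma bij_betw_lift:
  assumes "u permutes T"
  shows "bij_betw (\<lambda>(m, y). (m, u y)) ({..<d} \<times> T) ({..<d} \<times> T)"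
  by (rule bij_betw_byWitness[where f' = "\<lambda>(m, y). (m, inv_into UNIV u y)"])
     (use assms in \<open>auto simp: permutes_inverses permutes_in_image permutes_in_image[OF permutes_inv]\<close>)

text \<open>Transitivity holds because the tail reaches all of copy \<open>0\<close> and powers of
  the first entry carry it to the other copies. The last two conclusions recover \<open>e\<close>
  and \<open>\<alpha>\<close> from the tuple, which gives injectivity in
  \<open>card_fibre\<close>.\<close>

lemma assemble_fibre:
  assumes fin: "finite S" and p: "p \<in> T" and sub: "T \<subseteq> S" and us: "us \<in> trans_tuples l T p"
    and d: "d > 0" and e: "e \<in> bijections_ext d T S" and \<alpha>: "\<alpha> \<in> centralizer T us"
  shows "assemble d T us e \<alpha> \<in> fibre l S p T us"
    and "\<And>m y. m < d \<Longrightarrow> y \<in> T \<Longrightarrow> (hd (assemble d T us e \<alpha>) ^^ m) y = e (m, y)"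
    and "\<And>y. y \<in> T \<Longrightarrow> (hd (assemble d T us e \<alpha>) ^^ d) y = \<alpha> y"
proof -
  let ?M = "{..<d} \<times> T" and ?ts = "assemble d T us e \<alpha>"
  let ?lift = "\<lambda>u::'a\<Rightarrow>'a. \<lambda>(m::nat, y). (m, u y)"
  have fT: "finite T" using fin sub finite_subset by auto
  have usT: "us \<in> perm_tuples l T" "orb us p = T" using us by (auto simp: trans_tuples_def)
  have eb: "bij_betw e ?M S" and ey: "\<And>y. y \<in> T \<Longrightarrow> e (0, y) = y"
    using e by (auto simp: bijections_ext_def)
  have einj: "inj_on e ?M" and eim: "e ` ?M = S" using eb by (auto simp: bij_betw_def)
  have \<alpha>T: "\<alpha> permutes T" and \<alpha>c: "\<And>u a. u \<in> set us \<Longrightarrow> \<alpha> (u a) = u (\<alpha> a)"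
    using \<alpha> by (auto simp: centralizer_def fun_eq_iff)
  have uT: "u permutes T" if "u \<in> set us" for u using that usT by (auto simp: perm_tuples_def)
  have uc: "u (v a) = v (u a)" if "u \<in> set us" "v \<in> set us" for u v a
    using that usT unfolding perm_tuples_def by (auto simp: fun_eq_iff)
  define \<tau> where "\<tau> = transport ?M e (block_shift d \<alpha>)"
  define L where "L = (\<lambda>u. transport ?M e (?lift u))"
  have ts: "?ts = \<tau> # map L us" by (simp add: assemble_def \<tau>_def L_def)
  have \<tau>S: "\<tau> permutes S"
    unfolding \<tau>_def by (rule transport_permutes[OF eb bij_betw_block_shift[OF fT \<alpha>T]])
  have LS: "L u permutes S" if "u \<in> set us" for u
    unfolding L_def by (rule transport_permutes[OF eb bij_betw_lift[OF uT[OF that]]])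
  have \<tau>L: "\<tau> \<circ> L u = L u \<circ> \<tau>" if "u \<in> set us" for u
    unfolding \<tau>_def L_def using that uT[OF that] \<alpha>T
    by (intro transport_commute[OF einj]) (auto simp: block_shift_def permutes_in_image \<alpha>c)
  have LL: "L u \<circ> L v = L v \<circ> L u" if "u \<in> set us" "v \<in> set us" for u v
    unfolding L_def using that uT
    by (intro transport_commute[OF einj]) (auto simp: permutes_in_image uc)
  have tsS: "?ts \<in> perm_tuples (Suc l) S"
    unfolding ts using \<tau>S LS \<tau>L LL usT by (auto simp: perm_tuples_def)
  have Ly: "L u y = u y" if "u \<in> set us" "y \<in> T" for u y
    using transport_apply[OF einj, of "(0, y)" "?lift u"] that d ey[of y] ey[of "u y"] uT[OF that(1)]
    by (simp add: L_def permutes_in_image)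
  have "restr T (L u) = u" if "u \<in> set us" for u
    using Ly[OF that] permutes_not_in[OF uT[OF that]] by (auto simp: restr_def fun_eq_iff)
  then have map_us: "map (restr T) (map L us) = us"
    unfolding map_map by (intro map_idI) simp
  have "t a \<in> T" if "t \<in> set (map L us)" "a \<in> T" for t a
    using that Ly permutes_in_image[OF uT] by auto
  then have "orb (map (restr T) (map L us)) p = orb (map L us) p" by (rule orb_restr[OF p])
  then have orb_tl: "orb (map L us) p = T" using map_us usT(2) by simp
  have \<tau>e: "\<tau> (e (m, y)) = e (if Suc m < d then (Suc m, y) else (0, \<alpha> y))" if "m < d" "y \<in> T" for m y
    using transport_apply[OF einj, of "(m, y)"] that by (simp add: \<tau>_def block_shift_def)
  have pow: "(\<tau> ^^ m) y = e (m, y)" if "m < d" "y \<in> T" for m y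
    using that(1)
  proof (induction m)
    case 0 then show ?case using ey that by simp
  next
    case (Suc m) then show ?case using \<tau>e[of m y] that by simp
  qed
  then show "(hd ?ts ^^ m) y = e (m, y)" if "m < d" "y \<in> T" for m y using that by (simp add: ts)
  show "(hd ?ts ^^ d) y = \<alpha> y" if y: "y \<in> T" for y
  proof -
    obtain d' where d': "d = Suc d'" using d by (cases d) auto
    have "(\<tau> ^^ d) y = \<tau> (e (d', y))" using pow[of d' y] y by (simp add: d')
    also have "\<dots> = \<alpha> y" using \<tau>e[of d' y] y ey[of "\<alpha> y"] \<alpha>T by (simp add: d' permutes_in_image)
    finally show ?thesis by (simp add: ts)
  qed
  have "S \<subseteq> orb ?ts p"
  proof
    fix a assume "a \<in> S"
    then obtain m y where my: "m < d" "y \<in> T" "a = e (m, y)" using eim by auto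
    have "orb (map L us) p \<subseteq> orb ?ts p"
      by (rule orb_least[OF orb_base]) (auto simp: ts intro: orb_step)
    then have "y \<in> orb ?ts p" using orb_tl my by auto
    then have "(\<tau> ^^ m) y \<in> orb ?ts p"
      by (induction m) (auto simp: ts intro: orb_step)
    then show "a \<in> orb ?ts p" using pow my by simp
  qed
  moreover have "orb ?ts p \<subseteq> S" using tsS p sub by (intro orb_subset) auto
  ultimately show "?ts \<in> fibre l S p T us"
    using tsS orb_tl map_us by (auto simp: fibre_def trans_tuples_def ts)
qed

lemma funpow_commute: "f \<circ> g = g \<circ> f \<Longrightarrow> (f ^^ m) (g a) = g ((f ^^ m) a)"
  by (induction m) (auto simp: fun_eq_iff)

text \<open>The first entry \<open>\<tau>\<close> commutes with the tail, so its powers carry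
  \<open>T\<close> to orbits of the tail, which coincide or are disjoint. With \<open>d\<close> the
  first return time to \<open>T\<close>, the first \<open>d\<close> images are disjoint, and
  transitivity makes them cover \<open>S\<close>.\<close>

lemma fibre_decompose:
  assumes fin: "finite S" and p: "p \<in> T" and sub: "T \<subseteq> S" and us: "us \<in> trans_tuples l T p"
    and ts: "ts \<in> fibre l S p T us"
  obtains d e \<alpha> where "d > 0" "card S = d * card T" "e \<in> bijections_ext d T S"
    "\<alpha> \<in> centralizer T us" "ts = assemble d T us e \<alpha>"
proof -
  define \<tau> where "\<tau> = hd ts"
  define vs where "vs = tl ts"
  note F = fibre_trans[OF ts, folded \<tau>_def vs_def]
  have fT: "finite T" using fin sub finite_subset by auto
  have \<tau>S: "(\<tau> ^^ m) a \<in> S" if "a \<in> S" for m a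
    using that F(5) by (induction m) (auto simp: permutes_in_image)
  have \<tau>inj: "inj (\<tau> ^^ m)" for m
    using permutes_inj[OF F(5)] by (rule inj_fn)
  have vT: "v y \<in> T" if "v \<in> set vs" "y \<in> T" for v y
    using that F(3) orb_step by metis
  have comm: "(\<tau> ^^ m) (v a) = v ((\<tau> ^^ m) a)" if "v \<in> set vs" for v m a
    using F(8)[OF that] by (rule funpow_commute)
  have pS: "p \<in> S" using p sub by auto
  \<comment> \<open>The points sent into \<open>T\<close> by \<open>\<tau> ^^ m\<close> are closed
    under the tail, because the two commute. Containing one point of \<open>T\<close>, this set
    contains the whole orbit \<open>T\<close>.\<close>
  have hit: "(\<tau> ^^ m) y' \<in> T" if "y \<in> T" "(\<tau> ^^ m) y \<in> T" "y' \<in> T" for m y y'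
  proof -
    have "orb vs y = T" using orb_eq[OF fin F(2) pS] F(3) that(1) by auto
    moreover have "orb vs y \<subseteq> {a. (\<tau> ^^ m) a \<in> T}"
      by (rule orb_least) (use that vT comm in auto)
    ultimately show ?thesis using that by auto
  qed
  define d where "d = (LEAST d. d > 0 \<and> (\<tau> ^^ d) p \<in> T)"
  have "permutation \<tau>" using F(5) fin by (auto simp: permutation_permutes)
  then obtain n where "\<tau> ^^ n = id" "n > 0" using permutation_is_nilpotent by blast
  then have "n > 0 \<and> (\<tau> ^^ n) p \<in> T" using p by simp
  then have dT: "d > 0 \<and> (\<tau> ^^ d) p \<in> T" unfolding d_def by (rule LeastI)
  have dmin: "m \<ge> d" if "m > 0" "y \<in> T" "(\<tau> ^^ m) y \<in> T" for m y
    unfolding d_def by (rule Least_le) (use that hit[of y m p] p in auto)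
  let ?M = "{..<d} \<times> T"
  define e where "e = restrict (\<lambda>(m, y). (\<tau> ^^ m) y) ?M"
  define \<alpha> where "\<alpha> = restr T (\<tau> ^^ d)"
  have e_app: "e (m, y) = (\<tau> ^^ m) y" if "m < d" "y \<in> T" for m y using that by (simp add: e_def)
  \<comment> \<open>Cancelling \<open>\<tau> ^^ m\<close> turns a coincidence into a return to
    \<open>T\<close> after \<open>m' - m < d\<close> steps, so \<open>m' - m\<close> must be
    \<open>0\<close>.\<close>
  have le: "m = m' \<and> y = y'"
    if "m \<le> m'" "m' < d" "y \<in> T" "y' \<in> T" "(\<tau> ^^ m) y = (\<tau> ^^ m') y'" for m m' y y'
  proof -
    have "(\<tau> ^^ m') y' = (\<tau> ^^ m) ((\<tau> ^^ (m' - m)) y')"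
      using that(1) by (metis comp_apply funpow_add le_add_diff_inverse)
    then have y: "y = (\<tau> ^^ (m' - m)) y'" using that \<tau>inj[of m] by (auto dest: injD)
    have "m' - m = 0"
    proof (rule ccontr)
      assume "m' - m \<noteq> 0"
      then have "d \<le> m' - m" using dmin[of "m' - m" y'] that y by auto
      then show False using that by auto
    qed
    then show ?thesis using y that(1) by simp
  qed
  have einj: "inj_on e ?M"
  proof (rule inj_onI, clarify)
    fix m y m' y' assume *: "m < d" "y \<in> T" "m' < d" "y' \<in> T" "e (m, y) = e (m', y')"
    then show "m = m' \<and> y = y'"
      using le[of m m' y y'] le[of m' m y' y] by (cases "m \<le> m'") (auto simp: e_app)
  qed
  have dmap: "(\<tau> ^^ d) y \<in> T" if "y \<in> T" for y using hit[of p d y] dT p that by auto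
  have "e ` ?M = S"
  proof
    show "e ` ?M \<subseteq> S" using \<tau>S sub by (auto simp: e_def)
    \<comment> \<open>The union of the copies is closed under every entry: the tail preserves each
      copy, and \<open>\<tau>\<close> moves each copy to the next and the last one back to
      \<open>T\<close>.\<close>
    have "orb ts p \<subseteq> e ` ?M"
    proof (rule orb_least)
      show "p \<in> e ` ?M" using p dT e_app[of 0 p] by (intro image_eqI[of _ _ "(0, p)"]) auto
      fix t a assume t: "t \<in> set ts" and "a \<in> e ` ?M"
      then obtain m y where my: "m < d" "y \<in> T" "a = (\<tau> ^^ m) y" by (auto simp: e_app)
      have "t = \<tau> \<or> t \<in> set vs" using t F(1) by (metis set_ConsD)
      then show "t a \<in> e ` ?M"
      proof
        assume [simp]: "t = \<tau>"
        show ?thesis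
        proof (cases "Suc m < d")
          case True
          then show ?thesis using my by (intro image_eqI[of _ _ "(Suc m, y)"]) (auto simp: e_app)
        next
          case False
          then have "d = Suc m" using my by auto
          then have "t a = (\<tau> ^^ d) y" using my by simp
          then show ?thesis using dmap[OF my(2)] dT
            by (intro image_eqI[of _ _ "(0, (\<tau> ^^ d) y)"]) (auto simp: e_app)
        qed
      next
        assume "t \<in> set vs"
        then show ?thesis using my vT comm by (intro image_eqI[of _ _ "(m, t y)"]) (auto simp: e_app)
      qed
    qed
    then show "S \<subseteq> e ` ?M" using F(6) by auto
  qed
  then have eb: "bij_betw e ?M S" using einj by (simp add: bij_betw_def)
  then have "card S = d * card T" using bij_betw_same_card[OF eb] by (simp add: card_cartesian_product)
  moreover have "e \<in> bijections_ext d T S"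
    using eb dT by (auto simp: bijections_ext_def e_app) (simp add: e_def)
  moreover have "\<alpha> \<in> centralizer T us"
  proof -
    have "\<alpha> permutes T" unfolding \<alpha>_def by (rule restr_permutes[OF fT \<tau>inj dmap])
    moreover have "\<alpha> \<circ> restr T v = restr T v \<circ> \<alpha>" if "v \<in> set vs" for v
      using that vT dmap comm by (auto simp: \<alpha>_def restr_def fun_eq_iff)
    ultimately show ?thesis using F(4) by (auto simp: centralizer_def)
  qed
  moreover have "ts = assemble d T us e \<alpha>"
  proof -
    have eqI: "f = transport ?M e g" if "f permutes S" "\<And>m y. m < d \<Longrightarrow> y \<in> T \<Longrightarrow> f (e (m, y)) = e (g (m, y))"
      for f g
    proof
      fix a show "f a = transport ?M e g a"
      proof (cases "a \<in> S")
        case True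
        then obtain m y where "m < d" "y \<in> T" "a = e (m, y)" using \<open>e ` ?M = S\<close> by auto
        then show ?thesis using that transport_apply[OF einj, of "(m, y)"] by simp
      next
        case False
        then show ?thesis using that \<open>e ` ?M = S\<close> by (simp add: permutes_not_in transport_not_in)
      qed
    qed
    have "\<tau> = transport ?M e (block_shift d \<alpha>)"
    proof (rule eqI[OF F(5)])
      fix m y assume my: "m < d" "y \<in> T"
      show "\<tau> (e (m, y)) = e (block_shift d \<alpha> (m, y))"
      proof (cases "Suc m < d")
        case False
        then have "d = Suc m" using my by auto
        then have "\<tau> (e (m, y)) = (\<tau> ^^ d) y" using my by (simp add: e_app)
        then show ?thesis using False my dmap[OF my(2)] dT by (simp add: block_shift_def e_app \<alpha>_def restr_def)
      qed (use my in \<open>simp add: block_shift_def e_app\<close>)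
    qed
    moreover have "v = transport ?M e (\<lambda>(m, y). (m, restr T v y))" if "v \<in> set vs" for v
      by (rule eqI) (use F(2) that vT comm in \<open>auto simp: perm_tuples_def e_app restr_def\<close>)
    then have "map (\<lambda>u. transport ?M e (\<lambda>(m, y). (m, u y))) us = vs"
      unfolding F(4)[symmetric] map_map by (intro map_idI) simp
    ultimately show ?thesis using F(1) by (simp add: assemble_def)
  qed
  ultimately show ?thesis using dT that by blast
qed

text \<open>The number \<open>d\<close> of copies is forced to be \<open>card S / card T\<close>.
  What remains free is \<open>e\<close>, with \<open>fact (card S - card T)\<close> choices, and
  \<open>\<alpha>\<close>, with \<open>card T\<close> choices.\<close>

lemma card_fibre:
  assumes fin: "finite S" and p: "p \<in> T" and sub: "T \<subseteq> S" and us: "us \<in> trans_tuples l T p"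
  shows "card (fibre l S p T us) =
    (if card T dvd card S then card T * fact (card S - card T) else 0)"
proof (cases "card T dvd card S")
  case False
  have "fibre l S p T us = {}"
  proof (rule equals0I)
    fix ts assume "ts \<in> fibre l S p T us"
    then obtain d where "card S = d * card T" using fibre_decompose[OF assms] by metis
    then show False using False by simp
  qed
  then show ?thesis using False by simp
next
  case True
  then obtain d where d: "card S = d * card T" by (auto simp: dvd_def mult.commute)
  have fT: "finite T" using fin sub finite_subset by auto
  have cT: "card T > 0" using fT p by (auto simp: card_gt_0_iff)
  have "card S > 0" using fin p sub by (auto simp: card_gt_0_iff)
  then have d0: "d > 0" using d by (cases d) auto
  let ?X = "bijections_ext d T S \<times> centralizer T us"
  have "bij_betw (\<lambda>(e, \<alpha>). assemble d T us e \<alpha>) ?X (fibre l S p T us)"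
    unfolding bij_betw_def
  proof
    show "inj_on (\<lambda>(e, \<alpha>). assemble d T us e \<alpha>) ?X"
    proof (rule inj_onI, clarify)
      fix e \<alpha> e' \<alpha>'
      assume e: "e \<in> bijections_ext d T S" and e': "e' \<in> bijections_ext d T S"
        and \<alpha>: "\<alpha> \<in> centralizer T us" and \<alpha>': "\<alpha>' \<in> centralizer T us"
        and eq: "assemble d T us e \<alpha> = assemble d T us e' \<alpha>'"
      note A = assemble_fibre[OF assms d0 e \<alpha>] and B = assemble_fibre[OF assms d0 e' \<alpha>']
      have "e = e'"
        by (rule extensionalityI[of _ "{..<d} \<times> T"]) (use A(2) B(2) eq e e' in \<open>auto simp: bijections_ext_def\<close>)
      moreover have "\<alpha> = \<alpha>'"
      proof
        fix a show "\<alpha> a = \<alpha>' a"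
          using A(3) B(3) eq \<alpha> \<alpha>' by (cases "a \<in> T") (auto simp: centralizer_def permutes_not_in)
      qed
      ultimately show "e = e' \<and> \<alpha> = \<alpha>'" by simp
    qed
    show "(\<lambda>(e, \<alpha>). assemble d T us e \<alpha>) ` ?X = fibre l S p T us"
    proof
      show "(\<lambda>(e, \<alpha>). assemble d T us e \<alpha>) ` ?X \<subseteq> fibre l S p T us"
        using assemble_fibre(1)[OF assms d0] by auto
      show "fibre l S p T us \<subseteq> (\<lambda>(e, \<alpha>). assemble d T us e \<alpha>) ` ?X"
      proof
        fix ts assume "ts \<in> fibre l S p T us"
        then obtain d' e \<alpha> where *: "card S = d' * card T" "e \<in> bijections_ext d' T S"
          "\<alpha> \<in> centralizer T us" "ts = assemble d' T us e \<alpha>" using fibre_decompose[OF assms] by metis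
        then have "d' = d" using d cT by simp
        then show "ts \<in> (\<lambda>(e, \<alpha>). assemble d T us e \<alpha>) ` ?X" using * by auto
      qed
    qed
  qed
  then have "card (fibre l S p T us) = card (bijections_ext d T S) * card (centralizer T us)"
    by (metis bij_betw_same_card card_cartesian_product)
  then show ?thesis
    using True card_bijections_ext[OF fin sub d d0] card_centralizer[OF fT us p] by simp
qed

text \<open>\<open>tcount l k\<close> is the number of subgroups of index \<open>k\<close> in \<open>\<int>\<^sup>l\<close>. The sum is over an infinite set,
  hence \<open>0\<close>, when \<open>k = 0\<close>.\<close>

fun tcount :: "nat \<Rightarrow> nat \<Rightarrow> nat" where
  "tcount 0 k = (if k = 1 then 1 else 0)"
| "tcount (Suc l) k = (\<Sum>j | j dvd k. j * tcount l j)"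

section \<open>Counting transitive tuples and the exponential formula\<close>

lemma sum_subsets_card:
  fixes h :: "nat \<Rightarrow> 'b::comm_semiring_1"
  assumes "finite S"
  shows "(\<Sum>U\<in>Pow S. h (card U)) = (\<Sum>i\<le>card S. of_nat (card S choose i) * h i)"
proof -
  have "(\<Sum>U\<in>Pow S. h (card U)) = (\<Sum>i\<le>card S. \<Sum>U\<in>{U\<in>Pow S. card U = i}. h (card U))"
    using assms by (subst sum.group) (auto intro: card_mono)
  also have "\<dots> = (\<Sum>i\<le>card S. of_nat (card S choose i) * h i)"
  proof (rule sum.cong[OF refl])
    fix i
    have "{U \<in> Pow S. card U = i} = {U. U \<subseteq> S \<and> card U = i}" by auto
    then show "(\<Sum>U\<in>{U\<in>Pow S. card U = i}. h (card U)) = of_nat (card S choose i) * h i"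
      using n_subsets[OF assms, of i] by simp
  qed
  finally show ?thesis .
qed

lemma sum_subsets_containing:
  fixes h :: "nat \<Rightarrow> 'b::comm_semiring_1"
  assumes "finite S" "p \<in> S"
  shows "(\<Sum>T | p \<in> T \<and> T \<subseteq> S. h (card T)) =
    (\<Sum>i\<le>card S - 1. of_nat ((card S - 1) choose i) * h (Suc i))"
proof -
  have "(\<Sum>T | p \<in> T \<and> T \<subseteq> S. h (card T)) = (\<Sum>U\<in>Pow (S - {p}). h (Suc (card U)))"
    by (rule sum.reindex_bij_witness[where i = "insert p" and j = "\<lambda>T. T - {p}"])
       (use assms card.remove[OF finite_subset[OF _ assms(1)]] in \<open>auto simp del: card_Diff_insert\<close>)
  then show ?thesis using sum_subsets_card[of "S - {p}" "\<lambda>i. h (Suc i)"] assms by simp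
qed

lemma perm_tuples_0: "perm_tuples 0 A = {[]}"
  by (auto simp: perm_tuples_def)

lemma orb_Nil: "orb [] p = {p}"
  using orb_least[of p "{p}" "[]"] orb_base[of p "[]"] by auto

text \<open>The tuple is fibred over the orbit \<open>T\<close> of its tail. For
  \<open>card T = j\<close> and \<open>card S = k\<close> there are
  \<open>(k - 1) choose (j - 1)\<close> sets \<open>T\<close>, each with
  \<open>fact (j - 1) * tcount l j\<close> tails and fibres of size \<open>j * fact (k - j)\<close>.
  The product is \<open>fact (k - 1) * (j * tcount l j)\<close>, a summand in the recursion of
  \<open>tcount\<close>.\<close>

theorem card_trans_tuples:
  assumes "finite S" "p \<in> S"
  shows "card (trans_tuples l S p) = fact (card S - 1) * tcount l (card S)"
  using assms
proof (induction l arbitrary: S p)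
  case 0
  show ?case
  proof (cases "S = {p}")
    case True
    then have "trans_tuples 0 S p = {[]}" by (auto simp: trans_tuples_def perm_tuples_0 orb_Nil)
    then show ?thesis using True by simp
  next
    case False
    then have "trans_tuples 0 S p = {}" by (auto simp: trans_tuples_def perm_tuples_0 orb_Nil)
    moreover have "card S \<noteq> 1" using False 0 by (auto simp: card_1_singleton_iff)
    ultimately show ?thesis by simp
  qed
next
  case (Suc l)
  let ?I = "{T. p \<in> T \<and> T \<subseteq> S}" and ?k = "card S"
  let ?f = "\<lambda>ts. (orb (tl ts) p, map (restr (orb (tl ts) p)) (tl ts))"
  let ?Z = "Sigma ?I (\<lambda>T. trans_tuples l T p)"
  have finI: "finite ?I" using Suc by simp
  have finT: "finite T" if "T \<in> ?I" for T using that Suc finite_subset by auto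
  have k: "?k > 0" using Suc by (auto simp: card_gt_0_iff)
  have finZ: "finite ?Z" using finI finT by (intro finite_SigmaI finite_trans_tuples) auto
  have img: "?f ` trans_tuples (Suc l) S p \<subseteq> ?Z"
  proof clarify
    fix ts assume "ts \<in> trans_tuples (Suc l) S p"
    then have "ts \<in> fibre l S p (orb (tl ts) p) (map (restr (orb (tl ts) p)) (tl ts))"
      by (simp add: fibre_def)
    from fibre_trans(2)[OF this] have vs: "tl ts \<in> perm_tuples l S" .
    let ?T = "orb (tl ts) p"
    have T: "?T \<subseteq> S" using orb_subset[OF vs] Suc by auto
    have cl: "t a \<in> ?T" if "t \<in> set (tl ts)" "a \<in> ?T" for t a using that by (rule orb_step[rotated])
    have "map (restr ?T) (tl ts) \<in> perm_tuples l ?T"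
      by (rule restr_tuples[OF _ vs]) (use finT T cl orb_base[of p "tl ts"] in auto)
    moreover have "orb (map (restr ?T) (tl ts)) p = ?T"
      by (rule orb_restr[OF orb_base]) (rule cl)
    ultimately show "?T \<in> ?I \<and> map (restr ?T) (tl ts) \<in> trans_tuples l ?T p"
      using T orb_base[of p "tl ts"] by (auto simp: trans_tuples_def)
  qed
  have "card (trans_tuples (Suc l) S p) = (\<Sum>z\<in>?Z. card {ts \<in> trans_tuples (Suc l) S p. ?f ts = z})"
    using sum.group[OF _ finZ img, of "\<lambda>_. 1::nat"] Suc.prems by simp
  also have "\<dots> = (\<Sum>(T, us)\<in>?Z. card (fibre l S p T us))"
  proof (rule sum.cong[OF refl], clarify)
    fix T us assume "p \<in> T" "T \<subseteq> S" "us \<in> trans_tuples l T p"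
    have "{ts \<in> trans_tuples (Suc l) S p. ?f ts = (T, us)} = fibre l S p T us"
      by (auto simp: fibre_def)
    then show "card {ts \<in> trans_tuples (Suc l) S p. ?f ts = (T, us)} = card (fibre l S p T us)"
      by simp
  qed
  also have "\<dots> = (\<Sum>T\<in>?I. \<Sum>us\<in>trans_tuples l T p. card (fibre l S p T us))"
    using finI finT by (subst sum.Sigma) auto
  also have "\<dots> = (\<Sum>T\<in>?I. if card T dvd ?k
      then fact (card T - 1) * tcount l (card T) * (card T * fact (?k - card T)) else 0)"
    by (rule sum.cong[OF refl]) (use Suc finT card_fibre[OF Suc.prems(1)] in simp)
  also have "\<dots> = (\<Sum>i\<le>?k - 1. ((?k - 1) choose i) *
      (if Suc i dvd ?k then fact i * tcount l (Suc i) * (Suc i * fact (?k - Suc i)) else 0))"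
    using sum_subsets_containing[OF Suc.prems, of "\<lambda>j. if j dvd ?k
      then fact (j - 1) * tcount l j * (j * fact (?k - j)) else 0"]
    by (simp only: diff_Suc_1 of_nat_id)
  also have "\<dots> = (\<Sum>i\<le>?k - 1. if Suc i dvd ?k then fact (?k - 1) * (Suc i * tcount l (Suc i)) else 0)"
  proof (rule sum.cong[OF refl])
    fix i assume "i \<in> {..?k - 1}"
    then have "fact i * fact (?k - 1 - i) * ((?k - 1) choose i) = (fact (?k - 1) :: nat)"
      using binomial_fact_lemma[of i "?k - 1"] by simp
    then have *: "((?k - 1) choose i) * (fact i * c * (Suc i * fact (?k - Suc i))) = fact (?k - 1) * (Suc i * c)" for c
      by (metis (no_types, lifting) diff_Suc_eq_diff_pred mult.assoc mult.commute)
    show "((?k - 1) choose i) *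
      (if Suc i dvd ?k then fact i * tcount l (Suc i) * (Suc i * fact (?k - Suc i)) else 0) =
      (if Suc i dvd ?k then fact (?k - 1) * (Suc i * tcount l (Suc i)) else 0)"
      using *[of "tcount l (Suc i)"] by simp
  qed
  also have "\<dots> = (\<Sum>i | i \<le> ?k - 1 \<and> Suc i dvd ?k. fact (?k - 1) * (Suc i * tcount l (Suc i)))"
    by (subst sum.inter_filter[symmetric]) (auto intro: sum.cong)
  also have "\<dots> = (\<Sum>j | j dvd ?k. fact (?k - 1) * (j * tcount l j))"
  proof (rule sum.reindex_bij_witness[where j = Suc and i = "\<lambda>j. j - 1"])
    fix j assume "j \<in> {j. j dvd ?k}"
    then have "j dvd ?k" "j > 0" "j \<le> ?k" using k by (auto intro: Nat.gr0I dvd_imp_le)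
    then show "Suc (j - 1) = j" "j - 1 \<in> {i. i \<le> ?k - 1 \<and> Suc i dvd ?k}" by auto
  qed auto
  also have "\<dots> = fact (?k - 1) * tcount (Suc l) ?k" by (simp add: sum_distrib_left)
  finally show ?case .
qed

text \<open>\<open>hcoef c n\<close> is the coefficient of \<open>z^n\<close> in \<open>exp (\<Sum>k\<ge>1. c k / k * z^k)\<close>.\<close>

fun hcoef :: "(nat \<Rightarrow> real) \<Rightarrow> nat \<Rightarrow> real" where
  "hcoef c 0 = 1"
| "hcoef c (Suc n) = (\<Sum>k\<le>n. c (Suc k) * hcoef c (n - k)) / real (Suc n)"

text \<open>The exponential formula, by recursion on the orbit of a point. With
  \<open>card A = m + 1\<close> there are \<open>m choose i\<close> orbits of size
  \<open>i + 1\<close>, and the factorials of the transitive part and of the rest turn this binomial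
  into \<open>fact m\<close>. The quotient of \<open>fact (m + 1)\<close> by \<open>fact m\<close>
  is the denominator in \<open>hcoef\<close>.\<close>

theorem orbit_poly_eq_hcoef:
  assumes "finite A"
  shows "orbit_poly l x A = fact (card A) * hcoef (\<lambda>k. x * real (tcount l k)) (card A)"
  using assms
proof (induction "card A" arbitrary: A rule: less_induct)
  case (less A)
  show ?case
  proof (cases "A = {}")
    case True
    have "perm_tuples l ({} :: 'a set) = {replicate l id}"
      by (auto simp: perm_tuples_def intro: replicate_eqI)
    then show ?thesis using True by (simp add: orbit_poly_def)
  next
    case False
    then obtain p where p: "p \<in> A" by auto
    let ?c = "\<lambda>k. x * real (tcount l k)"
    define m where "m = card A - 1"
    have m: "card A = Suc m" using p less.prems by (simp add: m_def card_gt_0_iff Suc_diff_1[symmetric] del: Suc_diff_1) (metis Suc_pred card_gt_0_iff empty_iff)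
    have "orbit_poly l x A =
      (\<Sum>S | p \<in> S \<and> S \<subseteq> A. x * real (card (trans_tuples l S p)) * orbit_poly l x (A - S))"
      by (rule orbit_poly_decomp[OF less.prems p])
    also have "\<dots> = (\<Sum>S | p \<in> S \<and> S \<subseteq> A. x * (fact (card S - 1) * real (tcount l (card S))) *
        (fact (card A - card S) * hcoef ?c (card A - card S)))"
    proof (rule sum.cong[OF refl])
      fix S assume S: "S \<in> {S. p \<in> S \<and> S \<subseteq> A}"
      then have fS: "finite S" and pS: "p \<in> S" using less.prems finite_subset by auto
      have cAS: "card (A - S) = card A - card S" using S fS by (simp add: card_Diff_subset)
      moreover have "card S > 0" using fS pS by (auto simp: card_gt_0_iff)
      ultimately have "card (A - S) < card A" using m by simp
      then have "orbit_poly l x (A - S) = fact (card A - card S) * hcoef ?c (card A - card S)"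
        using less.hyps[of "A - S"] less.prems cAS by simp
      then show "x * real (card (trans_tuples l S p)) * orbit_poly l x (A - S) =
        x * (fact (card S - 1) * real (tcount l (card S))) * (fact (card A - card S) * hcoef ?c (card A - card S))"
        using card_trans_tuples[OF fS pS, of l] by simp
    qed
    also have "\<dots> = (\<Sum>i\<le>m. real (m choose i) * (x * (fact i * real (tcount l (Suc i))) *
        (fact (m - i) * hcoef ?c (m - i))))"
      using sum_subsets_containing[OF less.prems p, of "\<lambda>j. x * (fact (j - 1) * real (tcount l j)) *
        (fact (card A - j) * hcoef ?c (card A - j))"] by (simp add: m)
    also have "\<dots> = (\<Sum>i\<le>m. fact m * (?c (Suc i) * hcoef ?c (m - i)))"
    proof (rule sum.cong[OF refl])
      fix i assume "i \<in> {..m}"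
      then have "fact i * fact (m - i) * real (m choose i) = fact m"
        using binomial_fact_lemma[of i m] by (metis atMost_iff of_nat_fact of_nat_mult)
      moreover have "real (m choose i) * (x * (fact i * t) * (fact (m - i) * h))
        = (fact i * fact (m - i) * real (m choose i)) * ((x * t) * h)" for t h
        by (simp only: mult_ac)
      ultimately show "real (m choose i) * (x * (fact i * real (tcount l (Suc i))) * (fact (m - i) * hcoef ?c (m - i)))
        = fact m * (?c (Suc i) * hcoef ?c (m - i))" by (simp only:)
    qed
    also have "\<dots> = fact (card A) * hcoef ?c (card A)"
      unfolding m hcoef.simps fact_Suc sum_distrib_left[symmetric] by simp
    finally show ?thesis .
  qed
qed

section \<open>Orbits of the generated permutation group\<close>

lemma commuting_tuples_eq: "commuting_tuples l n = perm_tuples l {1..n}"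
proof -
  have "(\<forall>i<l. \<forall>j<l. \<sigma> ! i \<otimes>\<^bsub>sym_group n\<^esub> \<sigma> ! j = \<sigma> ! j \<otimes>\<^bsub>sym_group n\<^esub> \<sigma> ! i) \<longleftrightarrow>
    (\<forall>t\<in>set \<sigma>. \<forall>u\<in>set \<sigma>. t \<circ> u = u \<circ> t)" if "length \<sigma> = l" for \<sigma>
    unfolding sym_group_mult using that by (metis in_set_conv_nth)
  then show ?thesis unfolding commuting_tuples_def perm_tuples_def by (auto simp: sym_group_def)
qed

text \<open>The only real difference between the two orbits is that the generated group contains
  inverses; a step by an inverse is reversed by means of \<open>orb_sym\<close>.\<close>

lemma orbit_subgroup_generated:
  assumes \<sigma>: "\<sigma> \<in> perm_tuples l {1..n}" and a: "a \<in> {1..n}"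
  shows "orbit (subgroup_generated (sym_group n) (set \<sigma>)) (\<lambda>g. restrict g {1..n}) a = orb \<sigma> a"
proof -
  let ?G = "sym_group n" and ?A = "{1..n}"
  have G: "group ?G" by (rule sym_group_is_group)
  have perm: "t permutes ?A" if "t \<in> set \<sigma>" for t using \<sigma> that by (auto simp: perm_tuples_def)
  have sub: "set \<sigma> \<subseteq> carrier ?G" using perm by (auto simp: sym_group_carrier)
  have orb: "orbit (subgroup_generated ?G (set \<sigma>)) (\<lambda>g. restrict g ?A) a = {g a |g. g \<in> generate ?G (set \<sigma>)}"
    using a sub by (auto simp: orbit_def carrier_subgroup_generated Int_absorb1)
  have fin: "finite ?A" by simp
  have in_orb: "g b \<in> orb \<sigma> b" if "g \<in> generate ?G (set \<sigma>)" "b \<in> ?A" for g b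
    using that
  proof (induction arbitrary: b)
    case one then show ?case by (simp add: sym_group_one orb_base)
  next
    case (incl h) then show ?case by (auto intro: orb_step orb_base)
  next
    case (inv h)
    have h: "h permutes ?A" using perm inv by auto
    have "inv\<^bsub>?G\<^esub> h = inv' h" using h by (intro sym_group_inv_equality) (simp add: sym_group_carrier)
    then have ih: "h ((inv\<^bsub>?G\<^esub> h) b) = b" "(inv\<^bsub>?G\<^esub> h) b \<in> ?A"
      using h inv by (simp_all add: permutes_inverses permutes_in_image[OF permutes_inv] del: atLeastAtMost_iff)
    have "b \<in> orb \<sigma> ((inv\<^bsub>?G\<^esub> h) b)"
      using orb_step[OF orb_base, of h \<sigma> "(inv\<^bsub>?G\<^esub> h) b"] inv ih by simp
    then show ?case by (rule orb_sym[OF fin \<sigma> ih(2)])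
  next
    case (eng h1 h2)
    have 2: "h2 b \<in> orb \<sigma> b" using eng by auto
    then have h2: "h2 b \<in> ?A" using orb_subset[OF \<sigma> eng.prems] by auto
    have "h1 (h2 b) \<in> orb \<sigma> (h2 b)" using eng h2 by auto
    then show ?case using orb_eq[OF fin \<sigma> eng.prems 2] by (simp add: sym_group_mult)
  qed
  have "orb \<sigma> a \<subseteq> {g a |g. g \<in> generate ?G (set \<sigma>)}"
  proof (rule orb_least)
    have "id \<in> generate ?G (set \<sigma>)" using generate.one[of ?G "set \<sigma>"] by (simp add: sym_group_one)
    then show "a \<in> {g a |g. g \<in> generate ?G (set \<sigma>)}" by (intro CollectI exI[of _ id]) simp
    fix t b assume t: "t \<in> set \<sigma>" and "b \<in> {g a |g. g \<in> generate ?G (set \<sigma>)}"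
    then obtain g where g: "b = g a" "g \<in> generate ?G (set \<sigma>)" by auto
    have "t \<circ> g \<in> generate ?G (set \<sigma>)"
      using generate.eng[OF generate.incl[OF t] g(2)] by (simp add: sym_group_mult)
    then show "t b \<in> {g a |g. g \<in> generate ?G (set \<sigma>)}" using g(1)
      by (intro CollectI exI[of _ "t \<circ> g"]) simp
  qed
  then show ?thesis unfolding orb using in_orb a by auto
qed

lemma num_orbits_eq:
  assumes "\<sigma> \<in> perm_tuples l {1..n}"
  shows "num_orbits n \<sigma> = card (orb \<sigma> ` {1..n})"
proof -
  have "orbits (subgroup_generated (sym_group n) (set \<sigma>)) {1..n} (\<lambda>g. restrict g {1..n}) =
    (\<lambda>a. orbit (subgroup_generated (sym_group n) (set \<sigma>)) (\<lambda>g. restrict g {1..n}) a) ` {1..n}"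
    unfolding orbits_def by blast
  also have "\<dots> = orb \<sigma> ` {1..n}"
    by (rule image_cong[OF refl]) (rule orbit_subgroup_generated[OF assms])
  finally show ?thesis by (simp add: num_orbits_def)
qed

theorem commuting_partition_function:
  "(\<Sum>\<sigma>\<in>commuting_tuples l n. x ^ num_orbits n \<sigma>) =
     fact n * hcoef (\<lambda>k. x * real (tcount l k)) n"
  using orbit_poly_eq_hcoef[of "{1..n}" l x] num_orbits_eq[of _ l n]
  by (simp add: orbit_poly_def commuting_tuples_eq)

section \<open>The Dirichlet-type series\<close>

text \<open>\<open>u ^ p / fact p\<close> is a single term of the nonnegative series of
  \<open>exp u\<close>.\<close>

lemma power_exp_le:
  fixes u :: real
  assumes "u \<ge> 0"
  shows "u ^ p * exp (- u) \<le> fact p"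
proof -
  have "(\<lambda>n. u ^ n /\<^sub>R fact n) sums exp u" by (rule exp_converges)
  then have "(\<Sum>n\<in>{p}. u ^ n /\<^sub>R fact n) \<le> exp u"
    using assms by (intro sum_le_suminf[of "\<lambda>n. u ^ n /\<^sub>R fact n" "{p}", simplified sums_unique[OF exp_converges, symmetric]])
      (auto simp: sums_iff)
  then show ?thesis by (simp add: field_simps exp_minus)
qed

text \<open>This is \<open>power_exp_le\<close> with exponent \<open>p + 2\<close>: the two spare
  powers of \<open>k\<close> provide a summable factor, and the constant keeps an explicit power of
  \<open>t\<close>.\<close>

lemma power_exp_decay:
  assumes "t > 0" "k > 0"
  shows "real k ^ p * exp (- real k * t) \<le> fact (p + 2) / t ^ (p + 2) * (1 / real k ^ 2)"
proof -
  have "real k ^ p * exp (- real k * t) =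
    ((real k * t) ^ (p + 2) * exp (- (real k * t))) * (1 / (t ^ (p + 2) * real k ^ 2))"
    using assms by (simp add: power_mult_distrib power_add power2_eq_square)
  also have "\<dots> \<le> fact (p + 2) * (1 / (t ^ (p + 2) * real k ^ 2))"
    using assms by (intro mult_right_mono power_exp_le) auto
  finally show ?thesis by simp
qed

lemma summable_power_exp:
  assumes "t > 0"
  shows "summable (\<lambda>k. real k ^ p * exp (- real k * t))"
proof (rule summable_comparison_test_ev)
  show "summable (\<lambda>k. fact (p + 2) / t ^ (p + 2) * (1 / real k ^ 2))"
    using inverse_power_summable[of 2, where 'a = real] by (intro summable_mult) (simp add: field_simps)
  show "\<forall>\<^sub>F k in sequentially. norm (real k ^ p * exp (- real k * t)) \<le> fact (p + 2) / t ^ (p + 2) * (1 / real k ^ 2)"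
    using eventually_gt_at_top[of 0] by eventually_elim (use power_exp_decay[OF assms] in simp)
qed

lemma tcount_0_right: "tcount l 0 = 0"
proof (cases l)
  case (Suc m)
  have "infinite {j::nat. j dvd 0}" by simp
  then show ?thesis unfolding Suc tcount.simps by (rule sum.infinite)
qed simp

text \<open>A crude bound suffices: there are at most \<open>k\<close> divisors and each is at most
  \<open>k\<close>, so one step of the recursion costs at most \<open>k ^ 2\<close>.\<close>

lemma tcount_le: "tcount l k \<le> k ^ (2 * l)"
proof (cases "k = 0")
  case False
  then show ?thesis
  proof (induction l arbitrary: k)
    case (Suc l)
    have sub: "{j. j dvd k} \<subseteq> {1..k}" using Suc.prems by (auto simp: dvd_imp_le Suc_le_eq intro: Nat.gr0I)
    have "tcount (Suc l) k \<le> (\<Sum>j | j dvd k. k * k ^ (2 * l))"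
      unfolding tcount.simps
    proof (intro sum_mono mult_mono)
      fix j assume "j \<in> {j. j dvd k}"
      then have j: "j \<le> k" "j \<noteq> 0" using sub by auto
      show "j \<le> k" by fact
      show "tcount l j \<le> k ^ (2 * l)"
        using Suc.IH[OF j(2)] power_mono[OF j(1), of "2 * l"] by linarith
    qed auto
    also have "\<dots> \<le> card {1..k} * (k * k ^ (2 * l))"
      using card_mono[OF _ sub] by (simp add: mult_right_mono)
    finally show ?case by simp
  qed simp
qed (simp add: tcount_0_right)

text \<open>The terms of \<open>Z_fun\<close> grouped by the product \<open>k\<close> of the summation indices.\<close>

definition zterm :: "nat \<Rightarrow> int \<Rightarrow> real \<Rightarrow> nat \<Rightarrow> real" where
  "zterm l m t k = real k powi (m - int l) * real (tcount l k) * exp (- real k * t)"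

definition zser :: "nat \<Rightarrow> int \<Rightarrow> real \<Rightarrow> real" where
  "zser l m t = infsum (zterm l m t) {1..}"

lemma zterm_nonneg: "zterm l m t k \<ge> 0"
  by (simp add: zterm_def)

lemma powi_le_power_nat: "k \<ge> 1 \<Longrightarrow> real k powi q \<le> real k ^ nat q"
  by (cases "q \<ge> 0") (auto simp: power_int_def divide_simps)

lemma summable_zterm:
  assumes "t > 0"
  shows "summable (zterm l m t)"
proof (rule summable_comparison_test_ev)
  let ?p = "nat (m - int l) + 2 * l"
  show "summable (\<lambda>k. real k ^ ?p * exp (- real k * t))" by (rule summable_power_exp[OF assms])
  show "\<forall>\<^sub>F k in sequentially. norm (zterm l m t k) \<le> real k ^ ?p * exp (- real k * t)"
    using eventually_gt_at_top[of 0]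
  proof eventually_elim
    case (elim k)
    have "real (tcount l k) \<le> real k ^ (2 * l)" using tcount_le[of l k] by (metis of_nat_le_iff of_nat_power)
    then have "real k powi (m - int l) * real (tcount l k) \<le> real k ^ nat (m - int l) * real k ^ (2 * l)"
      using powi_le_power_nat[of k "m - int l"] elim by (intro mult_mono) auto
    then have "zterm l m t k \<le> real k ^ ?p * exp (- real k * t)"
      unfolding zterm_def power_add by (intro mult_right_mono) auto
    then show ?case using zterm_nonneg[of l m t k] by simp
  qed
qed

lemma zterm_has_sum:
  assumes "t > 0"
  shows "(zterm l m t has_sum zser l m t) {1..}"
proof -
  have "zterm l m t summable_on UNIV"
    using summable_zterm[OF assms] zterm_nonneg by (intro norm_summable_imp_summable_on) simp
  then have "zterm l m t summable_on {1..}" by (rule summable_on_subset_banach) simp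
  then show ?thesis by (simp add: zser_def)
qed

lemma zser_sums:
  assumes "t > 0"
  shows "zterm l m t sums zser l m t"
proof -
  have "(zterm l m t has_sum zser l m t) UNIV"
    \<comment> \<open>Passing from \<open>{1..}\<close> to all indices adds nothing, since
      \<open>tcount l 0 = 0\<close> annihilates the term at \<open>0\<close> whatever the power
      there is.\<close>
    by (rule has_sum_cong_neutral[THEN iffD1, OF _ _ _ zterm_has_sum[OF assms]])
       (auto simp: zterm_def tcount_0_right not_less_eq_eq)
  then show ?thesis by (rule has_sum_imp_sums)
qed

text \<open>Writing \<open>N = d * j\<close> for the divisors \<open>j\<close> of \<open>N\<close>
  splits off \<open>d\<close> as the last summation index. All terms are nonnegative, so the double
  sum may be rearranged.\<close>

lemma zser_rec:
  assumes t: "t > 0"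
  shows "((\<lambda>d. real d powi (m - int (Suc l)) * zser l m (real d * t)) has_sum zser (Suc l) m t) {1..}"
proof -
  let ?D = "Sigma {1::nat..} (\<lambda>N. {j. j dvd N})"
  let ?g = "\<lambda>(N, j). real N powi (m - int (Suc l)) * (real j * real (tcount l j)) * exp (- real N * t)"
  let ?f = "\<lambda>(d, j). real d powi (m - int (Suc l)) * zterm l m (real d * t) j"
  have inner: "((\<lambda>j. ?g (N, j)) has_sum zterm (Suc l) m t N) {j. j dvd N}" if "N \<in> {1..}" for N
    by (rule has_sum_finiteI)
       (use that in \<open>auto simp: zterm_def sum_distrib_left[symmetric] sum_distrib_right[symmetric]\<close>)
  have "?g summable_on ?D"
    by (rule summable_on_SigmaI[OF inner]) (use zterm_has_sum[OF t] in \<open>auto simp: has_sum_iff\<close>)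
  then have "(?g has_sum zser (Suc l) m t) ?D"
    by (intro has_sum_SigmaI[OF inner zterm_has_sum[OF t]])
  also have "(?g has_sum zser (Suc l) m t) ?D \<longleftrightarrow> (?f has_sum zser (Suc l) m t) ({1..} \<times> {1..})"
  proof (rule has_sum_reindex_bij_witness[where i = "\<lambda>(d, j). (d * j, j)" and j = "\<lambda>(N, j). (N div j, j)"])
    fix a assume "a \<in> ?D"
    then obtain N j where a: "a = (N, j)" "j dvd N" "N \<ge> 1" by auto
    then obtain d where N: "N = j * d" by auto
    then have pos: "j > 0" "d > 0" using a by (auto intro: Nat.gr0I)
    show "(\<lambda>(d, j). (d * j, j)) ((\<lambda>(N, j). (N div j, j)) a) = a" using a by simp
    show "(\<lambda>(N, j). (N div j, j)) a \<in> {1..} \<times> {1..}" using a N pos by simp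
    \<comment> \<open>The weights for \<open>l\<close> and \<open>l + 1\<close> differ by one power
      of \<open>j\<close>; it is the factor \<open>j\<close> in the recursion of
      \<open>tcount\<close>.\<close>
    have "real j powi (m - int l) = real j powi (m - int (Suc l)) * real j"
      using pos power_int_add[of "real j" "m - int (Suc l)" 1] by (simp add: algebra_simps)
    then show "?f ((\<lambda>(N, j). (N div j, j)) a) = ?g a"
      using a N pos by (simp add: zterm_def power_int_mult_distrib mult_ac)
  next
    fix b assume "b \<in> {1::nat..} \<times> {1::nat..}"
    then show "(\<lambda>(N, j). (N div j, j)) ((\<lambda>(d, j). (d * j, j)) b) = b"
      "(\<lambda>(d, j). (d * j, j)) b \<in> ?D" by auto
  qed simp
  finally have "(?f has_sum zser (Suc l) m t) ({1..} \<times> {1..})" .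
  moreover have "((\<lambda>j. ?f (d, j)) has_sum (real d powi (m - int (Suc l)) * zser l m (real d * t))) {1..}"
    if "d \<in> {1..}" for d
    using has_sum_cmult_right[OF zterm_has_sum[of "real d * t" l m]] that t by simp
  ultimately show ?thesis by (rule has_sum_SigmaD)
qed

text \<open>The multiple series obeys the recursion \<open>zser_rec\<close>: fixing the last
  component \<open>d\<close> of the index leaves the series for \<open>l\<close> at
  \<open>d * t\<close>.\<close>

lemma Z_fun_has_sum:
  assumes "t > 0"
  shows "((\<lambda>\<delta>. (\<Prod>i=1..l. real (\<delta> i) powi (m - int i)) * exp (- (\<Prod>i=1..l. real (\<delta> i)) * t))
    has_sum zser l m t) ({1..l} \<rightarrow>\<^sub>E {1::nat..})"
  using assms
proof (induction l arbitrary: t)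
  case 0
  have "(zterm 0 m t has_sum exp (- t)) {1..}"
    by (rule has_sum_cong_neutral[THEN iffD1, OF _ _ _ has_sum_finiteI[of "{1}" "exp (-t)"]])
       (auto simp: zterm_def)
  then have "zser 0 m t = exp (- t)" using zterm_has_sum[OF 0] has_sum_unique by blast
  then show ?case by (intro has_sum_finiteI) auto
next
  case (Suc l)
  let ?T = "\<lambda>l t \<delta>. (\<Prod>i=1..l. real (\<delta> i) powi (m - int i)) * exp (- (\<Prod>i=1..l. real (\<delta> i)) * t)"
  let ?P = "\<lambda>l. {1..l} \<rightarrow>\<^sub>E {1::nat..}"
  let ?h = "\<lambda>(d, \<delta>). \<delta>(Suc l := d)"
  let ?f = "\<lambda>(d, \<delta>). real d powi (m - int (Suc l)) * ?T l (real d * t) \<delta>"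
  have inner: "((\<lambda>\<delta>. ?f (d, \<delta>)) has_sum real d powi (m - int (Suc l)) * zser l m (real d * t)) (?P l)"
    if "d \<in> {1..}" for d
    using has_sum_cmult_right[OF Suc.IH[of "real d * t"], of "real d powi (m - int (Suc l))"] that Suc.prems by simp
  have "?f summable_on ({1::nat..} \<times> ?P l)"
    by (rule summable_on_SigmaI[OF inner]) (use zser_rec[OF Suc.prems, of m l] in \<open>auto simp: has_sum_iff intro!: mult_nonneg_nonneg prod_nonneg\<close>)
  then have "(?f has_sum zser (Suc l) m t) ({1::nat..} \<times> ?P l)"
    by (intro has_sum_SigmaI[OF inner zser_rec[OF Suc.prems]])
  moreover have "?T (Suc l) t (?h x) = ?f x" if "x \<in> {1::nat..} \<times> ?P l" for x
  proof -
    obtain d \<delta> where x: "x = (d, \<delta>)" by (cases x)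
    have "(\<Prod>i=1..l. real ((\<delta>(Suc l := d)) i) powi (m - int i)) = (\<Prod>i=1..l. real (\<delta> i) powi (m - int i))"
      "(\<Prod>i=1..l. real ((\<delta>(Suc l := d)) i)) = (\<Prod>i=1..l. real (\<delta> i))"
      by (rule prod.cong; simp)+
    then show ?thesis by (simp add: x mult_ac)
  qed
  ultimately have "((\<lambda>x. ?T (Suc l) t (?h x)) has_sum zser (Suc l) m t) ({1::nat..} \<times> ?P l)"
    by (subst has_sum_cong[where g = ?f]) auto
  then have "(?T (Suc l) t has_sum zser (Suc l) m t) (?h ` ({1::nat..} \<times> ?P l))"
    by (subst has_sum_reindex) (auto intro!: inj_combinator simp: o_def)
  also have "?h ` ({1::nat..} \<times> ?P l) = ?P (Suc l)"
    using PiE_insert_eq[of "Suc l" "{1..l}" "\<lambda>_. {1::nat..}"] by (simp add: atLeastAtMostSuc_conv)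
  finally show ?case .
qed

lemma Z_fun_eq_zser: "t > 0 \<Longrightarrow> Z_fun l m t = zser l m t"
  unfolding Z_fun_def by (rule infsumI[OF Z_fun_has_sum])

lemma zser_nonneg: "zser l m t \<ge> 0"
  unfolding zser_def by (rule infsum_nonneg) (rule zterm_nonneg)

section \<open>Behaviour of the series at zero\<close>

lemma tcount_1: "tcount (Suc 0) k = (if k = 0 then 0 else 1)"
proof (cases "k = 0")
  case False
  have "tcount (Suc 0) k = (\<Sum>j | j dvd k. if j = 1 then 1 else 0)"
    by (simp only: tcount.simps, rule sum.cong) auto
  also have "\<dots> = 1" using False by (subst sum.delta) auto
  finally show ?thesis using False by simp
qed (simp add: tcount_0_right)

lemma range_Suc: "range Suc = {1..}"
  by (auto simp: image_iff Suc_le_eq gr0_conv_Suc)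

lemma zser_1_sums:
  assumes "t > 0"
  shows "(\<lambda>n. real (Suc n) ^ p * exp (- t) ^ Suc n) sums zser 1 (int (Suc p)) t"
proof -
  have "zterm 1 (int (Suc p)) t 0 = 0" by (simp add: zterm_def tcount_0_right)
  then have "(\<lambda>n. zterm 1 (int (Suc p)) t (Suc n)) sums zser 1 (int (Suc p)) t"
    using zser_sums[OF assms, of 1 "int (Suc p)"] by (subst sums_Suc_iff) simp
  moreover have "zterm 1 (int (Suc p)) t (Suc n) = real (Suc n) ^ p * exp (- t) ^ Suc n" for n
  proof -
    have "exp (- t) ^ Suc n = exp (- real (Suc n) * t)"
      by (subst exp_of_nat_mult[symmetric]) (simp add: algebra_simps)
    moreover have "real (tcount 1 (Suc n)) = 1" using tcount_1[of "Suc n"] by (simp del: tcount.simps)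
    ultimately show ?thesis by (simp add: zterm_def del: tcount.simps)
  qed
  ultimately show ?thesis by (simp only:)
qed

text \<open>Multiplication by \<open>1 - exp (- t)\<close> takes differences of the coefficients and so lowers the power.\<close>

lemma zser_1_rec:
  assumes t: "t > 0"
  shows "(1 - exp (- t)) * zser 1 (int (Suc (Suc p))) t =
    (\<Sum>j\<le>p. - (real (Suc p choose j) * (-1) ^ (Suc p - j)) * zser 1 (int (Suc j)) t)"
proof -
  let ?r = "exp (- t)" and ?S = "\<lambda>j. zser 1 (int (Suc j)) t"
  have S: "(\<lambda>n. real (Suc n) ^ Suc p * ?r ^ Suc n) sums ?S (Suc p)" by (rule zser_1_sums[OF t])
  have "(\<lambda>n. ?r * (real (Suc n) ^ Suc p * ?r ^ Suc n)) sums (?r * ?S (Suc p))"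
    using S by (rule sums_mult)
  then have "(\<lambda>n. real (Suc n) ^ Suc p * ?r ^ Suc (Suc n)) sums (?r * ?S (Suc p))"
    by (simp add: mult_ac)
  then have "(\<lambda>n. real n ^ Suc p * ?r ^ Suc n) sums (?r * ?S (Suc p))"
    by (subst (asm) sums_Suc_iff[where f = "\<lambda>n. real n ^ Suc p * ?r ^ Suc n"]) simp
  then have 1: "(\<lambda>n. real (Suc n) ^ Suc p * ?r ^ Suc n - real n ^ Suc p * ?r ^ Suc n)
      sums (?S (Suc p) - ?r * ?S (Suc p))"
    by (rule sums_diff[OF S])
  have 2: "(\<lambda>n. \<Sum>j\<le>p. - (real (Suc p choose j) * (-1) ^ (Suc p - j)) * (real (Suc n) ^ j * ?r ^ Suc n)) sums
      (\<Sum>j\<le>p. - (real (Suc p choose j) * (-1) ^ (Suc p - j)) * ?S j)"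
    by (intro sums_sum sums_mult zser_1_sums[OF t])
  have "real (Suc n) ^ Suc p * ?r ^ Suc n - real n ^ Suc p * ?r ^ Suc n =
    (\<Sum>j\<le>p. - (real (Suc p choose j) * (-1) ^ (Suc p - j)) * (real (Suc n) ^ j * ?r ^ Suc n))" for n
  proof -
    have "real n ^ Suc p = (real (Suc n) + (-1)) ^ Suc p" by simp
    also have "\<dots> = (\<Sum>j\<le>Suc p. real (Suc p choose j) * real (Suc n) ^ j * (-1) ^ (Suc p - j))"
      by (rule binomial_ring)
    also have "\<dots> = (\<Sum>j\<le>p. real (Suc p choose j) * real (Suc n) ^ j * (-1) ^ (Suc p - j)) + real (Suc n) ^ Suc p"
      by (simp only: sum.atMost_Suc binomial_n_n) simp
    finally have "real (Suc n) ^ Suc p - real n ^ Suc p =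
      - (\<Sum>j\<le>p. real (Suc p choose j) * real (Suc n) ^ j * (-1) ^ (Suc p - j))" by linarith
    then have "(real (Suc n) ^ Suc p - real n ^ Suc p) * ?r ^ Suc n =
      - (\<Sum>j\<le>p. real (Suc p choose j) * real (Suc n) ^ j * (-1) ^ (Suc p - j)) * ?r ^ Suc n" by (simp only:)
    also have "\<dots> = (\<Sum>j\<le>p. - (real (Suc p choose j) * (-1) ^ (Suc p - j)) * (real (Suc n) ^ j * ?r ^ Suc n))"
      unfolding sum_negf[symmetric] sum_distrib_right by (rule sum.cong[OF refl]) (simp only: mult_ac mult_minus_left mult_minus_right)
    finally show ?thesis by (simp only: left_diff_distrib)
  qed
  with 1 2 have "?S (Suc p) - ?r * ?S (Suc p) =
      (\<Sum>j\<le>p. - (real (Suc p choose j) * (-1) ^ (Suc p - j)) * ?S j)"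
    by (simp only: sums_iff)
  then show ?thesis by (simp only: left_diff_distrib mult_1_left)
qed

text \<open>\<open>zser_1_rec\<close> expresses case \<open>q + 1\<close> through the cases
  \<open>j \<le> q\<close>. After multiplication by the power of \<open>t\<close>, only
  \<open>j = q\<close> keeps no spare power of \<open>t\<close>; its coefficient
  \<open>q + 1\<close> builds up the factorial, while \<open>t / (1 - exp (- t))\<close> tends to
  \<open>1\<close>.\<close>

lemma zser_1_limit:
  "((\<lambda>t. t ^ Suc p * zser 1 (int (Suc p)) t) \<longlongrightarrow> fact p) (at_right 0)"
proof (induction p rule: less_induct)
  case (less p)
  have pos: "\<forall>\<^sub>F t::real in at_right 0. t > 0" by (simp add: eventually_at_right_less)
  show ?case
  proof (cases p)
    case 0
    have "((\<lambda>t::real. t * (exp (- t) / (1 - exp (- t)))) \<longlongrightarrow> 1) (at_right 0)" by real_asymp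
    moreover have "\<forall>\<^sub>F t in at_right 0. t * (exp (- t) / (1 - exp (- t))) = t ^ Suc p * zser 1 (int (Suc p)) t"
      using pos
    proof eventually_elim
      case (elim t)
      have "(\<lambda>n. exp (- t) * exp (- t) ^ n) sums (exp (- t) * (1 / (1 - exp (- t))))"
        using elim by (intro sums_mult geometric_sums) auto
      then have "zser 1 (int (Suc p)) t = exp (- t) / (1 - exp (- t))"
        using zser_1_sums[OF elim, of 0] 0 sums_unique2 by fastforce
      then show ?case using 0 by simp
    qed
    ultimately show ?thesis using 0 by (auto intro: Lim_transform_eventually)
  next
    case (Suc q)
    let ?c = "\<lambda>j. - (real (Suc q choose j) * (-1) ^ (Suc q - j))"
    let ?g = "\<lambda>j t. t ^ Suc j * zser 1 (int (Suc j)) t"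
    have "((\<lambda>t. t / (1 - exp (- t)) * (\<Sum>j\<le>q. ?c j * (t ^ (q - j) * ?g j t))) \<longlongrightarrow>
      1 * (\<Sum>j\<le>q. ?c j * (0 ^ (q - j) * fact j))) (at_right 0)"
    proof (intro tendsto_mult tendsto_sum tendsto_const tendsto_power)
      show "((\<lambda>t::real. t / (1 - exp (- t))) \<longlongrightarrow> 1) (at_right 0)" by real_asymp
    qed (use less Suc in \<open>auto\<close>)
    also have "1 * (\<Sum>j\<le>q. ?c j * (0 ^ (q - j) * fact j)) = (\<Sum>j\<le>q. if j = q then fact p else 0)"
      unfolding mult_1_left by (rule sum.cong) (auto simp: Suc power_0_left algebra_simps)
    also have "\<dots> = fact p" by simp
    finally have *: "((\<lambda>t. t / (1 - exp (- t)) * (\<Sum>j\<le>q. ?c j * (t ^ (q - j) * ?g j t))) \<longlongrightarrow> fact p) (at_right 0)" .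
    have "\<forall>\<^sub>F t in at_right 0. t / (1 - exp (- t)) * (\<Sum>j\<le>q. ?c j * (t ^ (q - j) * ?g j t)) =
      t ^ Suc p * zser 1 (int (Suc p)) t"
      using pos
    proof eventually_elim
      case (elim t)
      have "(\<Sum>j\<le>q. ?c j * (t ^ (q - j) * ?g j t)) = (\<Sum>j\<le>q. t ^ Suc q * (?c j * zser 1 (int (Suc j)) t))"
      proof (rule sum.cong[OF refl])
        fix j assume "j \<in> {..q}"
        then have "t ^ Suc q = t ^ (q - j) * t ^ Suc j" by (simp flip: power_add)
        then show "?c j * (t ^ (q - j) * ?g j t) = t ^ Suc q * (?c j * zser 1 (int (Suc j)) t)"
          by (simp only: mult_ac)
      qed
      also have "\<dots> = t ^ Suc q * ((1 - exp (- t)) * zser 1 (int (Suc p)) t)"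
        unfolding Suc zser_1_rec[OF elim] sum_distrib_left ..
      finally show ?case using elim by (simp add: Suc)
    qed
    with * show ?thesis by (rule Lim_transform_eventually)
  qed
qed

text \<open>The limit bounds the function near \<open>0\<close>; away from \<open>0\<close>,
  \<open>power_exp_decay\<close> bounds it by a multiple of \<open>1 / t\<close>. A bound on the
  whole half-line is what \<open>zser_limit\<close> starts from.\<close>

lemma zser_1_bounded: "\<exists>C. \<forall>t>0. \<bar>t ^ Suc p * zser 1 (int (Suc p)) t\<bar> \<le> C"
proof -
  let ?g = "\<lambda>t. t ^ Suc p * zser 1 (int (Suc p)) t"
  have "\<forall>\<^sub>F t in at_right 0. \<bar>?g t\<bar> < fact p + 1"
    using tendsto_rabs[OF zser_1_limit[of p]] by (rule order_tendstoD) simp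
  then obtain \<delta> where \<delta>: "\<delta> > 0" "\<And>t. 0 < t \<Longrightarrow> t < \<delta> \<Longrightarrow> \<bar>?g t\<bar> < fact p + 1"
    unfolding eventually_at_right_field by blast
  have sq: "summable (\<lambda>n. 1 / real (Suc n) ^ 2)"
    using inverse_power_summable[of 2, where 'a = real] summable_Suc_iff[of "\<lambda>n. 1 / real n ^ 2"]
    by (simp add: field_simps)
  let ?B = "fact (p + 2) * (\<Sum>n. 1 / real (Suc n) ^ 2)"
  have "\<bar>?g t\<bar> \<le> max (fact p + 1) (?B / \<delta>)" if "t > 0" for t
  proof (cases "t < \<delta>")
    case True then show ?thesis using \<delta>(2)[OF that] by simp
  next
    case False
    have "zser 1 (int (Suc p)) t \<le> fact (p + 2) / t ^ (p + 2) * (\<Sum>n. 1 / real (Suc n) ^ 2)"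
    proof (rule sums_le[OF _ zser_1_sums[OF that] sums_mult[OF summable_sums[OF sq]]])
      fix n
      have "exp (- t) ^ Suc n = exp (- real (Suc n) * t)"
        by (subst exp_of_nat_mult[symmetric]) (simp add: algebra_simps)
      then show "real (Suc n) ^ p * exp (- t) ^ Suc n \<le> fact (p + 2) / t ^ (p + 2) * (1 / real (Suc n) ^ 2)"
        using power_exp_decay[OF that, of "Suc n" p] by simp
    qed
    then have "?g t \<le> t ^ Suc p * (fact (p + 2) / t ^ (p + 2) * (\<Sum>n. 1 / real (Suc n) ^ 2))"
      using that by (intro mult_left_mono) auto
    also have "\<dots> = ?B / t" using that by simp
    also have "\<dots> \<le> ?B / \<delta>"
      using False \<delta>(1) that by (intro divide_left_mono mult_nonneg_nonneg suminf_nonneg sq) auto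
    finally have "?g t \<le> ?B / \<delta>" .
    moreover have "?g t \<ge> 0"
      using that zser_nonneg by simp
    ultimately show ?thesis by simp
  qed
  then show ?thesis by blast
qed

text \<open>By \<open>zser_rec\<close>, passing from \<open>l\<close> to \<open>l + 1\<close>
  replaces \<open>g t = t ^ m * zser l m t\<close> by the sum over \<open>d\<close> of
  \<open>g (d * t) / d ^ (l + 1)\<close>. Termwise limits produce the next zeta factor. For each
  \<open>t\<close> the arguments \<open>d * t\<close> are unbounded, so Tannery's theorem needs a
  bound of \<open>g\<close> on the whole half-line; it is carried through the induction together
  with the limit.\<close>

lemma zser_limit:
  assumes "m \<ge> 1"
  shows "((\<lambda>t. t ^ m * zser (Suc l) (int m) t) \<longlongrightarrow> fact (m - 1) * (\<Prod>i=2..Suc l. real_zeta (real i))) (at_right 0)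
    \<and> (\<exists>C. \<forall>t>0. \<bar>t ^ m * zser (Suc l) (int m) t\<bar> \<le> C)"
proof (induction l)
  case 0
  obtain p where "m = Suc p" using assms by (cases m) auto
  then show ?case using zser_1_limit[of p] zser_1_bounded[of p] by simp
next
  case (Suc l)
  let ?g = "\<lambda>t. t ^ m * zser (Suc l) (int m) t"
  let ?L = "fact (m - 1) * (\<Prod>i=2..Suc l. real_zeta (real i))"
  let ?w = "\<lambda>n. 1 / real (Suc n) ^ (l + 2)"
  obtain C where C: "\<And>t. t > 0 \<Longrightarrow> \<bar>?g t\<bar> \<le> C" using Suc by blast
  have w: "summable ?w"
    using inverse_power_summable[of "l + 2", where 'a = real] summable_Suc_iff[of "\<lambda>n. 1 / real n ^ (l + 2)"]
    by (simp add: field_simps)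
  have eq: "(\<lambda>n. ?w n * ?g (real (Suc n) * t)) sums (t ^ m * zser (Suc (Suc l)) (int m) t)" if t: "t > 0" for t
  proof -
    have "((\<lambda>d. real d powi (int m - int (Suc (Suc l))) * zser (Suc l) (int m) (real d * t)) has_sum
       zser (Suc (Suc l)) (int m) t) (Suc ` UNIV)"
      using zser_rec[OF t, of "int m" "Suc l"] by (simp only: range_Suc)
    then have "((\<lambda>n. real (Suc n) powi (int m - int (Suc (Suc l))) * zser (Suc l) (int m) (real (Suc n) * t)) has_sum
       zser (Suc (Suc l)) (int m) t) UNIV"
      by (subst (asm) has_sum_reindex) (auto simp: o_def)
    then have "(\<lambda>n. real (Suc n) powi (int m - int (Suc (Suc l))) * zser (Suc l) (int m) (real (Suc n) * t)) sums
       zser (Suc (Suc l)) (int m) t" by (rule has_sum_imp_sums)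
    then have "(\<lambda>n. t ^ m * (real (Suc n) powi (int m - int (Suc (Suc l))) * zser (Suc l) (int m) (real (Suc n) * t))) sums
       (t ^ m * zser (Suc (Suc l)) (int m) t)" by (rule sums_mult)
    moreover have "t ^ m * (real (Suc n) powi (int m - int (Suc (Suc l))) * z) =
      ?w n * ((real (Suc n) * t) ^ m * z)" for n z
    proof -
      have "real (Suc n) powi (int m - int (Suc (Suc l))) = real (Suc n) powi int m / real (Suc n) powi int (Suc (Suc l))"
        by (rule power_int_diff) simp
      then show ?thesis by (simp only: power_int_of_nat power_mult_distrib) simp
    qed
    ultimately show ?thesis by (simp only:)
  qed
  have pos: "\<forall>\<^sub>F t::real in at_right 0. t > 0" by (simp add: eventually_at_right_less)
  have T: "((\<lambda>t. \<Sum>n. ?w n * ?g (real (Suc n) * t)) \<longlongrightarrow> (\<Sum>n. ?w n * ?L)) (at_right 0)"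
  proof (rule tannerys_theorem[THEN conjunct2, THEN conjunct2])
    fix n
    have "filterlim (\<lambda>t. real (Suc n) * t) (at_right 0) (at_right 0)"
      by (rule filterlim_at_withinI)
         (auto intro!: tendsto_eq_intros eventually_mono[OF pos] simp del: of_nat_Suc)
    then show "((\<lambda>t. ?w n * ?g (real (Suc n) * t)) \<longlongrightarrow> ?w n * ?L) (at_right 0)"
      by (intro tendsto_mult_left) (rule filterlim_compose[OF Suc[THEN conjunct1]])
  next
    show "summable (\<lambda>n. ?w n * C)" using w by (rule summable_mult2)
    have "\<forall>\<^sub>F x in (at_top :: nat filter) \<times>\<^sub>F at_right 0. True \<and> snd x > (0::real)"
      by (rule eventually_prodI[OF _ pos]) simp
    then show "\<forall>\<^sub>F (n, t) in at_top \<times>\<^sub>F at_right 0. norm (?w n * ?g (real (Suc n) * t)) \<le> ?w n * C"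
    proof (rule eventually_mono)
      fix x :: "nat \<times> real" assume x: "True \<and> snd x > 0"
      obtain n t where [simp]: "x = (n, t)" by (cases x)
      have gC: "\<bar>?g (real (Suc n) * t)\<bar> \<le> C" using x by (intro C) simp
      then have "norm (?w n * ?g (real (Suc n) * t)) \<le> ?w n * C"
        unfolding real_norm_def by (subst abs_mult) (rule mult_mono[OF _ gC], simp_all)
      then show "case x of (n, t) \<Rightarrow> norm (?w n * ?g (real (Suc n) * t)) \<le> ?w n * C"
        by (simp only: \<open>x = (n, t)\<close> prod.case)
    qed
  qed simp
  have zeta: "suminf ?w = real_zeta (real (Suc (Suc l)))"
    unfolding real_zeta_def by (subst powr_realpow) simp_all
  have "(\<Sum>n. ?w n * ?L) = real_zeta (real (Suc (Suc l))) * ?L"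
    using suminf_mult2[OF w, of ?L] zeta by simp
  also have "\<dots> = fact (m - 1) * (\<Prod>i=2..Suc (Suc l). real_zeta (real i))" by simp
  finally have L: "(\<Sum>n. ?w n * ?L) = fact (m - 1) * (\<Prod>i=2..Suc (Suc l). real_zeta (real i))" .
  have "\<forall>\<^sub>F t in at_right 0. (\<Sum>n. ?w n * ?g (real (Suc n) * t)) = t ^ m * zser (Suc (Suc l)) (int m) t"
    using pos by eventually_elim (use eq in \<open>simp only: sums_iff\<close>)
  with T[unfolded L] have lim: "((\<lambda>t. t ^ m * zser (Suc (Suc l)) (int m) t) \<longlongrightarrow>
    fact (m - 1) * (\<Prod>i=2..Suc (Suc l). real_zeta (real i))) (at_right 0)" by (rule Lim_transform_eventually)
  have "\<bar>t ^ m * zser (Suc (Suc l)) (int m) t\<bar> \<le> (\<Sum>n. ?w n * C)" if t: "t > 0" for t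
  proof -
    have "norm (\<Sum>n. ?w n * ?g (real (Suc n) * t)) \<le> (\<Sum>n. ?w n * C)"
    proof (rule norm_suminf_le)
      show "summable (\<lambda>n. ?w n * C)" using w by (rule summable_mult2)
      fix n
      have gC: "\<bar>?g (real (Suc n) * t)\<bar> \<le> C" using t by (intro C) simp
      then show "norm (?w n * ?g (real (Suc n) * t)) \<le> ?w n * C"
        unfolding real_norm_def by (subst abs_mult) (rule mult_mono[OF _ gC], simp_all)
    qed
    then show ?thesis using eq[OF t] by (simp only: sums_iff real_norm_def)
  qed
  with lim show ?case by blast
qed

section \<open>Coefficients of the exponential generating function\<close>

text \<open>Up to sign the \<open>j\<close>-th derivative of \<open>F (exp (- t))\<close>, where
  \<open>F\<close> is the power series with coefficients \<open>f\<close>.\<close>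

definition moment :: "(nat \<Rightarrow> real) \<Rightarrow> nat \<Rightarrow> real \<Rightarrow> real" where
  "moment f j t = (\<Sum>k. real k ^ j * f k * exp (- real k * t))"

text \<open>\<open>F\<close> at the point \<open>exp (- t + \<i> * \<theta>)\<close> of the circle
  used in Cauchy's formula.\<close>

definition cgen :: "(nat \<Rightarrow> real) \<Rightarrow> real \<Rightarrow> real \<Rightarrow> complex" where
  "cgen f t \<theta> = (\<Sum>k. complex_of_real (f k * exp (- real k * t)) * iexp (real k * \<theta>))"

text \<open>The factor \<open>k\<close> compensates the division by \<open>k\<close> built into
  \<open>hcoef\<close>, so these are the coefficients of \<open>exp (y * F z)\<close>.\<close>

abbreviation ecoef :: "(nat \<Rightarrow> real) \<Rightarrow> real \<Rightarrow> nat \<Rightarrow> real" where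
  "ecoef f y \<equiv> hcoef (\<lambda>k. y * (real k * f k))"

text \<open>\<open>H = exp (y * F)\<close> satisfies \<open>H' = y * F' * H\<close>; comparing
  coefficients gives the recursion of \<open>hcoef\<close>.\<close>

lemma fps_exp_compose_nth:
  assumes "f 0 = 0"
  shows "fps_nth (fps_exp (complex_of_real y) oo Abs_fps (\<lambda>k. complex_of_real (f k))) n = of_real (ecoef f y n)"
proof (induction n rule: less_induct)
  case (less n)
  let ?F = "Abs_fps (\<lambda>k. complex_of_real (f k))"
  let ?H = "fps_exp (complex_of_real y) oo ?F"
  have F0: "fps_nth ?F 0 = 0" using assms by simp
  show ?case
  proof (cases n)
    case 0 then show ?thesis by simp
  next
    case (Suc m)
    have "fps_deriv ?H = (fps_deriv (fps_exp (complex_of_real y)) oo ?F) * fps_deriv ?F"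
      by (rule fps_compose_deriv[OF F0])
    also have "\<dots> = fps_const (complex_of_real y) * (fps_deriv ?F * ?H)"
      using F0 by (simp add: fps_compose_mult_distrib mult_ac)
    finally have "fps_nth (fps_deriv ?H) m = of_real y * fps_nth (fps_deriv ?F * ?H) m" by simp
    then have "of_nat (Suc m) * fps_nth ?H (Suc m) =
      of_real y * (\<Sum>i=0..m. fps_nth (fps_deriv ?F) i * fps_nth ?H (m - i))"
      by (simp only: fps_mult_nth fps_deriv_nth Suc_eq_plus1)
    also have "\<dots> = (\<Sum>i\<le>m. of_real (y * (real (Suc i) * f (Suc i)) * ecoef f y (m - i)))"
      unfolding sum_distrib_left atLeast0AtMost
      by (rule sum.cong[OF refl]) (use less Suc in \<open>simp add: mult_ac\<close>)
    finally have "of_nat (Suc m) * fps_nth ?H (Suc m) = of_real (real (Suc m) * ecoef f y (Suc m))"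
      by (simp add: of_real_sum[symmetric] del: of_real_sum of_real_mult)
    then show ?thesis
      unfolding Suc of_real_mult of_real_of_nat_eq using mult_cancel_left[of "of_nat (Suc m) :: complex"] of_nat_neq_0 by blast
  qed
qed

lemma hcoef_nonneg: "(\<And>k. c k \<ge> 0) \<Longrightarrow> hcoef c n \<ge> 0"
  by (induction n rule: less_induct) (case_tac x, auto intro!: divide_nonneg_nonneg sum_nonneg mult_nonneg_nonneg)

lemma hcoef_pos: "(\<And>k. c k \<ge> 0) \<Longrightarrow> c 1 > 0 \<Longrightarrow> hcoef c n > 0"
proof (induction n)
  case (Suc n)
  have "0 < c (Suc 0) * hcoef c (n - 0)" using Suc by simp
  also have "\<dots> \<le> (\<Sum>k\<le>n. c (Suc k) * hcoef c (n - k))"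
    by (rule member_le_sum[where f = "\<lambda>k. c (Suc k) * hcoef c (n - k)"]) (auto simp: Suc hcoef_nonneg)
  finally show ?case by simp
qed simp

locale coeff_growth =
  fixes f :: "nat \<Rightarrow> real" and B :: nat
  assumes f0: "f 0 = 0" and f_nonneg: "\<And>k. f k \<ge> 0" and f_le: "\<And>k. f k \<le> real k ^ B"
begin

lemma summable_moment:
  assumes "t > 0"
  shows "summable (\<lambda>k. real k ^ j * f k * exp (- real k * t))"
proof (rule summable_comparison_test')
  show "summable (\<lambda>k. real k ^ (j + B) * exp (- real k * t))" by (rule summable_power_exp[OF assms])
  show "norm (real k ^ j * f k * exp (- real k * t)) \<le> real k ^ (j + B) * exp (- real k * t)" for k
    using f_nonneg[of k] f_le[of k] by (simp add: power_add mult_left_mono mult_right_mono)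
qed

lemma moment_sums: "t > 0 \<Longrightarrow> (\<lambda>k. real k ^ j * f k * exp (- real k * t)) sums moment f j t"
  unfolding moment_def by (intro summable_sums summable_moment)

lemma moment_nonneg: "t > 0 \<Longrightarrow> moment f j t \<ge> 0"
  unfolding moment_def by (intro suminf_nonneg summable_moment) (auto simp: f_nonneg)

lemma cgen_sums:
  assumes "t > 0"
  shows "(\<lambda>k. complex_of_real (f k * exp (- real k * t)) * iexp (real k * \<theta>)) sums cgen f t \<theta>"
proof -
  have "summable (\<lambda>k. norm (complex_of_real (f k * exp (- real k * t)) * iexp (real k * \<theta>)))"
    using summable_moment[OF assms, of 0] f_nonneg by (simp add: norm_mult)
  then show ?thesis unfolding cgen_def by (intro summable_sums) (rule summable_norm_cancel)
qed

lemma exp_power_iexp: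
  "exp (complex_of_real (- t) + \<i> * \<theta>) ^ k = complex_of_real (exp (- real k * t)) * iexp (real k * \<theta>)"
  by (simp add: exp_of_nat_mult[symmetric] exp_of_real[symmetric] exp_add[symmetric] algebra_simps)

lemma fps_conv_radius_ge_1: "fps_conv_radius (Abs_fps (\<lambda>k. complex_of_real (f k))) \<ge> 1"
  unfolding fps_conv_radius_def fps_nth_Abs_fps
proof (rule conv_radius_geI_ex')
  fix r :: real assume r: "0 < r" "ereal r < 1"
  define t where "t = - ln r"
  have t: "t > 0" using r by (simp add: t_def)
  have "summable (\<lambda>k. complex_of_real (f k * exp (- real k * t)))"
    using summable_moment[OF t, of 0] by (subst summable_of_real_iff) simp
  moreover have "exp (- real k * t) = r ^ k" for k
    using r by (simp add: t_def exp_of_nat_mult)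
  ultimately show "summable (\<lambda>n. complex_of_real (f n) * complex_of_real r ^ n)" by simp
qed

text \<open>\<open>exp (y * F)\<close> is holomorphic on the unit disc because \<open>F\<close> is,
  so its formal expansion converges there and represents it. Convergence is thus obtained without
  estimating \<open>ecoef\<close>.\<close>

lemma ecoef_sums:
  assumes t: "t > 0"
  shows "(\<lambda>n. complex_of_real (ecoef f y n * exp (- real n * t)) * iexp (real n * \<theta>)) sums
    exp (complex_of_real y * cgen f t \<theta>)"
proof -
  let ?F = "Abs_fps (\<lambda>k. complex_of_real (f k))"
  let ?z = "exp (complex_of_real (- t) + \<i> * \<theta>)"
  have rad: "fps_conv_radius ?F \<ge> 1" by (rule fps_conv_radius_ge_1)
  have "((\<lambda>x. exp (complex_of_real y * x)) \<circ> eval_fps ?F) has_fps_expansion (fps_exp (complex_of_real y) oo ?F)"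
    using rad f0 by (intro has_fps_expansion_compose has_fps_expansion_exp eval_fps_has_fps_expansion)
      (auto intro: less_le_trans[of _ 1])
  moreover have "eball 0 1 \<subseteq> eball 0 (fps_conv_radius ?F)" by (auto intro!: less_le_trans[OF _ rad])
  then have "((\<lambda>x. exp (complex_of_real y * x)) \<circ> eval_fps ?F) holomorphic_on eball 0 1"
    unfolding o_def by (intro holomorphic_intros)
  moreover have "ereal (norm ?z) < 1" using t by (simp add: norm_exp_eq_Re)
  ultimately have "(\<lambda>n. fps_nth (fps_exp (complex_of_real y) oo ?F) n * ?z ^ n) sums
    ((\<lambda>x. exp (complex_of_real y * x)) \<circ> eval_fps ?F) ?z"
    by (rule has_fps_expansion_imp_sums_complex)
  moreover have "eval_fps ?F ?z = cgen f t \<theta>"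
    unfolding eval_fps_def cgen_def exp_power_iexp by (simp add: mult_ac)
  ultimately have "(\<lambda>n. complex_of_real (ecoef f y n) * (complex_of_real (exp (- real n * t)) * iexp (real n * \<theta>))) sums
    exp (complex_of_real y * cgen f t \<theta>)"
    unfolding o_def by (simp only: fps_exp_compose_nth[of f, OF f0] exp_power_iexp)
  then show ?thesis by (simp only: of_real_mult mult.assoc)
qed

lemma cgen_0: "t > 0 \<Longrightarrow> cgen f t 0 = of_real (moment f 0 t)"
  using cgen_sums[of t 0] sums_of_real[OF moment_sums[of t 0], where 'a = complex] sums_unique2
  by fastforce

lemma ecoef_nonneg: "y \<ge> 0 \<Longrightarrow> ecoef f y n \<ge> 0"
  by (intro hcoef_nonneg) (auto simp: f_nonneg)

lemma summable_ecoef: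
  assumes "t > 0"
  shows "summable (\<lambda>n. ecoef f y n * exp (- real n * t))"
proof -
  have "summable (\<lambda>n. complex_of_real (ecoef f y n * exp (- real n * t)))"
    using ecoef_sums[OF assms, of y 0] by (simp add: sums_iff)
  then show ?thesis by (subst (asm) summable_of_real_iff)
qed

end

section \<open>Cauchy's formula for the coefficients\<close>

lemma integral_iexp_period:
  "(CLINT \<theta>|lborel. indicator {-pi..pi} \<theta> *\<^sub>R iexp (of_int k * \<theta>)) = (if k = 0 then 2 * pi else 0)"
proof (cases "k = 0")
  case True
  then show ?thesis by (simp add: scaleR_conv_of_real)
next
  case False
  have "(CLINT \<theta>|lborel. indicator {-pi..pi} \<theta> *\<^sub>R iexp (of_int k * \<theta>)) =
    iexp (of_int k * pi) / (\<i> * of_int k) - iexp (of_int k * (- pi)) / (\<i> * of_int k)"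
  proof (rule integral_FTC_Icc)
    fix x :: real
    show "((\<lambda>\<theta>. iexp (of_int k * \<theta>) / (\<i> * of_int k)) has_vector_derivative iexp (of_int k * x)) (at x within {-pi..pi})"
      using False
      by (auto intro!: derivative_eq_intros has_vector_derivative_real_field simp: field_simps)
  qed (auto intro!: continuous_intros)
  also have "iexp (of_int k * pi) = iexp (of_int k * (- pi))"
  proof -
    have "iexp (of_int k * pi) = iexp (of_int k * (- pi)) * exp ((2 * of_int k * complex_of_real pi) * \<i>)"
      unfolding exp_add[symmetric] by (rule arg_cong[where f = exp]) (simp add: algebra_simps)
    also have "exp ((2 * of_int k * complex_of_real pi) * \<i>) = 1" using exp_integer_2pi[of "of_int k"] by simp
    finally show ?thesis by (simp only: mult_1_right)
  qed
  finally show ?thesis using False by simp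
qed

text \<open>Absolute summability allows termwise integration over a period, and orthogonality keeps
  only the index \<open>n\<close>.\<close>

lemma fourier_coefficient:
  fixes a :: "nat \<Rightarrow> real"
  assumes "summable (\<lambda>k. \<bar>a k\<bar>)" "\<And>\<theta>. (\<lambda>k. complex_of_real (a k) * iexp (real k * \<theta>)) sums S \<theta>"
  shows "(CLINT \<theta>|lborel. indicator {-pi..pi} \<theta> *\<^sub>R (S \<theta> * iexp (- (real n * \<theta>)))) = 2 * pi * a n"
proof -
  let ?h = "\<lambda>k \<theta>. indicator {-pi..pi} \<theta> *\<^sub>R (complex_of_real (a k) * iexp (of_int (int k - int n) * \<theta>))"
  have int0: "integrable lborel (\<lambda>\<theta>. indicator {-pi..pi} \<theta> *\<^sub>R iexp (of_int k * \<theta>))" for k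
    by (rule borel_integrable_atLeastAtMost'[unfolded set_integrable_def]) (intro continuous_intros)
  have hk: "?h k = (\<lambda>\<theta>. complex_of_real (a k) * (indicator {-pi..pi} \<theta> *\<^sub>R iexp (of_int (int k - int n) * \<theta>)))" for k
    by (simp add: fun_eq_iff)
  have inth: "integrable lborel (?h k)" for k unfolding hk by (intro integrable_mult_right int0)
  have norm_h: "norm (?h k \<theta>) = indicator {-pi..pi} \<theta> * \<bar>a k\<bar>" for k \<theta>
    by (simp add: norm_mult indicator_def)
  have "(\<lambda>k. integral\<^sup>L lborel (?h k)) sums (\<integral>\<theta>. (\<Sum>k. ?h k \<theta>) \<partial>lborel)"
  proof (rule sums_integral[OF inth])
    show "AE \<theta> in lborel. summable (\<lambda>k. norm (?h k \<theta>))"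
      unfolding norm_h using assms(1) by (intro AE_I2 summable_mult)
    show "summable (\<lambda>k. \<integral>\<theta>. norm (?h k \<theta>) \<partial>lborel)"
      unfolding norm_h using assms(1) by (simp add: summable_mult2 summable_mult)
  qed
  moreover have "(\<Sum>k. ?h k \<theta>) = indicator {-pi..pi} \<theta> *\<^sub>R (S \<theta> * iexp (- (real n * \<theta>)))" for \<theta>
  proof -
    have "(\<lambda>k. indicator {-pi..pi} \<theta> *\<^sub>R (complex_of_real (a k) * iexp (real k * \<theta>) * iexp (- (real n * \<theta>)))) sums
      (indicator {-pi..pi} \<theta> *\<^sub>R (S \<theta> * iexp (- (real n * \<theta>))))"
      by (intro sums_scaleR_right sums_mult2 assms(2))
    also have "(\<lambda>k. indicator {-pi..pi} \<theta> *\<^sub>R (complex_of_real (a k) * iexp (real k * \<theta>) * iexp (- (real n * \<theta>)))) = (\<lambda>k. ?h k \<theta>)"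
      by (simp add: fun_eq_iff mult.assoc exp_add[symmetric] algebra_simps)
    finally show ?thesis by (simp add: sums_iff)
  qed
  moreover have "integral\<^sup>L lborel (?h k) = (if k = n then complex_of_real (2 * pi * a n) else 0)" for k
  proof -
    have "integral\<^sup>L lborel (?h k) = complex_of_real (a k) * (if int k - int n = 0 then 2 * pi else 0)"
      unfolding hk by (subst integral_mult_right_zero) (simp only: integral_iexp_period)
    then show ?thesis by simp
  qed
  ultimately have "(\<lambda>k. if k = n then complex_of_real (2 * pi * a n) else 0) sums
    (CLINT \<theta>|lborel. indicator {-pi..pi} \<theta> *\<^sub>R (S \<theta> * iexp (- (real n * \<theta>))))" by simp
  moreover have "(\<lambda>k. if k = n then complex_of_real (2 * pi * a n) else 0) sums complex_of_real (2 * pi * a n)"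
    using sums_If_finite[of "\<lambda>k. k = n" "\<lambda>_. complex_of_real (2 * pi * a n)"] by simp
  ultimately show ?thesis using sums_unique2 by fastforce
qed

lemma (in coeff_growth) ecoef_integral:
  assumes t: "t > 0" and y: "y \<ge> 0"
  shows "(CLINT \<theta>|lborel. indicator {-pi..pi} \<theta> *\<^sub>R (exp (complex_of_real y * cgen f t \<theta>) * iexp (- (real n * \<theta>))))
    = 2 * pi * (ecoef f y n * exp (- real n * t))"
proof (rule fourier_coefficient)
  show "summable (\<lambda>k. \<bar>ecoef f y k * exp (- real k * t)\<bar>)"
    using summable_ecoef[OF t] ecoef_nonneg[OF y] by simp
qed (rule ecoef_sums[OF t])

section \<open>Estimates on the circle\<close>

lemma iexp_taylor2: "norm (iexp u - (1 + \<i> * u - of_real (u\<^sup>2 / 2))) \<le> \<bar>u\<bar> ^ 3 / 6"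
proof -
  have "(\<Sum>k\<le>2. (\<i> * complex_of_real u) ^ k / fact k) = 1 + \<i> * u - of_real (u\<^sup>2 / 2)"
    by (simp add: numeral_eq_Suc algebra_simps)
  then show ?thesis using iexp_approx1[of u 2] by (simp add: eval_nat_numeral)
qed

lemma cos_le_taylor4: "cos u \<le> 1 - u\<^sup>2 / 2 + u ^ 4 / (24::real)"
proof -
  have "(\<Sum>k\<le>3. (\<i> * complex_of_real u) ^ k / fact k) = Complex (1 - u\<^sup>2 / 2) (u - u ^ 3 / 6)"
    by (simp add: numeral_eq_Suc complex_eq_iff)
  then have "norm (iexp u - Complex (1 - u\<^sup>2 / 2) (u - u ^ 3 / 6)) \<le> \<bar>u\<bar> ^ 4 / 24"
    using iexp_approx1[of u 3] by (simp add: eval_nat_numeral)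
  moreover have "\<bar>Re (iexp u - Complex (1 - u\<^sup>2 / 2) (u - u ^ 3 / 6))\<bar> \<le>
    norm (iexp u - Complex (1 - u\<^sup>2 / 2) (u - u ^ 3 / 6))" by (rule abs_Re_le_cmod)
  moreover have "Re (iexp u - Complex (1 - u\<^sup>2 / 2) (u - u ^ 3 / 6)) = cos u - (1 - u\<^sup>2 / 2)"
    by (simp add: Re_exp)
  ultimately show ?thesis by simp
qed

text \<open>Half-angle formula with \<open>u = \<bar>\<theta>\<bar> / 2 \<le> 2\<close>: from
  \<open>sin u \<ge> u - u ^ 3 / 6\<close> and \<open>u ^ 2 \<le> 4\<close> follows
  \<open>sin u \<ge> u / 3\<close>, and \<open>2 * (u / 3) ^ 2\<close> is
  \<open>\<theta> ^ 2 / 18\<close>.\<close>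

lemma one_minus_cos_ge:
  assumes "\<bar>\<theta>\<bar> \<le> pi"
  shows "1 - cos \<theta> \<ge> \<theta>\<^sup>2 / 18"
proof -
  define u where "u = \<bar>\<theta>\<bar> / 2"
  have u: "0 \<le> u" "u \<le> 2" using assms pi_less_4 by (auto simp: u_def)
  have "\<bar>Im (iexp u - (1 + \<i> * u - of_real (u\<^sup>2 / 2)))\<bar> \<le> \<bar>u\<bar> ^ 3 / 6"
    using abs_Im_le_cmod iexp_taylor2 order_trans by blast
  then have "\<bar>sin u - u\<bar> \<le> u ^ 3 / 6" using u by (simp add: Im_exp)
  moreover have "u ^ 3 = u * u\<^sup>2" by (simp add: power3_eq_cube power2_eq_square)
  moreover have "u * u\<^sup>2 \<le> u * 4" using power_mono[OF u(2,1), of 2] u by (intro mult_left_mono) auto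
  ultimately have "sin u \<ge> u / 3" by linarith
  then have "(u / 3)\<^sup>2 \<le> (sin u)\<^sup>2" using u by (intro power_mono) auto
  moreover have "cos \<theta> = 1 - 2 * (sin u)\<^sup>2"
  proof -
    have "cos \<theta> = cos (2 * u)" by (simp add: u_def)
    then show ?thesis by (simp only: cos_double_sin)
  qed
  moreover have "2 * (u / 3)\<^sup>2 = \<theta>\<^sup>2 / 18" by (simp add: u_def power_divide)
  ultimately show ?thesis by linarith
qed

context coeff_growth
begin

lemma cgen_diff_sums:
  assumes "t > 0"
  shows "(\<lambda>k. complex_of_real (f k * exp (- real k * t)) * (iexp (real k * \<theta>) - 1)) sums
    (cgen f t \<theta> - of_real (moment f 0 t))"
  using sums_diff[OF cgen_sums[OF assms, of \<theta>] cgen_sums[OF assms, of 0]] cgen_0[OF assms]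
  by (simp add: right_diff_distrib)

lemma cgen_taylor:
  assumes t: "t > 0"
  shows "norm (cgen f t \<theta> - of_real (moment f 0 t) -
    (\<i> * of_real (\<theta> * moment f 1 t) - of_real (\<theta>\<^sup>2 * moment f 2 t / 2))) \<le> \<bar>\<theta>\<bar> ^ 3 * moment f 3 t / 6"
proof -
  let ?a = "\<lambda>k. f k * exp (- real k * t)"
  have "(\<lambda>k. complex_of_real (?a k) * (iexp (real k * \<theta>) - 1) - (\<i> * of_real (\<theta> * (real k ^ 1 * f k * exp (- real k * t)))
    - of_real (\<theta>\<^sup>2 * (real k ^ 2 * f k * exp (- real k * t)) / 2))) sums
    (cgen f t \<theta> - of_real (moment f 0 t) - (\<i> * of_real (\<theta> * moment f 1 t) - of_real (\<theta>\<^sup>2 * moment f 2 t / 2)))"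
    by (intro sums_diff cgen_diff_sums[OF t] sums_mult sums_of_real sums_divide moment_sums[OF t])
  also have "(\<lambda>k. complex_of_real (?a k) * (iexp (real k * \<theta>) - 1) - (\<i> * of_real (\<theta> * (real k ^ 1 * f k * exp (- real k * t)))
    - of_real (\<theta>\<^sup>2 * (real k ^ 2 * f k * exp (- real k * t)) / 2))) =
    (\<lambda>k. of_real (?a k) * (iexp (real k * \<theta>) - (1 + \<i> * of_real (real k * \<theta>) - of_real ((real k * \<theta>)\<^sup>2 / 2))))"
    (is "_ = ?h") by (simp add: fun_eq_iff algebra_simps power_mult_distrib)
  finally have S: "?h sums (cgen f t \<theta> - of_real (moment f 0 t) -
    (\<i> * of_real (\<theta> * moment f 1 t) - of_real (\<theta>\<^sup>2 * moment f 2 t / 2)))" .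
  have S3: "(\<lambda>k. \<bar>\<theta>\<bar> ^ 3 * (real k ^ 3 * f k * exp (- real k * t)) / 6) sums (\<bar>\<theta>\<bar> ^ 3 * moment f 3 t / 6)"
    by (intro sums_divide sums_mult moment_sums[OF t])
  have "norm (suminf ?h) \<le> (\<Sum>k. \<bar>\<theta>\<bar> ^ 3 * (real k ^ 3 * f k * exp (- real k * t)) / 6)"
  proof (rule norm_suminf_le)
    fix k
    have na: "norm (complex_of_real (?a k)) = ?a k"
      unfolding norm_of_real using f_nonneg[of k] by simp
    have "norm (?h k) \<le> ?a k * (\<bar>real k * \<theta>\<bar> ^ 3 / 6)"
      unfolding norm_mult na using f_nonneg[of k] by (intro mult_left_mono iexp_taylor2) simp
    then show "norm (?h k) \<le> \<bar>\<theta>\<bar> ^ 3 * (real k ^ 3 * f k * exp (- real k * t)) / 6"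
      by (simp add: abs_mult power_mult_distrib mult_ac)
  qed (use S3 in \<open>simp add: sums_iff\<close>)
  then show ?thesis using S S3 by (simp only: sums_iff)
qed

lemma Re_cgen_diff_sums:
  assumes "t > 0"
  shows "(\<lambda>k. f k * exp (- real k * t) * (cos (real k * \<theta>) - 1)) sums (Re (cgen f t \<theta>) - moment f 0 t)"
proof -
  have "(\<lambda>k. Re (complex_of_real (f k * exp (- real k * t)) * (iexp (real k * \<theta>) - 1))) sums
    Re (cgen f t \<theta> - of_real (moment f 0 t))"
    by (rule sums_Re[OF cgen_diff_sums[OF assms]])
  then show ?thesis by (simp add: Re_exp)
qed

text \<open>The hypothesis on \<open>\<theta>\<close> says that the quartic term of the expansion of
  \<open>cos\<close> consumes at most half of the quadratic one.\<close>

lemma Re_cgen_small: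
  assumes t: "t > 0" and \<theta>: "\<theta>\<^sup>2 * moment f 4 t \<le> 6 * moment f 2 t"
  shows "Re (cgen f t \<theta>) - moment f 0 t \<le> - (\<theta>\<^sup>2 * moment f 2 t / 4)"
proof -
  have "Re (cgen f t \<theta>) - moment f 0 t \<le> - (\<theta>\<^sup>2 * moment f 2 t / 2) + \<theta> ^ 4 * moment f 4 t / 24"
  proof (rule sums_le)
    show "(\<lambda>k. - (\<theta>\<^sup>2 * (real k ^ 2 * f k * exp (- real k * t)) / 2) + \<theta> ^ 4 * (real k ^ 4 * f k * exp (- real k * t)) / 24)
      sums (- (\<theta>\<^sup>2 * moment f 2 t / 2) + \<theta> ^ 4 * moment f 4 t / 24)"
      by (intro sums_add sums_minus sums_divide sums_mult moment_sums[OF t])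
    show "(\<lambda>k. f k * exp (- real k * t) * (cos (real k * \<theta>) - 1)) sums (Re (cgen f t \<theta>) - moment f 0 t)"
      by (rule Re_cgen_diff_sums[OF t])
    fix k
    have "f k * exp (- real k * t) * (cos (real k * \<theta>) - 1) \<le>
      f k * exp (- real k * t) * (- ((real k * \<theta>)\<^sup>2 / 2) + (real k * \<theta>) ^ 4 / 24)"
      using cos_le_taylor4[of "real k * \<theta>"] f_nonneg[of k] by (intro mult_left_mono) auto
    then show "f k * exp (- real k * t) * (cos (real k * \<theta>) - 1) \<le>
      - (\<theta>\<^sup>2 * (real k ^ 2 * f k * exp (- real k * t)) / 2) + \<theta> ^ 4 * (real k ^ 4 * f k * exp (- real k * t)) / 24"
      by (simp add: algebra_simps power_mult_distrib)
  qed
  moreover have "\<theta> ^ 4 * moment f 4 t = \<theta>\<^sup>2 * (\<theta>\<^sup>2 * moment f 4 t)" by (simp add: power_add[symmetric])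
  moreover have "\<theta>\<^sup>2 * (\<theta>\<^sup>2 * moment f 4 t) \<le> \<theta>\<^sup>2 * (6 * moment f 2 t)"
    using \<theta> by (intro mult_left_mono) auto
  moreover have "\<theta>\<^sup>2 * (6 * moment f 2 t) = 6 * (\<theta>\<^sup>2 * moment f 2 t)" by simp
  ultimately show ?thesis by linarith
qed

text \<open>Away from the real axis only \<open>f k \<ge> 1\<close> is used: the sum is compared with a geometric series.\<close>

lemma Re_cgen_large:
  assumes t: "0 < t" "t \<le> 1 / 2" and f1: "\<And>k. k \<ge> 1 \<Longrightarrow> f k \<ge> 1"
    and \<theta>: "\<bar>\<theta>\<bar> \<le> pi" "\<eta> * t\<^sup>2 \<le> \<theta>\<^sup>2" and \<eta>: "\<eta> > 0"
  shows "Re (cgen f t \<theta>) - moment f 0 t \<le> - ((1 - 1 / sqrt (1 + \<eta> / 18)) / t)"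
proof -
  define r where "r = exp (- t)"
  define z where "z = complex_of_real r * iexp \<theta>"
  have r: "0 < r" "r < 1" "1 - r \<le> t" "r \<ge> 1 / 2"
    using t exp_ge_add_one_self[of "- t"] by (auto simp: r_def)
  have nz: "norm z = r" using r by (simp add: z_def norm_mult)
  have rk: "exp (- real k * t) = r ^ k" for k
    unfolding r_def exp_of_nat_mult[symmetric] by (simp add: mult_ac)
  have zk: "Re (z ^ k) = r ^ k * cos (real k * \<theta>)" for k
  proof -
    have "z ^ k = of_real (r ^ k) * iexp (real k * \<theta>)"
      by (simp add: z_def power_mult_distrib exp_of_nat_mult[symmetric] mult_ac)
    then show ?thesis by (simp add: Re_exp)
  qed
  have "(\<lambda>k. Re (z ^ k) - r ^ k) sums (Re (1 / (1 - z)) - 1 / (1 - r))"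
    using nz r by (intro sums_diff sums_Re geometric_sums) auto
  then have G: "(\<lambda>k. r ^ k * (cos (real k * \<theta>) - 1)) sums (Re (1 / (1 - z)) - 1 / (1 - r))"
    by (simp add: zk right_diff_distrib)
  \<comment> \<open>All factors \<open>cos (k * \<theta>) - 1\<close> are nonpositive, so lowering
    \<open>f k\<close> to \<open>1\<close> can only increase the sum.\<close>
  have "Re (cgen f t \<theta>) - moment f 0 t \<le> Re (1 / (1 - z)) - 1 / (1 - r)"
  proof (rule sums_le[OF _ Re_cgen_diff_sums[OF t(1)] G])
    fix k
    show "f k * exp (- real k * t) * (cos (real k * \<theta>) - 1) \<le> r ^ k * (cos (real k * \<theta>) - 1)"
    proof (cases "k = 0")
      case False
      then have "r ^ k \<le> f k * r ^ k" using f1[of k] r by (simp add: mult_le_cancel_right1)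
      then show ?thesis unfolding rk by (rule mult_right_mono_neg) simp
    qed simp
  qed
  also have "Re (1 / (1 - z)) \<le> 1 / norm (1 - z)"
    using complex_Re_le_cmod[of "1 / (1 - z)"] by (simp add: norm_divide)
  also have "1 / norm (1 - z) \<le> 1 / ((1 - r) * sqrt (1 + \<eta> / 18))"
  proof -
    \<comment> \<open>Law of cosines. Here \<open>t \<le> 1 / 2\<close> gives
      \<open>2 * r \<ge> 1\<close>, so \<open>one_minus_cos_ge\<close> adds
      \<open>\<theta> ^ 2 / 18\<close>, and \<open>1 - r \<le> t\<close> makes this at least
      \<open>\<eta> / 18\<close> times \<open>(1 - r) ^ 2\<close>.\<close>
    have "(norm (1 - z))\<^sup>2 = (1 - r * cos \<theta>)\<^sup>2 + (r * sin \<theta>)\<^sup>2"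
      by (simp add: cmod_power2 z_def Re_exp Im_exp)
    also have "(1 - r * c)\<^sup>2 + (r * s)\<^sup>2 = (1 - r)\<^sup>2 + 2 * r * (1 - c) + r\<^sup>2 * (s\<^sup>2 + c\<^sup>2 - 1)" for c s :: real
      by (simp add: power2_eq_square algebra_simps)
    also have "(1 - r)\<^sup>2 + 2 * r * (1 - cos \<theta>) + r\<^sup>2 * ((sin \<theta>)\<^sup>2 + (cos \<theta>)\<^sup>2 - 1) =
      (1 - r)\<^sup>2 + 2 * r * (1 - cos \<theta>)" by simp
    finally have 1: "(norm (1 - z))\<^sup>2 = (1 - r)\<^sup>2 + 2 * r * (1 - cos \<theta>)" .
    have "1 * (1 - cos \<theta>) \<le> 2 * r * (1 - cos \<theta>)" using r by (intro mult_right_mono) auto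
    then have 2: "2 * r * (1 - cos \<theta>) \<ge> \<theta>\<^sup>2 / 18" using one_minus_cos_ge[OF \<theta>(1)] by simp
    have "(1 - r)\<^sup>2 \<le> t\<^sup>2" using r by (intro power_mono) auto
    then have "\<eta> * (1 - r)\<^sup>2 \<le> \<theta>\<^sup>2" using \<theta>(2) \<eta> by (meson mult_left_mono less_imp_le order_trans)
    then have "(1 - r)\<^sup>2 * (1 + \<eta> / 18) \<le> (norm (1 - z))\<^sup>2" using 1 2 by (simp add: algebra_simps)
    then have "((1 - r) * sqrt (1 + \<eta> / 18))\<^sup>2 \<le> (norm (1 - z))\<^sup>2"
      using \<eta> by (simp add: power_mult_distrib)
    then have 3: "(1 - r) * sqrt (1 + \<eta> / 18) \<le> norm (1 - z)" by (rule power2_le_imp_le) simp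
    have pos: "(1 - r) * sqrt (1 + \<eta> / 18) > 0" using r \<eta> by (intro mult_pos_pos) auto
    then have "norm (1 - z) > 0" using 3 by linarith
    then show ?thesis by (intro divide_left_mono[OF 3 _ mult_pos_pos] pos) simp
  qed
  also have "1 / ((1 - r) * sqrt (1 + \<eta> / 18)) - 1 / (1 - r) = - ((1 - 1 / sqrt (1 + \<eta> / 18)) / (1 - r))"
    by (simp add: diff_divide_distrib mult.commute)
  also have "\<dots> \<le> - ((1 - 1 / sqrt (1 + \<eta> / 18)) / t)"
    using r t \<eta> by (intro le_imp_neg_le divide_left_mono) auto
  finally show ?thesis by simp
qed

end

section \<open>Gaussian limit of the coefficients\<close>

lemma gaussian_fourier:
  "(CLINT \<phi>|lborel. exp (\<i> * of_real (\<mu> * \<phi>) - of_real (\<phi>\<^sup>2 / 2))) = of_real (sqrt (2 * pi) * exp (- (\<mu>\<^sup>2 / 2)))"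
proof -
  have "char std_normal_distribution \<mu> = (CLINT \<phi>|lborel. std_normal_density \<phi> *\<^sub>R iexp (\<mu> * \<phi>))"
    unfolding char_def by (subst integral_density) (auto simp: normal_density_nonneg)
  also have "\<dots> = (CLINT \<phi>|lborel. of_real (1 / sqrt (2 * pi)) * exp (\<i> * of_real (\<mu> * \<phi>) - of_real (\<phi>\<^sup>2 / 2)))"
  proof (rule Bochner_Integration.integral_cong[OF refl])
    fix \<phi> :: real
    have "exp (\<i> * of_real (\<mu> * \<phi>) - of_real (\<phi>\<^sup>2 / 2)) = of_real (exp (- (\<phi>\<^sup>2 / 2))) * iexp (\<mu> * \<phi>)"
      by (simp only: exp_diff exp_of_real exp_minus of_real_inverse divide_inverse mult.commute)
    then show "std_normal_density \<phi> *\<^sub>R iexp (\<mu> * \<phi>) =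
      of_real (1 / sqrt (2 * pi)) * exp (\<i> * of_real (\<mu> * \<phi>) - of_real (\<phi>\<^sup>2 / 2))"
      by (simp only: std_normal_density_def scaleR_conv_of_real of_real_mult mult.assoc minus_divide_left)
  qed
  also have "\<dots> = of_real (1 / sqrt (2 * pi)) * (CLINT \<phi>|lborel. exp (\<i> * of_real (\<mu> * \<phi>) - of_real (\<phi>\<^sup>2 / 2)))"
    by (rule integral_mult_right_zero)
  finally have "of_real (1 / sqrt (2 * pi)) * (CLINT \<phi>|lborel. exp (\<i> * of_real (\<mu> * \<phi>) - of_real (\<phi>\<^sup>2 / 2))) =
    complex_of_real (exp (- \<mu>\<^sup>2 / 2))" by (simp add: char_std_normal_distribution)
  then have "of_real (sqrt (2 * pi)) * (of_real (1 / sqrt (2 * pi)) * (CLINT \<phi>|lborel. exp (\<i> * of_real (\<mu> * \<phi>) - of_real (\<phi>\<^sup>2 / 2)))) =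
    of_real (sqrt (2 * pi)) * complex_of_real (exp (- (\<mu>\<^sup>2 / 2)))" by simp
  moreover have "of_real (sqrt (2 * pi)) * (of_real (1 / sqrt (2 * pi)) * I) = I" for I :: complex
    unfolding mult.assoc[symmetric] of_real_mult[symmetric] by simp
  ultimately show ?thesis by simp
qed

lemma integrable_one_plus_square: "integrable lborel (\<lambda>x::real. K / (1 + x\<^sup>2))"
proof -
  have "integrable lborel (\<lambda>x::real. inverse (1 + x\<^sup>2))"
    using integrable_inverse_1_plus_square by (simp add: set_integrable_def)
  then show ?thesis unfolding divide_inverse by (intro integrable_mult_right) simp
qed

text \<open>This isolates what the analysis uses of the tuple counts. The limits say that
  \<open>moment f 0 t\<close> behaves like \<open>C * fact (d - 1) / t ^ d\<close> at
  \<open>0\<close> and that this may be differentiated formally.\<close>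

locale saddle = coeff_growth +
  fixes d :: nat and C :: real
  assumes f_ge: "\<And>k. k \<ge> 1 \<Longrightarrow> f k \<ge> 1" and d: "d \<ge> 1" and C: "C > 0"
    and moment_limit: "\<And>j. ((\<lambda>t. t ^ (d + j) * moment f j t) \<longlongrightarrow> C * fact (d + j - 1)) (at_right 0)"
begin

text \<open>The weight \<open>y n\<close> varies, but \<open>\<sigma>\<close> is formed with its
  limit \<open>x\<close> and the radius need not be the saddle point of \<open>y n\<close>. The
  deviation, measured on the scale \<open>\<sigma>\<close>, has the limit
  \<open>\<mu>\<close>.\<close>

context
  fixes t y \<sigma> :: "nat \<Rightarrow> real" and N :: "nat \<Rightarrow> nat" and x \<mu> :: real
  assumes t: "filterlim t (at_right 0) sequentially" and x: "x > 0" and y: "y \<longlonglongrightarrow> x"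
    and \<sigma>: "\<And>n. \<sigma> n = sqrt (x * moment f 2 (t n))"
    and \<mu>: "(\<lambda>n. (y n * moment f 1 (t n) - real (N n)) / \<sigma> n) \<longlonglongrightarrow> \<mu>"
begin

abbreviation mom :: "nat \<Rightarrow> nat \<Rightarrow> real" where "mom j n \<equiv> moment f j (t n)"

lemma eventually_t_pos: "\<forall>\<^sub>F n in sequentially. t n > 0"
  using t by (auto simp: filterlim_at elim: eventually_mono)

lemma t_tendsto_0: "t \<longlonglongrightarrow> 0" using t by (auto simp: filterlim_at)

lemma mom_limit: "(\<lambda>n. t n ^ (d + j) * mom j n) \<longlonglongrightarrow> C * fact (d + j - 1)"
  by (rule filterlim_compose[OF moment_limit t])

lemma mom_limit_pos: "C * fact (d + j - 1) > 0" using C by simp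

lemma eventually_mom_pos: "\<forall>\<^sub>F n in sequentially. mom j n > 0"
  using order_tendstoD(1)[OF mom_limit mom_limit_pos] eventually_t_pos
  by eventually_elim (auto simp: zero_less_mult_iff zero_less_power_eq)

text \<open>The square is considered so that only integer powers of \<open>t\<close> occur: by the
  moment limits it is of order \<open>t ^ d\<close>, which tends to \<open>0\<close> because
  \<open>d \<ge> 1\<close>.\<close>

lemma third_moment_negligible: "(\<lambda>n. mom 3 n / \<sigma> n ^ 3) \<longlonglongrightarrow> 0"
proof -
  let ?g = "\<lambda>n. (t n ^ (d + 3) * mom 3 n)\<^sup>2 / (t n ^ (d + 2) * mom 2 n) ^ 3 * t n ^ d / x ^ 3"
  have "?g \<longlonglongrightarrow> (C * fact (d + 3 - 1))\<^sup>2 / (C * fact (d + 2 - 1)) ^ 3 * 0 ^ d / x ^ 3"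
    using x C by (intro tendsto_intros mom_limit t_tendsto_0) auto
  then have "?g \<longlonglongrightarrow> 0" using d by (simp add: power_0_left)
  then have "(\<lambda>n. sqrt (?g n)) \<longlonglongrightarrow> 0" using tendsto_real_sqrt by fastforce
  moreover have "\<forall>\<^sub>F n in sequentially. sqrt (?g n) = mom 3 n / \<sigma> n ^ 3"
    using eventually_t_pos eventually_mom_pos[of 2]
  proof eventually_elim
    case (elim n)
    have "t n ^ (d + 3) * t n ^ (d + 3) * t n ^ d = (t n ^ (d + 2)) ^ 3"
      by (simp only: power_add[symmetric] power_mult[symmetric]) (simp add: algebra_simps)
    moreover have "(a * m)\<^sup>2 / (b * k) ^ 3 * c / z = (a * a * c) * m\<^sup>2 / (b ^ 3 * k ^ 3) / z" for a b c m k z :: real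
      by (simp add: power_mult_distrib power2_eq_square)
    ultimately have "?g n = (t n ^ (d + 2)) ^ 3 * (mom 3 n)\<^sup>2 / ((t n ^ (d + 2)) ^ 3 * (mom 2 n) ^ 3) / x ^ 3"
      by (simp only:)
    also have "\<dots> = (mom 3 n)\<^sup>2 / (mom 2 n) ^ 3 / x ^ 3" using elim by simp
    also have "\<dots> = (mom 3 n)\<^sup>2 / (x * mom 2 n) ^ 3" by (simp add: power_mult_distrib mult.commute)
    also have "(x * mom 2 n) ^ 3 = (\<sigma> n ^ 3)\<^sup>2"
    proof -
      have "(\<sigma> n ^ 3)\<^sup>2 = ((\<sigma> n)\<^sup>2) ^ 3" by (simp flip: power_mult)
      then show ?thesis using \<sigma>[of n] x elim by simp
    qed
    finally have "?g n = (mom 3 n / \<sigma> n ^ 3)\<^sup>2" by (simp add: power_divide)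
    then have "sqrt (?g n) = \<bar>mom 3 n / \<sigma> n ^ 3\<bar>" by simp
    then show ?case using moment_nonneg[OF elim(1), of 3] \<sigma>[of n] x elim by simp
  qed
  ultimately show ?thesis by (rule Lim_transform_eventually)
qed

lemma sigma_at_top: "filterlim \<sigma> at_top sequentially"
proof -
  have "filterlim (\<lambda>n. inverse (t n ^ (d + 2))) at_top sequentially"
  proof (rule filterlim_inverse_at_top)
    show "(\<lambda>n. t n ^ (d + 2)) \<longlonglongrightarrow> 0" using tendsto_power[OF t_tendsto_0, of "d + 2"] by simp
    show "\<forall>\<^sub>F n in sequentially. t n ^ (d + 2) > 0" using eventually_t_pos by eventually_elim simp
  qed
  then have "filterlim (\<lambda>n. (x * (t n ^ (d + 2) * mom 2 n)) * inverse (t n ^ (d + 2))) at_top sequentially"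
    using x mom_limit_pos[of 2]
    by (intro filterlim_tendsto_pos_mult_at_top[OF tendsto_mult[OF tendsto_const mom_limit[of 2]]]) auto
  then have "filterlim (\<lambda>n. sqrt ((x * (t n ^ (d + 2) * mom 2 n)) * inverse (t n ^ (d + 2)))) at_top sequentially"
    by (rule filterlim_compose[OF sqrt_at_top])
  moreover have "\<forall>\<^sub>F n in sequentially. sqrt ((x * (t n ^ (d + 2) * mom 2 n)) * inverse (t n ^ (d + 2))) = \<sigma> n"
    using eventually_t_pos by eventually_elim (simp add: \<sigma> field_simps)
  ultimately show ?thesis by (rule filterlim_mono_eventually[OF _ order_refl order_refl])
qed

text \<open>Cauchy's integrand at the angle \<open>\<theta> = \<phi> / \<sigma> n\<close>, normalised by its value at \<open>\<theta> = 0\<close>.\<close>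

definition integrand :: "nat \<Rightarrow> real \<Rightarrow> complex" where
  "integrand n \<phi> = indicator {- pi * \<sigma> n..pi * \<sigma> n} \<phi> *\<^sub>R
     exp (of_real (y n) * (cgen f (t n) (\<phi> / \<sigma> n) - of_real (mom 0 n)) - \<i> * of_real (real (N n) * (\<phi> / \<sigma> n)))"

lemma integrand_measurable: "integrand n \<in> borel_measurable lborel"
  unfolding integrand_def cgen_def by measurable

text \<open>In the Taylor expansion at \<open>\<phi> / \<sigma> n\<close> the linear terms combine
  to \<open>\<i> * \<phi>\<close> times the deviation with limit \<open>\<mu>\<close>, the quadratic
  term tends to \<open>\<phi> ^ 2 / 2\<close> since \<open>y n / x\<close> tends to
  \<open>1\<close>, and the cubic remainder vanishes.\<close>

lemma integrand_limit: "(\<lambda>n. integrand n \<phi>) \<longlonglongrightarrow> exp (\<i> * of_real (\<mu> * \<phi>) - of_real (\<phi>\<^sup>2 / 2))"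
proof -
  define R where "R n = cgen f (t n) (\<phi> / \<sigma> n) - of_real (mom 0 n) -
    (\<i> * of_real (\<phi> / \<sigma> n * mom 1 n) - of_real ((\<phi> / \<sigma> n)\<^sup>2 * mom 2 n / 2))" for n
  have "(\<lambda>n. of_real (y n) * R n) \<longlonglongrightarrow> 0"
  proof (rule Lim_null_comparison)
    have "(\<lambda>n. \<bar>y n\<bar> * (\<bar>\<phi>\<bar> ^ 3 * (mom 3 n / \<sigma> n ^ 3) / 6)) \<longlonglongrightarrow> \<bar>x\<bar> * (\<bar>\<phi>\<bar> ^ 3 * 0 / 6)"
      by (intro tendsto_mult tendsto_divide tendsto_const tendsto_rabs y third_moment_negligible) simp
    then show "(\<lambda>n. \<bar>y n\<bar> * (\<bar>\<phi>\<bar> ^ 3 * (mom 3 n / \<sigma> n ^ 3) / 6)) \<longlonglongrightarrow> 0" by simp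
    show "\<forall>\<^sub>F n in sequentially. norm (of_real (y n) * R n) \<le> \<bar>y n\<bar> * (\<bar>\<phi>\<bar> ^ 3 * (mom 3 n / \<sigma> n ^ 3) / 6)"
      using eventually_t_pos eventually_mom_pos[of 2]
    proof eventually_elim
      case (elim n)
      have "\<sigma> n > 0" using \<sigma>[of n] x elim by simp
      then have "norm (R n) \<le> \<bar>\<phi>\<bar> ^ 3 * (mom 3 n / \<sigma> n ^ 3) / 6"
        using cgen_taylor[OF elim(1), of "\<phi> / \<sigma> n"] by (simp add: R_def power_divide)
      then show ?case unfolding norm_mult norm_of_real by (intro mult_left_mono) auto
    qed
  qed
  then have L: "(\<lambda>n. \<i> * of_real (\<phi> * ((y n * mom 1 n - real (N n)) / \<sigma> n)) - of_real (y n / x * \<phi>\<^sup>2 / 2) + of_real (y n) * R n)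
    \<longlonglongrightarrow> \<i> * of_real (\<phi> * \<mu>) - of_real (x / x * \<phi>\<^sup>2 / 2) + 0"
    using x by (intro tendsto_intros \<mu> y) auto
  have L2: "(\<lambda>n. exp (\<i> * of_real (\<phi> * ((y n * mom 1 n - real (N n)) / \<sigma> n)) - of_real (y n / x * \<phi>\<^sup>2 / 2) + of_real (y n) * R n))
    \<longlonglongrightarrow> exp (\<i> * of_real (\<mu> * \<phi>) - of_real (\<phi>\<^sup>2 / 2))"
    using tendsto_exp[OF L] x by (simp add: mult.commute)
  have "\<forall>\<^sub>F n in sequentially. \<sigma> n \<ge> \<bar>\<phi>\<bar> / pi" using sigma_at_top by (simp add: filterlim_at_top)
  then have "\<forall>\<^sub>F n in sequentially. exp (\<i> * of_real (\<phi> * ((y n * mom 1 n - real (N n)) / \<sigma> n)) - of_real (y n / x * \<phi>\<^sup>2 / 2)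
      + of_real (y n) * R n) = integrand n \<phi>"
    using eventually_t_pos eventually_mom_pos[of 2]
  proof eventually_elim
    case (elim n)
    have s: "\<sigma> n > 0" "(\<sigma> n)\<^sup>2 = x * mom 2 n" using \<sigma>[of n] x elim by simp_all
    have "\<bar>\<phi>\<bar> \<le> pi * \<sigma> n" using elim by (simp add: pos_divide_le_eq mult.commute)
    then have ind: "indicator {- pi * \<sigma> n..pi * \<sigma> n} \<phi> = (1::real)" by (auto simp: indicator_def)
    have "y n / x * \<phi>\<^sup>2 / 2 = y n * ((\<phi> / \<sigma> n)\<^sup>2 * mom 2 n / 2)"
      using x elim by (simp add: power_divide s)
    then have "\<i> * of_real (\<phi> * ((y n * mom 1 n - real (N n)) / \<sigma> n)) - of_real (y n / x * \<phi>\<^sup>2 / 2) + of_real (y n) * R n =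
      of_real (y n) * (cgen f (t n) (\<phi> / \<sigma> n) - of_real (mom 0 n)) - \<i> * of_real (real (N n) * (\<phi> / \<sigma> n))"
      by (simp add: R_def algebra_simps diff_divide_distrib)
    then show ?case unfolding integrand_def ind by simp
  qed
  with L2 show ?thesis by (rule Lim_transform_eventually)
qed

text \<open>Near the real axis \<open>Re_cgen_small\<close> gives Gaussian decay. Elsewhere the
  integrand is at most \<open>exp (- c / t)\<close>, while \<open>\<phi> ^ 2\<close> is at most of
  order \<open>t ^ -(d + 2)\<close> on the circle, so the exponential absorbs the factor
  \<open>1 + \<phi> ^ 2\<close>.\<close>

lemma integrand_bound: "\<exists>K. \<forall>\<^sub>F n in sequentially. \<forall>\<phi>. norm (integrand n \<phi>) \<le> K / (1 + \<phi>\<^sup>2)"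
proof -
  define q where "q = C * fact (d + 4 - 1) / (C * fact (d + 2 - 1))"
  have q: "q > 0" using C by (simp add: q_def)
  \<comment> \<open>Where \<open>Re_cgen_small\<close> does not apply,
    \<open>\<theta> ^ 2 > 6 * m2 / m4\<close>. As \<open>q\<close> is the limit of
    \<open>t ^ 2 * m4 / m2\<close>, eventually \<open>m4 / m2 < 2 * q / t ^ 2\<close>, so that
    \<open>\<theta> ^ 2\<close> exceeds \<open>(3 / q) * t ^ 2\<close>.\<close>
  define \<eta> where "\<eta> = 3 / q"
  have \<eta>: "\<eta> > 0" using q by (simp add: \<eta>_def)
  \<comment> \<open>The gain of \<open>Re_cgen_large\<close> times \<open>x / 2\<close>, an eventual
    lower bound for \<open>y n\<close>.\<close>
  define c where "c = x / 2 * (1 - 1 / sqrt (1 + \<eta> / 18))"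
  have c: "c > 0" using x \<eta> by (simp add: c_def)
  define L where "L = C * fact (d + 2 - 1) + 1"
  \<comment> \<open>The sum of the constants of the two regions: \<open>8\<close> dominates
    \<open>(1 + \<phi> ^ 2) * exp (- \<phi> ^ 2 / 8)\<close>, the other summand serves the outer
    region.\<close>
  define K where "K = 8 + (1 + pi\<^sup>2 * (x * (L * (fact (d + 2) / c ^ (d + 2)))))"
  have L: "L > 0" using C by (simp add: L_def add_pos_pos)
  have K2: "0 \<le> 1 + pi\<^sup>2 * (x * (L * (fact (d + 2) / c ^ (d + 2))))" using x L c by simp
  have "(\<lambda>n. (t n ^ (d + 4) * mom 4 n) / (t n ^ (d + 2) * mom 2 n)) \<longlonglongrightarrow> q"
    unfolding q_def using C by (intro tendsto_divide mom_limit) auto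
  then have e1: "\<forall>\<^sub>F n in sequentially. (t n ^ (d + 4) * mom 4 n) / (t n ^ (d + 2) * mom 2 n) < 2 * q"
    by (rule order_tendstoD(2)) (use q in simp)
  have e2: "\<forall>\<^sub>F n in sequentially. t n ^ (d + 2) * mom 2 n < L"
    by (rule order_tendstoD(2)[OF mom_limit]) (simp add: L_def)
  have e3: "\<forall>\<^sub>F n in sequentially. t n < 1 / 2" by (rule order_tendstoD(2)[OF t_tendsto_0]) simp
  have e4: "\<forall>\<^sub>F n in sequentially. y n > x / 2" by (rule order_tendstoD(1)[OF y]) (use x in simp)
  have "\<forall>\<^sub>F n in sequentially. \<forall>\<phi>. norm (integrand n \<phi>) \<le> K / (1 + \<phi>\<^sup>2)"
    using e1 e2 e3 e4 eventually_t_pos eventually_mom_pos[of 2] eventually_mom_pos[of 4]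
  proof eventually_elim
    case (elim n)
    have s: "\<sigma> n > 0" "(\<sigma> n)\<^sup>2 = x * mom 2 n" using \<sigma>[of n] x elim by simp_all
    have yn: "y n > 0" using elim x by simp
    show ?case
    proof
      fix \<phi>
      let ?\<theta> = "\<phi> / \<sigma> n" and ?D = "Re (cgen f (t n) (\<phi> / \<sigma> n)) - mom 0 n"
      have K: "K / (1 + \<phi>\<^sup>2) \<ge> 8 / (1 + \<phi>\<^sup>2)"
        "K / (1 + \<phi>\<^sup>2) \<ge> (1 + pi\<^sup>2 * (x * (L * (fact (d + 2) / c ^ (d + 2))))) / (1 + \<phi>\<^sup>2)"
        using K2 by (auto simp: K_def intro!: divide_right_mono)
      show "norm (integrand n \<phi>) \<le> K / (1 + \<phi>\<^sup>2)"
      proof (cases "\<bar>\<phi>\<bar> \<le> pi * \<sigma> n")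
        case False
        then have "integrand n \<phi> = 0" by (auto simp: integrand_def indicator_def)
        moreover have "K / (1 + \<phi>\<^sup>2) \<ge> 0" using K(1) by (rule order_trans[rotated]) simp
        ultimately show ?thesis by simp
      next
        case True
        then have "norm (integrand n \<phi>) = exp (y n * ?D)"
          by (auto simp: integrand_def indicator_def norm_exp_eq_Re)
        also have "\<dots> \<le> K / (1 + \<phi>\<^sup>2)"
        proof (cases "?\<theta>\<^sup>2 * mom 4 n \<le> 6 * mom 2 n")
          case small: True
          have "?D \<le> - (?\<theta>\<^sup>2 * mom 2 n / 4)" by (rule Re_cgen_small[OF elim(5) small])
          also have "?\<theta>\<^sup>2 * mom 2 n / 4 = \<phi>\<^sup>2 / (4 * x)" using x elim by (simp add: power_divide s)
          finally have "y n * ?D \<le> y n * - (\<phi>\<^sup>2 / (4 * x))" using yn by (intro mult_left_mono) auto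
          also have "\<dots> \<le> x / 2 * - (\<phi>\<^sup>2 / (4 * x))" using elim x by (intro mult_right_mono_neg) auto
          also have "\<dots> = - (\<phi>\<^sup>2 / 8)" using x by simp
          finally have "exp (y n * ?D) \<le> exp (- (\<phi>\<^sup>2 / 8))" by simp
          also have "\<dots> \<le> 1 / (1 + \<phi>\<^sup>2 / 8)"
            using exp_ge_add_one_self[of "\<phi>\<^sup>2 / 8"] unfolding exp_minus inverse_eq_divide
            by (intro divide_left_mono mult_pos_pos) (auto simp: add_pos_nonneg)
          also have "\<dots> \<le> 8 / (1 + \<phi>\<^sup>2)"
          proof -
            have "1 / (1 + \<phi>\<^sup>2 / 8) = 8 / (8 + \<phi>\<^sup>2)" by (simp add: field_simps)
            also have "\<dots> \<le> 8 / (1 + \<phi>\<^sup>2)" by (intro divide_left_mono mult_pos_pos) (auto simp: add_pos_nonneg)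
            finally show ?thesis .
          qed
          finally show ?thesis using K(1) by simp
        next
          case large: False
          have th: "\<bar>?\<theta>\<bar> \<le> pi" using True s(1) by (simp add: pos_divide_le_eq)
          have "(t n)\<^sup>2 * mom 4 n / mom 2 n < 2 * q" using elim(1,5) by (simp add: power_add power_numeral_reduce mult_ac)
          then have "(t n)\<^sup>2 * mom 4 n < 2 * q * mom 2 n" using elim by (simp add: pos_divide_less_eq)
          then have "\<eta> * ((t n)\<^sup>2 * mom 4 n) \<le> \<eta> * (2 * q * mom 2 n)" using \<eta> by (intro mult_left_mono) auto
          also have "\<dots> = 6 * mom 2 n" using q by (simp add: \<eta>_def)
          also have "\<dots> \<le> ?\<theta>\<^sup>2 * mom 4 n" using large by simp
          finally have "(\<eta> * (t n)\<^sup>2) * mom 4 n \<le> ?\<theta>\<^sup>2 * mom 4 n" by (simp add: mult.assoc)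
          then have "\<eta> * (t n)\<^sup>2 \<le> ?\<theta>\<^sup>2" using elim(7) by (rule mult_right_le_imp_le)
          then have "?D \<le> - ((1 - 1 / sqrt (1 + \<eta> / 18)) / t n)"
            using elim f_ge th \<eta> by (intro Re_cgen_large) auto
          then have "y n * ?D \<le> y n * - ((1 - 1 / sqrt (1 + \<eta> / 18)) / t n)" using yn by (intro mult_left_mono) auto
          also have "\<dots> \<le> x / 2 * - ((1 - 1 / sqrt (1 + \<eta> / 18)) / t n)"
            using elim \<eta> by (intro mult_right_mono_neg) auto
          also have "\<dots> = - (c / t n)" by (simp add: c_def)
          finally have 1: "exp (y n * ?D) \<le> exp (- (c / t n))" by simp
          have "\<phi>\<^sup>2 \<le> (pi * \<sigma> n)\<^sup>2" using True by (metis abs_ge_zero power2_abs power_mono)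
          also have "\<dots> = pi\<^sup>2 * (x * mom 2 n)" by (simp add: power_mult_distrib s)
          also have "\<dots> \<le> pi\<^sup>2 * (x * (L / t n ^ (d + 2)))"
            using elim x by (intro mult_left_mono) (auto simp: pos_le_divide_eq mult.commute)
          finally have 2: "\<phi>\<^sup>2 \<le> pi\<^sup>2 * (x * (L / t n ^ (d + 2)))" .
          have "exp (- (c / t n)) / t n ^ (d + 2) = (c / t n) ^ (d + 2) * exp (- (c / t n)) / c ^ (d + 2)"
            using c elim by (simp add: power_divide)
          also have "\<dots> \<le> fact (d + 2) / c ^ (d + 2)"
            using c elim by (intro divide_right_mono power_exp_le) auto
          finally have 3: "exp (- (c / t n)) / t n ^ (d + 2) \<le> fact (d + 2) / c ^ (d + 2)" .
          have "(1 + \<phi>\<^sup>2) * exp (- (c / t n)) \<le> (1 + pi\<^sup>2 * (x * (L / t n ^ (d + 2)))) * exp (- (c / t n))"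
            using 2 by (intro mult_right_mono) auto
          also have "\<dots> = exp (- (c / t n)) + pi\<^sup>2 * (x * (L * (exp (- (c / t n)) / t n ^ (d + 2))))"
            by (simp add: algebra_simps)
          also have "\<dots> \<le> 1 + pi\<^sup>2 * (x * (L * (fact (d + 2) / c ^ (d + 2))))"
            using c elim L x 3 by (intro add_mono mult_left_mono) auto
          finally have "exp (- (c / t n)) \<le> (1 + pi\<^sup>2 * (x * (L * (fact (d + 2) / c ^ (d + 2))))) / (1 + \<phi>\<^sup>2)"
            by (subst pos_le_divide_eq) (auto simp: add_pos_nonneg mult.commute)
          then show ?thesis using 1 K(2) by linarith
        qed
        finally show ?thesis .
      qed
    qed
  qed
  then show ?thesis by blast
qed

lemma integrand_integral:
  assumes "t n > 0" "mom 2 n > 0" "y n \<ge> 0"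
  shows "integral\<^sup>L lborel (integrand n) =
    of_real (2 * pi * (\<sigma> n * (ecoef f (y n) (N n) * exp (- real (N n) * t n)) * exp (- y n * mom 0 n)))"
proof -
  have s: "\<sigma> n > 0" using \<sigma>[of n] x assms by simp
  have "integral\<^sup>L lborel (integrand n) = \<bar>\<sigma> n\<bar> *\<^sub>R (CLINT \<theta>|lborel. integrand n (0 + \<sigma> n * \<theta>))"
    using s by (intro lborel_integral_real_affine) simp
  also have "(\<lambda>\<theta>. integrand n (0 + \<sigma> n * \<theta>)) = (\<lambda>\<theta>. of_real (exp (- y n * mom 0 n)) *
      (indicator {-pi..pi} \<theta> *\<^sub>R (exp (of_real (y n) * cgen f (t n) \<theta>) * iexp (- (real (N n) * \<theta>)))))"
  proof
    fix \<theta>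
    have "indicator {- pi * \<sigma> n..pi * \<sigma> n} (\<sigma> n * \<theta>) = (indicator {-pi..pi} \<theta> :: real)"
    proof -
      have "- pi * \<sigma> n \<le> \<sigma> n * \<theta> \<longleftrightarrow> - pi \<le> \<theta>" "\<sigma> n * \<theta> \<le> pi * \<sigma> n \<longleftrightarrow> \<theta> \<le> pi"
        using s mult_le_cancel_left_pos[OF s, of "- pi" \<theta>] mult_le_cancel_left_pos[OF s, of \<theta> pi] by (simp_all add: mult.commute)
      then show ?thesis by (simp add: indicator_def)
    qed
    then show "integrand n (0 + \<sigma> n * \<theta>) = of_real (exp (- y n * mom 0 n)) *
      (indicator {-pi..pi} \<theta> *\<^sub>R (exp (of_real (y n) * cgen f (t n) \<theta>) * iexp (- (real (N n) * \<theta>))))"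
      using s by (simp add: integrand_def exp_of_real[symmetric] exp_add[symmetric] algebra_simps)
  qed
  also have "(CLINT \<theta>|lborel. of_real (exp (- y n * mom 0 n)) *
      (indicator {-pi..pi} \<theta> *\<^sub>R (exp (of_real (y n) * cgen f (t n) \<theta>) * iexp (- (real (N n) * \<theta>))))) =
      of_real (exp (- y n * mom 0 n)) * of_real (2 * pi * (ecoef f (y n) (N n) * exp (- real (N n) * t n)))"
    unfolding integral_mult_right_zero ecoef_integral[OF assms(1,3)] ..
  finally show ?thesis using s by (simp add: scaleR_conv_of_real mult_ac)
qed

text \<open>A local limit theorem: the factor \<open>exp (- (\<mu> ^ 2 / 2))\<close> is the price
  for a radius that misses the saddle point of \<open>y n\<close>.\<close>

theorem coefficient_limit:
  "(\<lambda>n. \<sigma> n * (ecoef f (y n) (N n) * exp (- real (N n) * t n)) * exp (- y n * mom 0 n))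
     \<longlonglongrightarrow> exp (- (\<mu>\<^sup>2 / 2)) / sqrt (2 * pi)"
proof -
  let ?g = "\<lambda>n. \<sigma> n * (ecoef f (y n) (N n) * exp (- real (N n) * t n)) * exp (- y n * mom 0 n)"
  obtain K where "\<forall>\<^sub>F n in sequentially. \<forall>\<phi>. norm (integrand n \<phi>) \<le> K / (1 + \<phi>\<^sup>2)" using integrand_bound by blast
  then obtain n0 where n0: "\<And>n \<phi>. n \<ge> n0 \<Longrightarrow> norm (integrand n \<phi>) \<le> K / (1 + \<phi>\<^sup>2)"
    unfolding eventually_sequentially by blast
  \<comment> \<open>Shifting by \<open>n0\<close> turns the eventual bound into one for all indices,
    as dominated convergence demands.\<close>
  have "(\<lambda>n. integral\<^sup>L lborel (integrand (n + n0))) \<longlonglongrightarrow>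
    (CLINT \<phi>|lborel. exp (\<i> * of_real (\<mu> * \<phi>) - of_real (\<phi>\<^sup>2 / 2)))"
  proof (rule integral_dominated_convergence)
    show "integrable lborel (\<lambda>x::real. K / (1 + x\<^sup>2))" by (rule integrable_one_plus_square)
    show "AE \<phi> in lborel. (\<lambda>n. integrand (n + n0) \<phi>) \<longlonglongrightarrow> exp (\<i> * of_real (\<mu> * \<phi>) - of_real (\<phi>\<^sup>2 / 2))"
      by (intro AE_I2 LIMSEQ_ignore_initial_segment integrand_limit)
  qed (use n0 integrand_measurable in auto)
  then have "(\<lambda>n. integral\<^sup>L lborel (integrand n)) \<longlonglongrightarrow> of_real (sqrt (2 * pi) * exp (- (\<mu>\<^sup>2 / 2)))"
    unfolding gaussian_fourier by (rule LIMSEQ_offset)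
  moreover have "\<forall>\<^sub>F n in sequentially. y n > 0" by (rule order_tendstoD(1)[OF y x])
  then have "\<forall>\<^sub>F n in sequentially. integral\<^sup>L lborel (integrand n) = of_real (2 * pi * ?g n)"
    using eventually_t_pos eventually_mom_pos[of 2] by eventually_elim (simp only: integrand_integral less_imp_le)
  ultimately have "(\<lambda>n. complex_of_real (2 * pi * ?g n)) \<longlonglongrightarrow> of_real (sqrt (2 * pi) * exp (- (\<mu>\<^sup>2 / 2)))"
    by (rule Lim_transform_eventually)
  then have "(\<lambda>n. 2 * pi * ?g n) \<longlonglongrightarrow> sqrt (2 * pi) * exp (- (\<mu>\<^sup>2 / 2))"
    by (simp only: tendsto_of_real_iff)
  then have "(\<lambda>n. 2 * pi * ?g n / (2 * pi)) \<longlonglongrightarrow> sqrt (2 * pi) * exp (- (\<mu>\<^sup>2 / 2)) / (2 * pi)"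
    by (intro tendsto_divide tendsto_const) auto
  also have "sqrt (2 * pi) * exp (- (\<mu>\<^sup>2 / 2)) / (2 * pi) = exp (- (\<mu>\<^sup>2 / 2)) / sqrt (2 * pi)"
  proof -
    have "sqrt (2 * pi) / (2 * pi) = 1 / sqrt (2 * pi)" by (simp add: sqrt_divide_self_eq inverse_eq_divide)
    then show ?thesis by (metis mult.commute mult.right_neutral times_divide_eq_left times_divide_eq_right)
  qed
  finally show ?thesis by simp
qed

end

end

section \<open>The saddle point\<close>

context saddle
begin

lemma moment_strict_antimono:
  assumes "0 < s" "s < t"
  shows "moment f j t < moment f j s"
proof -
  let ?h = "\<lambda>k. real k ^ j * f k * exp (- real k * s) - real k ^ j * f k * exp (- real k * t)"
  have S: "?h sums (moment f j s - moment f j t)"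
    using assms by (intro sums_diff moment_sums) auto
  have "?h k \<ge> 0" for k
    using assms f_nonneg[of k] by (auto intro!: mult_left_mono mult_nonneg_nonneg)
  moreover have "?h 1 > 0" using assms f_ge[of 1] by simp
  ultimately have "suminf ?h > 0" using S by (intro suminf_pos2[of _ 1]) (auto simp: sums_iff)
  then show ?thesis using S by (simp add: sums_iff)
qed

lemma isCont_moment:
  assumes "t > 0"
  shows "isCont (moment f j) t"
proof -
  let ?c = "\<lambda>k. real k ^ j * f k"
  have eq: "moment f j = (\<lambda>t. (\<lambda>z. \<Sum>k. ?c k * z ^ k) (exp (- t)))"
    by (simp add: moment_def fun_eq_iff exp_of_nat_mult[symmetric])
  \<comment> \<open>Convergence at the larger radius \<open>exp (- (t / 2))\<close> makes
    \<open>exp (- t)\<close> an interior point.\<close>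
  have "summable (\<lambda>k. ?c k * exp (- (t / 2)) ^ k)"
    using summable_moment[of "t / 2" j] assms by (simp add: exp_of_nat_mult[symmetric])
  then have "isCont (\<lambda>z. \<Sum>k. ?c k * z ^ k) (exp (- t))"
    by (rule isCont_powser) (use assms in simp)
  then show ?thesis unfolding eq by (rule isCont_o2[rotated]) (intro continuous_intros)
qed

lemma moment_tendsto_0: "(moment f 1 \<longlongrightarrow> 0) at_top"
proof (rule Lim_null_comparison)
  have S: "summable (\<lambda>k. 1 / real k ^ 2)"
    using inverse_power_summable[of 2, where 'a = real] by (simp add: field_simps)
  let ?L = "fact (1 + B + 2) * (\<Sum>k. 1 / real k ^ 2)"
  show "\<forall>\<^sub>F t in at_top. norm (moment f 1 t) \<le> ?L / t ^ (1 + B + 2)"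
    using eventually_gt_at_top[of 0]
  proof eventually_elim
    case (elim t)
    have "moment f 1 t \<le> fact (1 + B + 2) / t ^ (1 + B + 2) * (\<Sum>k. 1 / real k ^ 2)"
    proof (rule sums_le[OF _ moment_sums[OF elim] sums_mult[OF summable_sums[OF S]]])
      fix k
      show "real k ^ 1 * f k * exp (- real k * t) \<le> fact (1 + B + 2) / t ^ (1 + B + 2) * (1 / (real k)\<^sup>2)"
      proof (cases "k = 0")
        case False
        have "real k ^ 1 * f k * exp (- real k * t) \<le> real k ^ (1 + B) * exp (- real k * t)"
          unfolding power_add using f_le[of k] by (intro mult_right_mono mult_left_mono) auto
        also have "\<dots> \<le> fact (1 + B + 2) / t ^ (1 + B + 2) * (1 / (real k)\<^sup>2)"
          using False by (intro power_exp_decay[OF elim]) simp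
        finally show ?thesis .
      qed (use elim in simp)
    qed
    then show ?case using moment_nonneg[OF elim, of 1] by simp
  qed
  show "((\<lambda>t. ?L / t ^ (1 + B + 2)) \<longlongrightarrow> 0) at_top"
    by (intro real_tendsto_divide_at_top[OF tendsto_const] filterlim_pow_at_top filterlim_ident) simp
qed

lemma moment_at_top: "filterlim (moment f 1) at_top (at_right 0)"
proof -
  have pos: "\<forall>\<^sub>F t::real in at_right 0. t > 0" by (simp add: eventually_at_right_less)
  have "filterlim (\<lambda>t::real. inverse (t ^ (d + 1))) at_top (at_right 0)"
  proof (rule filterlim_inverse_at_top)
    have "((\<lambda>t::real. t ^ (d + 1)) \<longlongrightarrow> 0 ^ (d + 1)) (at_right 0)" by (intro tendsto_intros)
    then show "((\<lambda>t::real. t ^ (d + 1)) \<longlongrightarrow> 0) (at_right 0)" by simp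
    show "\<forall>\<^sub>F t::real in at_right 0. t ^ (d + 1) > 0" using pos by eventually_elim simp
  qed
  then have "filterlim (\<lambda>t. (t ^ (d + 1) * moment f 1 t) * inverse (t ^ (d + 1))) at_top (at_right 0)"
    by (intro filterlim_tendsto_pos_mult_at_top[OF moment_limit]) (use C in simp)
  moreover have "\<forall>\<^sub>F t in at_right 0. (t ^ (d + 1) * moment f 1 t) * inverse (t ^ (d + 1)) = moment f 1 t"
    using pos by eventually_elim (simp add: field_simps)
  ultimately show ?thesis by (rule filterlim_mono_eventually[OF _ order_refl order_refl])
qed

text \<open>Intermediate values between the blow-up at \<open>0\<close> and the decay at infinity.
  Together with \<open>moment_inj\<close> this makes the inverse function in the theorem
  meaningful.\<close>

lemma moment_surj:
  assumes "v > 0"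
  shows "\<exists>t>0. moment f 1 t = v"
proof -
  have pos: "\<forall>\<^sub>F t::real in at_right 0. t > 0" by (simp add: eventually_at_right_less)
  have "\<forall>\<^sub>F t in at_right 0. moment f 1 t \<ge> v" using moment_at_top by (simp add: filterlim_at_top)
  then have "\<forall>\<^sub>F t in at_right 0. t > 0 \<and> moment f 1 t \<ge> v" using pos by eventually_elim simp
  then obtain p where p: "p > 0" "moment f 1 p \<ge> v"
    using eventually_happens trivial_limit_at_right_real by blast
  have "\<forall>\<^sub>F t in at_top. moment f 1 t < v" by (rule order_tendstoD(2)[OF moment_tendsto_0 assms])
  then have "\<forall>\<^sub>F t in at_top. t \<ge> p \<and> moment f 1 t < v"
    using eventually_ge_at_top[of p] by eventually_elim simp
  then obtain r where r: "r \<ge> p" "moment f 1 r < v"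
    using eventually_happens trivial_limit_at_top_linorder by blast
  have "\<exists>t. p \<le> t \<and> t \<le> r \<and> moment f 1 t = v"
    by (rule IVT2) (use p r isCont_moment in auto)
  then show ?thesis using p by (auto intro: less_le_trans)
qed

lemma moment_inj: "inj_on (moment f 1) {0<..}"
  by (rule inj_onI) (metis greaterThan_iff linorder_neqE less_irrefl moment_strict_antimono)

context
  fixes x :: real and \<tau> :: "nat \<Rightarrow> real"
  assumes x: "x > 0" and \<tau>: "\<And>n. n \<ge> 1 \<Longrightarrow> \<tau> n > 0" "\<And>n. n \<ge> 1 \<Longrightarrow> x * moment f 1 (\<tau> n) = real n"
begin

lemma tau_at_right: "filterlim \<tau> (at_right 0) sequentially"
proof -
  have pos: "\<forall>\<^sub>F n in sequentially. \<tau> n > 0"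
    using eventually_ge_at_top[of 1] by eventually_elim (rule \<tau>(1))
  have "\<tau> \<longlonglongrightarrow> 0"
  proof (rule order_tendstoI)
    fix e :: real assume "e < 0"
    show "\<forall>\<^sub>F n in sequentially. \<tau> n > e" using pos by eventually_elim (use \<open>e < 0\<close> in simp)
  next
    fix e :: real assume e: "0 < e"
    have "\<forall>\<^sub>F n in sequentially. real n > x * moment f 1 e"
      using filterlim_real_sequentially by (simp add: filterlim_at_top_dense)
    then show "\<forall>\<^sub>F n in sequentially. \<tau> n < e"
      using eventually_ge_at_top[of 1]
    proof eventually_elim
      case (elim n)
      show ?case
      proof (rule ccontr)
        assume "\<not> \<tau> n < e"
        then have "moment f 1 (\<tau> n) \<le> moment f 1 e"
          using moment_strict_antimono[OF e, of "\<tau> n" 1] by (cases "\<tau> n = e") auto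
        then have "x * moment f 1 (\<tau> n) \<le> x * moment f 1 e" using x by (intro mult_left_mono) auto
        then show False using elim \<tau>(2)[of n] by simp
      qed
    qed
  qed
  then show ?thesis using pos by (auto simp: filterlim_at elim: eventually_mono)
qed

lemma tau_moment_limit: "(\<lambda>n. \<tau> n ^ (d + j) * moment f j (\<tau> n)) \<longlonglongrightarrow> C * fact (d + j - 1)"
  by (rule filterlim_compose[OF moment_limit tau_at_right])

lemma tau_power_limit: "(\<lambda>n. \<tau> n ^ (d + 1) * real n) \<longlonglongrightarrow> x * (C * fact d)"
proof -
  have "(\<lambda>n. x * (\<tau> n ^ (d + 1) * moment f 1 (\<tau> n))) \<longlonglongrightarrow> x * (C * fact (d + 1 - 1))"
    by (rule tendsto_mult_left[OF tau_moment_limit])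
  moreover have "\<forall>\<^sub>F n in sequentially. x * (\<tau> n ^ (d + 1) * moment f 1 (\<tau> n)) = \<tau> n ^ (d + 1) * real n"
    using eventually_ge_at_top[of 1] by eventually_elim (simp add: \<tau>(2)[symmetric] mult_ac)
  ultimately have "(\<lambda>n. \<tau> n ^ (d + 1) * real n) \<longlonglongrightarrow> x * (C * fact (d + 1 - 1))"
    by (rule Lim_transform_eventually)
  then show ?thesis by simp
qed

text \<open>The exponent is that of \<open>n\<close> in the scaling \<open>b n\<close>: it
  identifies the order of \<open>b n\<close> as \<open>\<tau> n powr (- d / 2)\<close>, comparable
  with the moments.\<close>

lemma tau_powr_limit:
  "(\<lambda>n. real n powr (real d / (2 * real (d + 1))) * \<tau> n powr (real d / 2)) \<longlonglongrightarrow>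
     (x * (C * fact d)) powr (real d / (2 * real (d + 1)))"
proof -
  let ?e = "real d / (2 * real (d + 1))"
  have "(\<lambda>n. (\<tau> n ^ (d + 1) * real n) powr ?e) \<longlonglongrightarrow> (x * (C * fact d)) powr ?e"
    using x C by (intro tendsto_powr' tau_power_limit tendsto_const) auto
  moreover have "\<forall>\<^sub>F n in sequentially. (\<tau> n ^ (d + 1) * real n) powr ?e =
    real n powr ?e * \<tau> n powr (real d / 2)"
    using eventually_ge_at_top[of 1]
  proof eventually_elim
    case (elim n)
    have p: "\<tau> n > 0" using \<tau>(1)[OF elim] .
    have "(\<tau> n ^ (d + 1) * real n) powr ?e = (\<tau> n ^ (d + 1)) powr ?e * real n powr ?e"
      by (rule powr_mult)
    also have "(\<tau> n ^ (d + 1)) powr ?e = \<tau> n powr (real (d + 1) * ?e)"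
      using p by (simp only: powr_realpow[OF p, symmetric] powr_powr)
    also have "real (d + 1) * ?e = real d / 2" by (simp add: field_simps)
    finally show ?case by (simp add: mult.commute)
  qed
  ultimately show ?thesis by (rule Lim_transform_eventually)
qed

end

end

section \<open>The central limit theorem\<close>

text \<open>By \<open>card_trans_tuples\<close>, for \<open>k \<ge> 1\<close> this is the number of
  transitive tuples on \<open>k\<close> points divided by \<open>fact k\<close>.\<close>

definition orbit_weight :: "nat \<Rightarrow> nat \<Rightarrow> real" where
  "orbit_weight l k = real (tcount l k) / real k"

lemma tcount_ge_1:
  assumes "k \<ge> 1"
  shows "tcount (Suc l) k \<ge> 1"
proof (induction l)
  case 0
  then show ?case using assms tcount_1[of k] by (simp del: tcount.simps)
next
  case (Suc l)
  have "k * tcount (Suc l) k \<le> (\<Sum>j | j dvd k. j * tcount (Suc l) j)"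
    using assms by (intro member_le_sum) auto
  then have "k * tcount (Suc l) k \<le> tcount (Suc (Suc l)) k" by (simp only: tcount.simps)
  moreover have "1 * 1 \<le> k * tcount (Suc l) k" using assms Suc by (intro mult_le_mono)
  ultimately show ?case by linarith
qed

text \<open>The divisor \<open>j = k\<close> alone suffices. For \<open>l = 1\<close> the bound
  fails, since \<open>tcount 1 k = 1\<close> for all \<open>k \<ge> 1\<close>.\<close>

lemma tcount_ge:
  assumes "k \<ge> 1" "l \<ge> 2"
  shows "tcount l k \<ge> k"
proof -
  define m where "m = l - 2"
  have l: "l = Suc (Suc m)" using assms(2) by (simp add: m_def)
  have "k * tcount (Suc m) k \<le> (\<Sum>j | j dvd k. j * tcount (Suc m) j)"
    using assms by (intro member_le_sum) auto
  then have "k * tcount (Suc m) k \<le> tcount l k" by (simp only: tcount.simps l)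
  moreover have "k * 1 \<le> k * tcount (Suc m) k" using assms tcount_ge_1 by (intro mult_le_mono) auto
  ultimately show ?thesis by linarith
qed

lemma moment_orbit_weight:
  assumes "t > 0"
  shows "moment (orbit_weight l) j t = zser l (int l - 1 + int j) t"
proof -
  have "real k ^ j * orbit_weight l k * exp (- real k * t) = zterm l (int l - 1 + int j) t k" for k
  proof (cases "k = 0")
    case False
    have "real k powi (int l - 1 + int j - int l) = real k ^ j / real k"
      using False power_int_diff[of "real k" "int j" 1] by simp
    then show ?thesis by (simp add: orbit_weight_def zterm_def)
  qed (simp add: zterm_def tcount_0_right orbit_weight_def)
  then show ?thesis using zser_sums[OF assms, of l "int l - 1 + int j"]
    by (simp add: moment_def sums_iff)
qed

lemma real_zeta_pos:
  assumes "k \<ge> 2"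
  shows "real_zeta (real k) > 0"
proof -
  have "summable (\<lambda>n. 1 / real (Suc n) ^ k)"
    using inverse_power_summable[of k, where 'a = real] summable_Suc_iff[of "\<lambda>n. 1 / real n ^ k"] assms
    by (simp add: field_simps)
  then have "summable (\<lambda>n. 1 / real (Suc n) powr real k)" by (subst powr_realpow) simp_all
  then show ?thesis unfolding real_zeta_def by (intro suminf_pos) auto
qed

lemma saddle_orbit_weight:
  assumes "l \<ge> 2"
  shows "saddle (orbit_weight l) (2 * l) (l - 1) (\<Prod>i=2..l. real_zeta (real i))"
proof
  show "orbit_weight l 0 = 0" by (simp add: orbit_weight_def)
  show "orbit_weight l k \<ge> 0" for k by (simp add: orbit_weight_def)
  show "orbit_weight l k \<le> real k ^ (2 * l)" for k
  proof (cases "k = 0")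
    case False
    have "real (tcount l k) \<le> real k ^ (2 * l)" using tcount_le[of l k] by (metis of_nat_le_iff of_nat_power)
    then have "real (tcount l k) \<le> real k ^ (2 * l) * 1" by simp
    also have "\<dots> \<le> real k ^ (2 * l) * real k" using False by (intro mult_left_mono) auto
    finally show ?thesis using False by (simp add: orbit_weight_def pos_divide_le_eq)
  qed (simp add: orbit_weight_def)
  show "orbit_weight l k \<ge> 1" if "k \<ge> 1" for k
    using tcount_ge[OF that assms] that by (simp add: orbit_weight_def pos_le_divide_eq)
  show "l - 1 \<ge> 1" using assms by simp
  show "(\<Prod>i=2..l. real_zeta (real i)) > 0" by (intro prod_pos) (auto intro: real_zeta_pos)
  fix j
  obtain m where l: "l = Suc m" using assms by (cases l) auto
  have pos: "\<forall>\<^sub>F t::real in at_right 0. t > 0" by (simp add: eventually_at_right_less)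
  have "((\<lambda>t. t ^ (m + j) * zser (Suc m) (int (m + j)) t) \<longlongrightarrow>
    fact (m + j - 1) * (\<Prod>i=2..Suc m. real_zeta (real i))) (at_right 0)"
    using zser_limit[of "m + j" m] assms l by simp
  moreover have "\<forall>\<^sub>F t in at_right 0. t ^ (m + j) * zser (Suc m) (int (m + j)) t = t ^ (m + j) * moment (orbit_weight l) j t"
    using pos by eventually_elim (simp add: moment_orbit_weight l)
  ultimately have "((\<lambda>t. t ^ (m + j) * moment (orbit_weight l) j t) \<longlongrightarrow>
    fact (m + j - 1) * (\<Prod>i=2..Suc m. real_zeta (real i))) (at_right 0)" by (rule Lim_transform_eventually)
  then show "((\<lambda>t. t ^ (l - 1 + j) * moment (orbit_weight l) j t) \<longlongrightarrow>
    (\<Prod>i=2..l. real_zeta (real i)) * fact (l - 1 + j - 1)) (at_right 0)"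
    by (simp only: l diff_Suc_1 mult.commute[of "fact _"])
qed

lemma partition_function_orbit_weight:
  "(\<Sum>\<sigma>\<in>commuting_tuples l n. x ^ num_orbits n \<sigma>) = fact n * ecoef (orbit_weight l) x n"
proof -
  have "(\<lambda>k. x * (real k * orbit_weight l k)) = (\<lambda>k. x * real (tcount l k))"
    by (auto simp: orbit_weight_def tcount_0_right)
  then show ?thesis by (simp only: commuting_partition_function)
qed

lemma commuting_mgf:
  assumes "x > 0"
  shows "(\<integral>\<sigma>. exp (s * ((real (num_orbits n \<sigma>) - a) / b)) \<partial>commuting_measure l n x) =
    exp (- (s * (a / b))) * (ecoef (orbit_weight l) (x * exp (s / b)) n / ecoef (orbit_weight l) x n)"
proof -
  let ?T = "commuting_tuples l n"
  let ?S = "\<Sum>\<tau>\<in>?T. x ^ num_orbits n \<tau>"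
  have "(\<integral>\<sigma>. exp (s * ((real (num_orbits n \<sigma>) - a) / b)) \<partial>commuting_measure l n x) =
    (\<Sum>\<sigma>\<in>?T. (x ^ num_orbits n \<sigma> / ?S) *\<^sub>R exp (s * ((real (num_orbits n \<sigma>) - a) / b)))"
    unfolding commuting_measure_def using assms
    by (intro lebesgue_integral_point_measure_finite finite_commuting_tuples) (auto intro!: divide_nonneg_nonneg sum_nonneg)
  also have "\<dots> = (\<Sum>\<sigma>\<in>?T. exp (- (s * (a / b))) / ?S * (x * exp (s / b)) ^ num_orbits n \<sigma>)"
  proof (rule sum.cong[OF refl])
    fix \<sigma>
    let ?k = "num_orbits n \<sigma>"
    have "exp (s * ((real ?k - a) / b)) = exp (real ?k * (s / b) + - (s * (a / b)))"
      by (simp add: diff_divide_distrib algebra_simps)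
    also have "\<dots> = exp (s / b) ^ ?k * exp (- (s * (a / b)))"
      by (simp only: exp_add exp_of_nat_mult)
    finally show "(x ^ ?k / ?S) *\<^sub>R exp (s * ((real ?k - a) / b)) =
      exp (- (s * (a / b))) / ?S * (x * exp (s / b)) ^ ?k" by (simp add: power_mult_distrib)
  qed
  also have "\<dots> = exp (- (s * (a / b))) / ?S * (\<Sum>\<sigma>\<in>?T. (x * exp (s / b)) ^ num_orbits n \<sigma>)"
    by (simp only: sum_distrib_left)
  also have "\<dots> = exp (- (s * (a / b))) * (ecoef (orbit_weight l) (x * exp (s / b)) n / ecoef (orbit_weight l) x n)"
    unfolding partition_function_orbit_weight by simp
  finally show ?thesis .
qed

lemma scaled_exp_limits:
  fixes s :: real
  shows "((\<lambda>B. B * (exp (s / B) - 1)) \<longlongrightarrow> s) at_top"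
    and "((\<lambda>B. B\<^sup>2 * (exp (s / B) - 1 - s / B)) \<longlongrightarrow> s\<^sup>2 / 2) at_top"
proof -
  \<comment> \<open>The growth comparison by \<open>real_asymp\<close> needs the sign of
    \<open>s\<close>.\<close>
  consider "s = 0" | "s > 0" | "s < 0" by linarith
  then show "((\<lambda>B. B * (exp (s / B) - 1)) \<longlongrightarrow> s) at_top"
    by cases (simp, real_asymp+)
  consider "s = 0" | "s > 0" | "s < 0" by linarith
  then have "((\<lambda>B. B\<^sup>2 * (exp (s / B) - 1 - s / B)) \<longlongrightarrow> s * s / 2) at_top"
    by cases (simp, real_asymp+)
  then show "((\<lambda>B. B\<^sup>2 * (exp (s / B) - 1 - s / B)) \<longlongrightarrow> s\<^sup>2 / 2) at_top"
    by (simp add: power2_eq_square)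
qed

theorem proposition1p1:
  fixes l :: nat and x :: real and a b :: "nat \<Rightarrow> real"
  assumes "l \<ge> 2" and "x > 0"
    and "\<And>n. n \<ge> 1 \<Longrightarrow> b n > 0"
    and "(\<lambda>n. a n - x * Z_fun l (int l - 1) (the_inv_into {0<..} (Z_fun l (int l)) (real n / x)))
           \<in> o[at_top](\<lambda>n. real n powr ((real l - 1) / (2 * real l)))"
    and "b \<sim>[at_top] (\<lambda>n. (x * K_const l) powr (1 / (2 * real l)) / sqrt (real l * (real l - 1))
                          * real n powr ((real l - 1) / (2 * real l)))"
  shows "\<forall>s::real.
    (\<lambda>n. ln (\<integral>\<sigma>. exp (s * ((real (num_orbits n \<sigma>) - a n) / b n)) \<partial>commuting_measure l n x))
      \<longlonglongrightarrow> s\<^sup>2 / 2"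
proof
  fix s :: real
  define d where "d = l - 1"
  define C where "C = (\<Prod>i=2..l. real_zeta (real i))"
  define f where "f = orbit_weight l"
  have l: "l = d + 1" "real l = real d + 1" and d1: "d \<ge> 1" using assms(1) by (auto simp: d_def)
  interpret saddle f "2 * l" d C unfolding f_def d_def C_def by (rule saddle_orbit_weight[OF assms(1)])
  note x = assms(2) and bpos = assms(3)
  define \<tau> where "\<tau> n = the_inv_into {0<..} (Z_fun l (int l)) (real n / x)" for n :: nat
  define e where "e = real d / (2 * real (d + 1))"
  have e: "e > 0" using d1 by (simp add: e_def)
  have exp_e: "(real l - 1) / (2 * real l) = e" by (simp add: e_def l)
  define k where "k = x * (C * fact d)"
  have k: "k > 0" using x C by (simp add: k_def)
  have xK: "x * K_const l = k" by (simp add: k_def K_const_def C_def d_def mult.commute)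
  define g where "g = k powr (1 / (2 * real l)) / sqrt (real l * (real l - 1))"
  have g: "g > 0" using k d1 l by (simp add: g_def)

  have Z: "Z_fun l (int l) t = moment f 1 t" "Z_fun l (int l - 1) t = moment f 0 t" if "t > 0" for t
    using that by (simp_all add: Z_fun_eq_zser f_def moment_orbit_weight)
  have inj: "inj_on (Z_fun l (int l)) {0<..}"
    using moment_inj by (subst inj_on_cong[where g = "moment f 1"]) (auto simp: Z)
  have tau: "\<tau> n > 0 \<and> x * moment f 1 (\<tau> n) = real n" if "n \<ge> 1" for n
  proof -
    have "real n / x > 0" using that x by simp
    then obtain t where t: "t > 0" "moment f 1 t = real n / x" using moment_surj by blast
    then have im: "real n / x \<in> Z_fun l (int l) ` {0<..}" using Z(1)[OF t(1)] by (intro image_eqI[of _ _ t]) auto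
    have pos: "\<tau> n > 0" using the_inv_into_into[OF inj im, of "{0<..}"] by (simp add: \<tau>_def)
    have "Z_fun l (int l) (\<tau> n) = real n / x" unfolding \<tau>_def by (rule f_the_inv_into_f[OF inj im])
    then show ?thesis using pos Z(1)[OF pos] x by simp
  qed
  note tpos = tau[THEN conjunct1] and teq = tau[THEN conjunct2]
  let ?m = "\<lambda>j n. moment f j (\<tau> n)"
  have tr: "filterlim \<tau> (at_right 0) sequentially" by (rule tau_at_right[OF x tpos teq])
  have mlim: "(\<lambda>n. \<tau> n ^ (d + j) * ?m j n) \<longlonglongrightarrow> C * fact (d + j - 1)" for j
    by (rule tau_moment_limit[OF x tpos teq])
  have evt: "\<forall>\<^sub>F n in sequentially. \<tau> n > 0"
    using eventually_ge_at_top[of 1] by eventually_elim (rule tpos)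
  have evm: "\<forall>\<^sub>F n in sequentially. ?m j n > 0" for j
  proof -
    have "\<forall>\<^sub>F n in sequentially. \<tau> n ^ (d + j) * ?m j n > 0"
      by (rule order_tendstoD(1)[OF mlim]) (use C in simp)
    then show ?thesis using evt by eventually_elim (simp add: zero_less_mult_iff)
  qed
  define \<sigma> where "\<sigma> n = sqrt (x * ?m 2 n)" for n
  have evs: "\<forall>\<^sub>F n in sequentially. \<sigma> n > 0"
    using evm[of 2] by eventually_elim (use x in \<open>simp add: \<sigma>_def\<close>)
  have evb: "\<forall>\<^sub>F n in sequentially. b n > 0"
    using eventually_ge_at_top[of 1] by eventually_elim (rule bpos)

  have b_eq: "b \<sim>[at_top] (\<lambda>n. g * real n powr e)"
    using assms(5) unfolding exp_e xK g_def[symmetric] .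
  have powr_pos: "\<forall>\<^sub>F n in sequentially. real n powr e > 0"
    using eventually_gt_at_top[of 0] by eventually_elim simp
  have "(\<lambda>n. b n / (g * real n powr e)) \<longlonglongrightarrow> 1"
    by (rule asymp_equivD_strong[OF b_eq]) (use evb in \<open>auto elim: eventually_mono\<close>)
  then have "(\<lambda>n. g * (b n / (g * real n powr e))) \<longlonglongrightarrow> g * 1" by (rule tendsto_mult_left)
  then have b_lim: "(\<lambda>n. b n / real n powr e) \<longlonglongrightarrow> g" using g by simp
  have b_top: "filterlim b at_top sequentially"
  proof (rule asymp_equiv_at_top_transfer[OF asymp_equiv_symI[OF b_eq]])
    show "filterlim (\<lambda>n. g * real n powr e) at_top sequentially" using g e by real_asymp
  qed

  \<comment> \<open>The scaling is re-expressed through \<open>\<tau>\<close>; after squaring,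
    \<open>(b n) ^ 2 * \<tau> ^ d\<close> can be paired with the moment limits.\<close>
  have "(\<lambda>n. (b n / real n powr e) * (real n powr e * \<tau> n powr (real d / 2))) \<longlonglongrightarrow> g * k powr e"
    unfolding e_def k_def by (intro tendsto_mult b_lim[unfolded e_def] tau_powr_limit[OF x tpos teq])
  then have "(\<lambda>n. ((b n / real n powr e) * (real n powr e * \<tau> n powr (real d / 2)))\<^sup>2) \<longlonglongrightarrow> (g * k powr e)\<^sup>2"
    by (rule tendsto_power)
  also have "(g * k powr e)\<^sup>2 = k / (real l * real d)"
  proof -
    \<comment> \<open>The exponents \<open>1 / (2 * l)\<close> and \<open>(l - 1) / (2 * l)\<close>
      add up to \<open>1 / 2\<close>, so squaring leaves no fractional power of
      \<open>k\<close>.\<close>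
    have "1 / (2 * real l) + e = 1 / 2" by (simp add: e_def l field_simps)
    then have "k powr (1 / (2 * real l)) * k powr e = sqrt k"
      using k by (simp only: powr_add[symmetric] powr_half_sqrt)
    moreover have "real l - 1 = real d" by (simp add: l)
    ultimately have "g * k powr e = sqrt k / sqrt (real l * real d)"
      by (simp add: g_def times_divide_eq_left)
    then show ?thesis using k by (simp add: power_divide)
  qed
  finally have "(\<lambda>n. ((b n / real n powr e) * (real n powr e * \<tau> n powr (real d / 2)))\<^sup>2) \<longlonglongrightarrow> k / (real l * real d)" .
  moreover have "\<forall>\<^sub>F n in sequentially. ((b n / real n powr e) * (real n powr e * \<tau> n powr (real d / 2)))\<^sup>2 =
    (b n)\<^sup>2 * \<tau> n ^ d"
    using evt powr_pos
  proof eventually_elim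
    case (elim n)
    have "(\<tau> n powr (real d / 2))\<^sup>2 = \<tau> n powr real d"
      by (simp add: power2_eq_square powr_add[symmetric])
    also have "\<dots> = \<tau> n ^ d" using elim by (simp add: powr_realpow)
    finally show ?case using elim by (simp add: power_mult_distrib)
  qed
  ultimately have b2: "(\<lambda>n. (b n)\<^sup>2 * \<tau> n ^ d) \<longlonglongrightarrow> k / (real l * real d)" by (rule Lim_transform_eventually)
  have b2ne: "k / (real l * real d) \<noteq> 0" using k d1 l by simp

  have fact_d: "fact d = real d * fact (d - 1)" using d1 by (cases d) auto
  \<comment> \<open>\<open>x * m0\<close> is asymptotic to \<open>(k / d) * \<tau> ^ -d\<close>,
    while \<open>(b n) ^ 2\<close> is asymptotic to
    \<open>k / (l * d) * \<tau> ^ -d\<close>.\<close>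
  have L1: "(\<lambda>n. x * ?m 0 n / (b n)\<^sup>2) \<longlonglongrightarrow> real l"
  proof -
    have "(\<lambda>n. x * (\<tau> n ^ (d + 0) * ?m 0 n) / ((b n)\<^sup>2 * \<tau> n ^ d)) \<longlonglongrightarrow>
      x * (C * fact (d + 0 - 1)) / (k / (real l * real d))"
      by (intro tendsto_divide tendsto_mult_left mlim b2 b2ne)
    also have "x * (C * fact (d + 0 - 1)) / (k / (real l * real d)) = real l"
      using x C d1 by (simp add: k_def fact_d)
    finally have "(\<lambda>n. x * (\<tau> n ^ (d + 0) * ?m 0 n) / ((b n)\<^sup>2 * \<tau> n ^ d)) \<longlonglongrightarrow> real l" .
    moreover have "\<forall>\<^sub>F n in sequentially. x * (\<tau> n ^ (d + 0) * ?m 0 n) / ((b n)\<^sup>2 * \<tau> n ^ d) = x * ?m 0 n / (b n)\<^sup>2"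
      using evt by eventually_elim simp
    ultimately show ?thesis by (rule Lim_transform_eventually)
  qed
  have L2: "(\<lambda>n. x * ?m 1 n / (b n * \<sigma> n)) \<longlonglongrightarrow> sqrt (real d)"
  proof -
    \<comment> \<open>Squared for integer powers of \<open>\<tau>\<close>; the factorials give
      \<open>fact d / fact (d + 1) = 1 / l\<close>, which cancels against \<open>l * d\<close> to
      leave \<open>d\<close>.\<close>
    let ?q = "\<lambda>n. x * (\<tau> n ^ (d + 1) * ?m 1 n)\<^sup>2 / (((b n)\<^sup>2 * \<tau> n ^ d) * (\<tau> n ^ (d + 2) * ?m 2 n))"
    have "?q \<longlonglongrightarrow> x * (C * fact (d + 1 - 1))\<^sup>2 / ((k / (real l * real d)) * (C * fact (d + 2 - 1)))"
      using b2ne C by (intro tendsto_divide tendsto_mult[OF b2] tendsto_mult_left tendsto_power mlim) auto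
    also have "x * (C * fact (d + 1 - 1))\<^sup>2 / ((k / (real l * real d)) * (C * fact (d + 2 - 1))) = real d"
    proof -
      have "fact (d + 2 - 1) = real l * fact d" by (simp add: l)
      moreover have "real l > 0" by (simp add: l)
      ultimately show ?thesis using x C by (simp add: k_def power2_eq_square)
    qed
    finally have "(\<lambda>n. sqrt (?q n)) \<longlonglongrightarrow> sqrt (real d)" by (rule tendsto_real_sqrt)
    moreover have "\<forall>\<^sub>F n in sequentially. sqrt (?q n) = x * ?m 1 n / (b n * \<sigma> n)"
      using evt evb evm[of 1] evm[of 2] evs
    proof eventually_elim
      case (elim n)
      have "(\<tau> n ^ (d + 1))\<^sup>2 = \<tau> n ^ d * \<tau> n ^ (d + 2)"
        by (simp only: power_add[symmetric] power_mult[symmetric], rule arg_cong[where f = "\<lambda>i. \<tau> n ^ i"]) simp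
      moreover have "x * (p * m)\<^sup>2 / (B * u * (v * w)) = (p\<^sup>2 * (x * m\<^sup>2)) / ((u * v) * (B * w))"
        for p m B u v w :: real by (simp add: power_mult_distrib mult_ac)
      ultimately have "?q n = (\<tau> n ^ d * \<tau> n ^ (d + 2)) * (x * (?m 1 n)\<^sup>2) / ((\<tau> n ^ d * \<tau> n ^ (d + 2)) * ((b n)\<^sup>2 * ?m 2 n))"
        by (simp only:)
      also have "\<dots> = (x * (?m 1 n)\<^sup>2) / ((b n)\<^sup>2 * ?m 2 n)" using elim by simp
      also have "\<dots> = (x * ?m 1 n)\<^sup>2 / ((b n)\<^sup>2 * (x * ?m 2 n))" using x by (simp add: power2_eq_square mult_ac)
      also have "x * ?m 2 n = (\<sigma> n)\<^sup>2" using elim x by (simp add: \<sigma>_def)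
      finally have "?q n = (x * ?m 1 n / (b n * \<sigma> n))\<^sup>2" by (simp add: power_divide power_mult_distrib)
      then have "sqrt (?q n) = \<bar>x * ?m 1 n / (b n * \<sigma> n)\<bar>" by simp
      then show ?case using elim x by simp
    qed
    ultimately show ?thesis by (rule Lim_transform_eventually)
  qed

  define y where "y n = x * exp (s / b n)" for n
  have sb: "(\<lambda>n. s / b n) \<longlonglongrightarrow> 0"
    by (rule real_tendsto_divide_at_top[OF tendsto_const b_top])
  have y: "y \<longlonglongrightarrow> x"
  proof -
    have "(\<lambda>n. x * exp (s / b n)) \<longlonglongrightarrow> x * exp 0" by (intro tendsto_mult_left tendsto_exp sb)
    then show ?thesis by (simp add: y_def[abs_def])
  qed
  have E1: "(\<lambda>n. b n * (exp (s / b n) - 1)) \<longlonglongrightarrow> s"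
    by (rule filterlim_compose[OF scaled_exp_limits(1) b_top])
  have E2: "(\<lambda>n. (b n)\<^sup>2 * (exp (s / b n) - 1 - s / b n)) \<longlonglongrightarrow> s\<^sup>2 / 2"
    by (rule filterlim_compose[OF scaled_exp_limits(2) b_top])

  \<comment> \<open>As \<open>x * m1 = n\<close>, the deviation of \<open>y n\<close> from its
    saddle equation is \<open>(exp (s / b n) - 1) * x * m1\<close>, of the same order as
    \<open>\<sigma>\<close>.\<close>
  have mu: "(\<lambda>n. (y n * ?m 1 n - real n) / \<sigma> n) \<longlonglongrightarrow> s * sqrt (real d)"
  proof -
    have "\<forall>\<^sub>F n in sequentially. (b n * (exp (s / b n) - 1)) * (x * ?m 1 n / (b n * \<sigma> n)) = (y n * ?m 1 n - real n) / \<sigma> n"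
      using eventually_ge_at_top[of 1] evb evs
    proof eventually_elim
      case (elim n)
      have "y n * ?m 1 n - real n = (exp (s / b n) - 1) * (x * ?m 1 n)"
        by (simp add: y_def teq[OF elim(1), symmetric] algebra_simps)
      then show ?case using elim by simp
    qed
    with tendsto_mult[OF E1 L2] show ?thesis by (rule Lim_transform_eventually)
  qed
  let ?G = "\<lambda>y n. \<sigma> n * (ecoef f y n * exp (- real n * \<tau> n)) * exp (- y * ?m 0 n)"
  have G1: "(\<lambda>n. ?G (y n) n) \<longlonglongrightarrow> exp (- ((s * sqrt (real d))\<^sup>2 / 2)) / sqrt (2 * pi)"
    by (rule coefficient_limit[OF tr x y \<sigma>_def, of "\<lambda>n. n", OF mu])
  have "\<forall>\<^sub>F n in sequentially. 0 = (x * ?m 1 n - real n) / \<sigma> n"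
    using eventually_ge_at_top[of 1] by eventually_elim (simp only: teq diff_self div_0)
  then have "(\<lambda>n. (x * ?m 1 n - real n) / \<sigma> n) \<longlonglongrightarrow> 0" by (rule Lim_transform_eventually[OF tendsto_const])
  then have G0: "(\<lambda>n. ?G x n) \<longlonglongrightarrow> exp (- (0\<^sup>2 / 2)) / sqrt (2 * pi)"
    by (rule coefficient_limit[OF tr x tendsto_const \<sigma>_def, of "\<lambda>n. n"])
  have "(\<lambda>n. ln (?G (y n) n) - ln (?G x n)) \<longlonglongrightarrow>
    ln (exp (- ((s * sqrt (real d))\<^sup>2 / 2)) / sqrt (2 * pi)) - ln (exp (- (0\<^sup>2 / 2)) / sqrt (2 * pi))"
    by (intro tendsto_diff tendsto_ln G1 G0) auto
  also have "ln (exp (- ((s * sqrt (real d))\<^sup>2 / 2)) / sqrt (2 * pi)) - ln (exp (- (0\<^sup>2 / 2)) / sqrt (2 * pi)) =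
    - (s\<^sup>2 * real d / 2)" by (simp add: ln_div power_mult_distrib)
  finally have lim1: "(\<lambda>n. ln (?G (y n) n) - ln (?G x n)) \<longlonglongrightarrow> - (s\<^sup>2 * real d / 2)" .

  have lim2: "(\<lambda>n. (x * ?m 0 n / (b n)\<^sup>2) * ((b n)\<^sup>2 * (exp (s / b n) - 1 - s / b n))) \<longlonglongrightarrow> real l * (s\<^sup>2 / 2)"
    by (intro tendsto_mult L1 E2)
  \<comment> \<open>The permitted error of \<open>a n\<close> is \<open>o(n powr e)\<close>, and
    \<open>b n\<close> is of exact order \<open>n powr e\<close>.\<close>
  have lim3: "(\<lambda>n. s * (((a n - x * Z_fun l (int l - 1) (\<tau> n)) / real n powr e) / (b n / real n powr e))) \<longlonglongrightarrow> 0"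
  proof -
    have "(\<lambda>n. (a n - x * Z_fun l (int l - 1) (\<tau> n)) / real n powr e) \<longlonglongrightarrow> 0"
      using assms(4) unfolding exp_e \<tau>_def by (rule smalloD_tendsto)
    then have "(\<lambda>n. s * (((a n - x * Z_fun l (int l - 1) (\<tau> n)) / real n powr e) / (b n / real n powr e))) \<longlonglongrightarrow> s * (0 / g)"
      using g by (intro tendsto_mult_left tendsto_divide b_lim) auto
    then show ?thesis by simp
  qed
  have "(\<lambda>n. (ln (?G (y n) n) - ln (?G x n)) + (x * ?m 0 n / (b n)\<^sup>2) * ((b n)\<^sup>2 * (exp (s / b n) - 1 - s / b n)) -
      s * (((a n - x * Z_fun l (int l - 1) (\<tau> n)) / real n powr e) / (b n / real n powr e)))
    \<longlonglongrightarrow> - (s\<^sup>2 * real d / 2) + real l * (s\<^sup>2 / 2) - 0"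
    by (intro tendsto_diff tendsto_add lim1 lim2 lim3)
  also have "- (s\<^sup>2 * real d / 2) + real l * (s\<^sup>2 / 2) - 0 = s\<^sup>2 / 2" by (simp add: l algebra_simps)
  finally have lim: "(\<lambda>n. (ln (?G (y n) n) - ln (?G x n)) + (x * ?m 0 n / (b n)\<^sup>2) * ((b n)\<^sup>2 * (exp (s / b n) - 1 - s / b n)) -
      s * (((a n - x * Z_fun l (int l - 1) (\<tau> n)) / real n powr e) / (b n / real n powr e))) \<longlonglongrightarrow> s\<^sup>2 / 2" .
  have ecoef_pos: "ecoef f z n > 0" if "z > 0" for z n
    using that f_ge[of 1] f_nonneg by (intro hcoef_pos) auto
  have "\<forall>\<^sub>F n in sequentially. (ln (?G (y n) n) - ln (?G x n)) + (x * ?m 0 n / (b n)\<^sup>2) * ((b n)\<^sup>2 * (exp (s / b n) - 1 - s / b n)) -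
      s * (((a n - x * Z_fun l (int l - 1) (\<tau> n)) / real n powr e) / (b n / real n powr e)) =
    ln (\<integral>\<sigma>. exp (s * ((real (num_orbits n \<sigma>) - a n) / b n)) \<partial>commuting_measure l n x)"
    using evt evb evs powr_pos
  proof eventually_elim
    case (elim n)
    have yp: "y n > 0" using x by (simp add: y_def)
    have lnG: "ln (?G z n) = ln (\<sigma> n) + ln (ecoef f z n) - real n * \<tau> n - z * ?m 0 n" if "z > 0" for z
      using elim(3) ecoef_pos[OF that, of n] by (simp add: ln_mult)
    have "ln (\<integral>\<sigma>. exp (s * ((real (num_orbits n \<sigma>) - a n) / b n)) \<partial>commuting_measure l n x) =
      - (s * (a n / b n)) + (ln (ecoef f (y n) n) - ln (ecoef f x n))"
      unfolding commuting_mgf[OF x] f_def[symmetric] y_def[symmetric]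
      using ecoef_pos[OF yp, of n] ecoef_pos[OF x, of n] by (simp add: ln_mult ln_div)
    also have "\<dots> = (ln (?G (y n) n) - ln (?G x n)) + (y n - x) * ?m 0 n - s * (a n / b n)"
      unfolding lnG[OF yp] lnG[OF x] by (simp add: algebra_simps)
    \<comment> \<open>The term linear in \<open>s / b n\<close> is split off because the centering
      \<open>a n\<close> cancels it up to \<open>lim3\<close>; the second order remainder is the
      quantity of \<open>lim2\<close>.\<close>
    also have "(y n - x) * ?m 0 n = x * ?m 0 n * (exp (s / b n) - 1 - s / b n) + s * (x * ?m 0 n / b n)"
      by (simp add: y_def algebra_simps)
    also have "x * ?m 0 n * (exp (s / b n) - 1 - s / b n) =
      (x * ?m 0 n / (b n)\<^sup>2) * ((b n)\<^sup>2 * (exp (s / b n) - 1 - s / b n))" using elim by simp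
    finally have main: "ln (\<integral>\<sigma>. exp (s * ((real (num_orbits n \<sigma>) - a n) / b n)) \<partial>commuting_measure l n x) =
      ln (?G (y n) n) - ln (?G x n) +
      ((x * ?m 0 n / (b n)\<^sup>2) * ((b n)\<^sup>2 * (exp (s / b n) - 1 - s / b n)) + s * (x * ?m 0 n / b n)) - s * (a n / b n)" .
    have "(D / p) / (q / p) = D / q" if "p > 0" for D p q :: real
      using that by simp
    then have "s * (((a n - x * Z_fun l (int l - 1) (\<tau> n)) / real n powr e) / (b n / real n powr e)) =
      s * (a n / b n) - s * (x * ?m 0 n / b n)"
      using elim Z(2)[OF elim(1)] by (simp only: diff_divide_distrib right_diff_distrib)
    then show ?case unfolding main by linarith
  qed
  with lim show "(\<lambda>n. ln (\<integral>\<sigma>. exp (s * ((real (num_orbits n \<sigma>) - a n) / b n)) \<partial>commuting_measure l n x))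
      \<longlonglongrightarrow> s\<^sup>2 / 2" by (rule Lim_transform_eventually)
qed

end
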